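(* Let $\alpha\in(0,1)$, $t>0$ and $x\in\mathbb{R}$. Let $B^{(\alpha)}$ be $\alpha$-skew Brownian motion started at $x$ (under the probability measure $P_x$), and let $\ell^{(\alpha)}_t$ be its symmetric local time at $0$ up to time $t$. Then the joint law of $(B^{(\alpha)}_t,\ell^{(\alpha)}_t)$ under $P_x$, as a measure on $\mathbb{R}\times[0,\infty)$, is given as follows, where $\delta_0(dl)$ is the unit point mass at $l=0$. (i) If $x\ge 0$, then $$P_x\bigl(B_t^{(\alpha)}\in dy,\ \ell_t^{(\alpha)}\in dl\bigr)=\frac{2(1-\alpha)(l-y+x)}{\sqrt{2\pi t^3}}\exp\Bigl\{-\frac{(l-y+x)^2}{2t}\Bigr\}\,dy\,dl\qquad\text{if } y\le 0,\ l\ge 0,$$ and $$P_x\bigl(B_t^{(\alpha)}\in dy,\ \ell_t^{(\alpha)}\in dl\bigr)=\frac{2\alpha(l+y+x)}{\sqrt{2\pi t^3}}\exp\Bigl\{-\frac{(l+y+x)^2}{2t}\Bigr\}\,dy\,dl+\frac{1}{\sqrt{2\pi t}}\Bigl[\exp\Bigl\{-\frac{(y-x)^2}{2t}\Bigr\}-\exp\Bigl\{-\frac{(y+x)^2}{2t}\Bigr\}\Bigr]\delta_0(dl)\,dy\qquad\text{if } y\ge 0,\ l\ge 0.$$ (ii) If $x\le 0$, then $$P_x\bigl(B_t^{(\alpha)}\in dy,\ \ell_t^{(\alpha)}\in dl\bigr)=\frac{2\alpha(l+y-x)}{\sqrt{2\pi t^3}}\exp\Bigl\{-\frac{(l+y-x)^2}{2t}\Bigr\}\,dy\,dl\qquad\text{if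 } y\ge 0,\ l\ge 0,$$ and $$P_x\bigl(B_t^{(\alpha)}\in dy,\ \ell_t^{(\alpha)}\in dl\bigr)=\frac{2(1-\alpha)(l-y-x)}{\sqrt{2\pi t^3}}\exp\Bigl\{-\frac{(l-y-x)^2}{2t}\Bigr\}\,dy\,dl+\frac{1}{\sqrt{2\pi t}}\Bigl[\exp\Bigl\{-\frac{(y-x)^2}{2t}\Bigr\}-\exp\Bigl\{-\frac{(y+x)^2}{2t}\Bigr\}\Bigr]\delta_0(dl)\,dy\qquad\text{if } y\le 0,\ l\ge 0.$$
   Context: For $\alpha\in(0,1)$, $\alpha$-skew Brownian motion $B^{(\alpha)}$ started at $x\in\mathbb{R}$ is the continuous strong Markov process that is the unique strong solution of $$B^{(\alpha)}_t = x + W_t + (2\alpha-1)\,\ell^{(\alpha)}_t,\qquad t\ge 0,$$ where $W$ is a standard one-dimensional Brownian motion started at $0$ and $\ell^{(\alpha)}$ is the symmetric local time of $B^{(\alpha)}$ at $0$: $$\ell^{(\alpha)}_t=\lim_{\varepsilon\downarrow 0}\frac{1}{2\varepsilon}\int_0^t \mathbf{1}\{|B^{(\alpha)}_s|\le\varepsilon\}\,ds .$$ $P_x$ denotes the law of the process with $B^{(\alpha)}_0=x$. Equivalently, $B^{(\alpha)}$ is obtained from reflected Brownian motion by independently giving each excursion away from $0$ the sign $+$ with probability $\alpha$ and the sign $-$ with probability $1-\alpha$ (with the sign of the initial excursion, if $x\neq0$, being that of $x$). The formulas describe the restrictions of the joint law to $\{y\le 0\}$ and $\{y\ge 0\}$;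 the set $\{y=0\}$ has measure zero, so the overlap at $y=0$ is immaterial. *)

theory Defs
  imports "HOL-Probability.Probability"
begin

text \<open>Processes are indexed by \<^typ>\<open>real\<close>; only times \<open>t \<ge> 0\<close> are ever constrained.\<close>

locale standard_brownian_motion = prob_space M
  for M :: "'a measure" +
  fixes W :: "real \<Rightarrow> 'a \<Rightarrow> real"
  assumes W_measurable: "\<And>t. 0 \<le> t \<Longrightarrow> random_variable borel (W t)"
    and W_start: "AE \<omega> in M. W 0 \<omega> = 0"
    and W_gaussian_increments: "\<And>s t. 0 \<le> s \<Longrightarrow> s < t \<Longrightarrow>
      distributed M lborel (\<lambda>\<omega>. W t \<omega> - W s \<omega>) (normal_density 0 (sqrt (t - s)))"
    and W_indep_increments: "\<And>(n::nat) \<tau>. 0 \<le> \<tau> 0 \<Longrightarrow> strict_mono_on {..n} \<tau> \<Longrightarrow>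
      indep_vars (\<lambda>_. borel) (\<lambda>i \<omega>. W (\<tau> (Suc i)) \<omega> - W (\<tau> i) \<omega>) {..<n}"
    and W_continuous: "AE \<omega> in M. continuous_on {0..} (\<lambda>t. W t \<omega>)"

text \<open>If \<open>M\<close> is not complete, the filtration below is augmented by the measurable null sets only,
  so that it always consists of sub-sigma-algebras of \<open>M\<close>.\<close>

definition completed_natural_filtration ::
  "'a measure \<Rightarrow> (real \<Rightarrow> 'a \<Rightarrow> real) \<Rightarrow> real \<Rightarrow> 'a measure" where
  "completed_natural_filtration M W t =
     sigma (space M)
       ({W s -` A \<inter> space M | s A. 0 \<le> s \<and> s \<le> t \<and> A \<in> sets borel} \<union> null_sets M)"

text \<open>The symmetric local time at \<open>0\<close> of a single path \<open>b\<close>; the existence of the limits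
  is part of the predicate.\<close>

definition is_symmetric_local_time :: "(real \<Rightarrow> real) \<Rightarrow> (real \<Rightarrow> real) \<Rightarrow> bool" where
  "is_symmetric_local_time b l \<longleftrightarrow>
     (\<forall>t\<ge>0. ((\<lambda>\<epsilon>. 1 / (2 * \<epsilon>) * (LBINT s:{0..t}. indicator {s. \<bar>b s\<bar> \<le> \<epsilon>} s))
              \<longlongrightarrow> l t) (at_right 0))"

text \<open>\<open>B\<close> is a strong solution, driven by \<open>W\<close> and started at \<open>x\<close>, of the equation defining
  \<open>\<alpha>\<close>-skew Brownian motion: \<open>B_adapted\<close> is what makes the solution strong.
  The law \<open>P\<^sub>x\<close> is the law of \<open>B\<close> under \<open>M\<close>.\<close>

locale skew_brownian_motion = standard_brownian_motion M W
  for M :: "'a measure" and W :: "real \<Rightarrow> 'a \<Rightarrow> real" +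
  fixes \<alpha> x :: real
    and B :: "real \<Rightarrow> 'a \<Rightarrow> real"
    and L :: "real \<Rightarrow> 'a \<Rightarrow> real"
  assumes B_adapted: "\<And>t. 0 \<le> t \<Longrightarrow>
      B t \<in> borel_measurable (completed_natural_filtration M W t)"
    and B_continuous: "AE \<omega> in M. continuous_on {0..} (\<lambda>t. B t \<omega>)"
    and local_time_measurable: "\<And>t. 0 \<le> t \<Longrightarrow> random_variable borel (L t)"
    and local_time: "AE \<omega> in M. is_symmetric_local_time (\<lambda>s. B s \<omega>) (\<lambda>t. L t \<omega>)"
    and skew_equation: "AE \<omega> in M. \<forall>t\<ge>0. B t \<omega> = x + W t \<omega> + (2 * \<alpha> - 1) * L t \<omega>"

end

theory Submission imports Defs
begin

text \<open>For continuous f, smooth on each closed half line, \<open>exp (- \<theta> l) f b\<close>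
  has no local time term when \<alpha> f'(0+) - (1 - \<alpha>) f'(0-) = \<theta> f(0). The solutions
  of f'' = - k^2 f with this condition form a plane, which for k \<noteq> 0 is spanned by one smooth
  and one even function: the two test functions. Only the smooth one can be expanded directly. For
  the even one, \<open>exp (- \<theta> L)\<close> is replaced by the exponential of minus an
  integrated potential concentrated at 0, and the kinked function by an even smooth function that
  nearly solves the equation with this potential. Its derivative at 0 vanishes, so the skewness
  drops out. Hence \<open>ito_inequality\<close> carries both a local time weight and a potential.
  The potential has height of order 1/\<epsilon>, so errors are measured against its discounted
  total, which is bounded, and not against its maximum; this is the form of the hypothesis on
  \<eta>. The local time part is estimated by differences of \<open>exp (- \<theta> l)\<close>,
  which telescope over the grid to at most 1, whatever the size of L.\<close>

text \<open>
  Both sides are identified by their Robin transforms.  Let \<open>\<gamma> = 2 \<alpha> - 1\<close> and \<open>\<theta> > 0\<close>.  The function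
  \<open>exp (- \<theta> l) (\<theta> sin (k b) + \<gamma> k cos (k b))\<close> is smooth in \<open>b\<close> and its derivative along \<open>(\<gamma>, 1)\<close>
  vanishes at \<open>b = 0\<close>, so the local time does not contribute to the evolution of its expectation along
  \<open>(B, L)\<close>, which therefore decays like \<open>exp (- k\<^sup>2 t / 2)\<close>.  The same holds for
  \<open>exp (- \<theta> l) (\<theta> sin (k \<bar>b\<bar>) + k cos (k b))\<close>, whose kink at \<open>0\<close> is smoothed by means of the approximation of
  \<open>L\<close> by occupation times.  No stochastic integral is needed: a Taylor expansion over a fine grid suffices.
  The claimed law satisfies the same two identities.  They determine the law: the second gives the Fourier
  sine transform of the convolution of the law of \<open>\<bar>b\<bar>\<close> (weighted with \<open>exp (- \<theta> l)\<close>) with an exponential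
  law, the first then separates the two signs of \<open>b\<close>, and letting \<open>\<theta>\<close> vary one inverts the Laplace
  transform in \<open>l\<close>.
\<close>

section \<open>Local time of a continuous path\<close>

text \<open>Uniform continuity bounds the error on each cell by e times its length. Applied to
  paths, it makes time integrals adapted and identifies the limit of the discretised
  potential.\<close>

lemma riemann_sum_tendsto:
  fixes f :: "real \<Rightarrow> real"
  assumes f: "continuous_on {0..t} f" and t: "0 \<le> t"
  shows "(\<lambda>n. t / real n * (\<Sum>i<n. f (real i * (t / real n)))) \<longlonglongrightarrow> integral {0..t} f"
proof (rule LIMSEQ_I)
  fix r :: real assume r: "0 < r"
  \<comment> \<open>The total error is at most e * t < r; the summand 1 covers t = 0.\<close>
  define e where "e = r / (2 * (t + 1))"
  have e: "0 < e" using r t by (simp add: e_def)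
  have "uniformly_continuous_on {0..t} f" using f compact_uniformly_continuous by blast
  then obtain d where d: "0 < d" "\<And>u v. u \<in> {0..t} \<Longrightarrow> v \<in> {0..t} \<Longrightarrow> dist v u < d \<Longrightarrow> dist (f v) (f u) < e"
    unfolding uniformly_continuous_on_def using e by metis
  obtain N :: nat where N: "t / d < real N" using reals_Archimedean2 by blast
  show "\<exists>no. \<forall>n\<ge>no. norm (t / real n * (\<Sum>i<n. f (real i * (t / real n))) - integral {0..t} f) < r"
  proof (intro exI[of _ "Suc N"] allI impI)
    fix n assume n: "Suc N \<le> n"
    define h where "h = t / real n"
    have np: "real n > 0" and Nn: "real N < real n" using n by auto
    have "t / d < real n" using N Nn by simp
    then have hd: "h < d" using d(1) np by (simp add: h_def field_simps)
    have h0: "0 \<le> h" using t by (simp add: h_def)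
    have nh: "real n * h = t" using np by (simp add: h_def)
    have ih: "real i * h \<le> t" if "i \<le> n" for i
      using that h0 by (metis nh mult_right_mono of_nat_le_iff)
    have step: "\<bar>integral {real i * h..real (Suc i) * h} f - h * f (real i * h)\<bar> \<le> e * h" if "i < n" for i
    proof -
      let ?I = "{real i * h..real (Suc i) * h}"
      have sub: "?I \<subseteq> {0..t}"
        using ih[of "Suc i"] that h0 by (auto intro: order_trans[rotated] mult_nonneg_nonneg)
      have c: "continuous_on ?I f" using f sub continuous_on_subset by blast
      have le: "real i * h \<le> real (Suc i) * h" using h0 by (simp add: algebra_simps)
      have "integral ?I f - h * f (real i * h) = integral ?I (\<lambda>s. f s - f (real i * h))"
        using le c by (subst integral_diff) (auto intro: integrable_continuous_interval simp: algebra_simps)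
      moreover have "norm (integral ?I (\<lambda>s. f s - f (real i * h))) \<le> e * (real (Suc i) * h - real i * h)"
      proof (rule integral_bound[OF le])
        show "continuous_on ?I (\<lambda>s. f s - f (real i * h))" by (intro continuous_intros c)
        fix s assume s: "s \<in> ?I"
        have "dist s (real i * h) < d" using s hd by (auto simp: dist_real_def algebra_simps)
        then show "norm (f s - f (real i * h)) \<le> e"
          using d(2)[of "real i * h" s] s sub le by (force simp: dist_norm)
      qed
      ultimately show ?thesis by (simp add: algebra_simps)
    qed
    have comb: "(\<Sum>i<m. integral {real i * h..real (Suc i) * h} f) = integral {0..real m * h} f" if "m \<le> n" for m
      using that
    proof (induction m)
      case (Suc m)
      have "integral {0..real m * h} f + integral {real m * h..real (Suc m) * h} f = integral {0..real (Suc m) * h} f"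
        using h0 ih[of "Suc m"] Suc.prems
        by (intro Henstock_Kurzweil_Integration.integral_combine integrable_continuous_interval
              continuous_on_subset[OF f]) (auto simp: algebra_simps)
      with Suc show ?case by simp
    qed simp
    have "\<bar>h * (\<Sum>i<n. f (real i * h)) - integral {0..t} f\<bar>
        = \<bar>\<Sum>i<n. (integral {real i * h..real (Suc i) * h} f - h * f (real i * h))\<bar>"
      using comb[of n] nh by (simp add: sum_subtractf sum_distrib_left abs_minus_commute)
    also have "\<dots> \<le> (\<Sum>i<n. e * h)"
      using step by (intro order_trans[OF sum_abs] sum_mono) auto
    also have "\<dots> = e * t" using nh by (simp add: algebra_simps)
    also have "\<dots> < r" using r t by (simp add: e_def field_simps) (smt (verit) mult_nonneg_nonneg)
    finally show "norm (t / real n * (\<Sum>i<n. f (real i * (t / real n))) - integral {0..t} f) < r"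
      by (simp add: h_def)
  qed
qed

definition occupation :: "(real \<Rightarrow> real) \<Rightarrow> real \<Rightarrow> real \<Rightarrow> real" where
  "occupation b \<epsilon> t = measure lborel ({0..t} \<inter> {s. \<bar>b s\<bar> \<le> \<epsilon>})"

lemma closed_occupation_set:
  fixes b :: "real \<Rightarrow> real"
  assumes "continuous_on {0..} b"
  shows "closed ({0..t} \<inter> {s. \<bar>b s\<bar> \<le> \<epsilon>})"
proof -
  have "continuous_on {0..t} (\<lambda>s. \<bar>b s\<bar>)"
    by (intro continuous_on_rabs continuous_on_subset[OF assms]) auto
  then have "closed ({0..t} \<inter> (\<lambda>s. \<bar>b s\<bar>) -` {..\<epsilon>})"
    by (intro continuous_closed_preimage) auto
  then show ?thesis by (simp add: vimage_def)
qed

lemma occupation_set_lmeasurable: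
  fixes b :: "real \<Rightarrow> real"
  assumes "continuous_on {0..} b"
  shows "({0..t} \<inter> {s. \<bar>b s\<bar> \<le> \<epsilon>}) \<in> sets borel" "emeasure lborel ({0..t} \<inter> {s. \<bar>b s\<bar> \<le> \<epsilon>}) < \<infinity>"
    "({0..t} \<inter> {s. \<bar>b s\<bar> \<le> \<epsilon>}) \<in> lmeasurable"
proof -
  show 1: "({0..t} \<inter> {s. \<bar>b s\<bar> \<le> \<epsilon>}) \<in> sets borel"
    by (intro borel_closed closed_occupation_set assms)
  show 2: "emeasure lborel ({0..t} \<inter> {s. \<bar>b s\<bar> \<le> \<epsilon>}) < \<infinity>"
    using emeasure_mono[of "{0..t} \<inter> {s. \<bar>b s\<bar> \<le> \<epsilon>}" "{0..t}" lborel] 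
    by (metis emeasure_bounded_finite bounded_Int bounded_closed_interval)
  show "({0..t} \<inter> {s. \<bar>b s\<bar> \<le> \<epsilon>}) \<in> lmeasurable"
    using 1 2 by (simp add: fmeasurable_def)
qed

lemma local_time_occupation:
  assumes "is_symmetric_local_time b l" "0 \<le> t"
  shows "((\<lambda>\<epsilon>. 1 / (2 * \<epsilon>) * occupation b \<epsilon> t) \<longlongrightarrow> l t) (at_right 0)"
proof -
  have eq: "(LBINT s:{0..t}. indicator {s. \<bar>b s\<bar> \<le> \<epsilon>} s) = occupation b \<epsilon> t" for \<epsilon>
    by (simp add: occupation_def set_lebesgue_integral_def indicator_inter_arith[symmetric])
  show ?thesis using assms unfolding is_symmetric_local_time_def eq[symmetric] by blast
qed

lemma occupation_mono:
  assumes "continuous_on {0..} b" "s \<le> t"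
  shows "occupation b \<epsilon> s \<le> occupation b \<epsilon> t"
  unfolding occupation_def
  using assms occupation_set_lmeasurable[OF assms(1)]
  by (intro measure_mono_fmeasurable) (auto simp: fmeasurable_def)

lemma local_time_mono:
  assumes b: "continuous_on {0..} b" and l: "is_symmetric_local_time b l" and "0 \<le> s" "s \<le> t"
  shows "l s \<le> l t"
proof (rule tendsto_le[OF _ local_time_occupation[OF l] local_time_occupation[OF l]])
  show "eventually (\<lambda>\<epsilon>. 1 / (2 * \<epsilon>) * occupation b \<epsilon> s \<le> 1 / (2 * \<epsilon>) * occupation b \<epsilon> t) (at_right 0)"
    using eventually_at_right_less[of 0]
    by eventually_elim (use occupation_mono[OF b \<open>s \<le> t\<close>] in \<open>auto intro: divide_right_mono\<close>)
qed (use assms in auto)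

lemma local_time_0:
  assumes l: "is_symmetric_local_time b l"
  shows "l 0 = 0"
proof -
  have "occupation b \<epsilon> 0 = 0" for \<epsilon>
  proof -
    have "{0..0} \<inter> {s. \<bar>b s\<bar> \<le> \<epsilon>} = {} \<or> {0..0} \<inter> {s. \<bar>b s\<bar> \<le> \<epsilon>} = {0::real}" by auto
    moreover have "measure lborel {0::real} = 0" by (simp only: measure_def emeasure_lborel_singleton enn2real_0)
    ultimately show ?thesis unfolding occupation_def by (elim disjE) (simp_all only: measure_empty)
  qed
  then have "((\<lambda>\<epsilon>::real. 0) \<longlongrightarrow> l 0) (at_right 0)"
    using local_time_occupation[OF l, of 0] by simp
  then show ?thesis using tendsto_unique[OF _ _ tendsto_const] by (metis trivial_limit_at_right_real)
qed

text \<open>On [s, t] the continuous function |b| has a positive minimum d, so for \<epsilon> < d no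
  occupation time is gained there and both limits are taken over the same values.\<close>

lemma local_time_constant_off_zeros:
  assumes b: "continuous_on {0..} b" and l: "is_symmetric_local_time b l" and st: "0 \<le> s" "s \<le> t"
    and nz: "\<And>u. s \<le> u \<Longrightarrow> u \<le> t \<Longrightarrow> b u \<noteq> 0"
  shows "l s = l t"
proof -
  have "continuous_on {s..t} (\<lambda>u. \<bar>b u\<bar>)"
    by (intro continuous_intros continuous_on_subset[OF b]) (use st in auto)
  then obtain v where v: "v \<in> {s..t}" "\<And>u. u \<in> {s..t} \<Longrightarrow> \<bar>b v\<bar> \<le> \<bar>b u\<bar>"
    using continuous_attains_inf[of "{s..t}" "\<lambda>u. \<bar>b u\<bar>"] st by auto
  define d where "d = \<bar>b v\<bar>"
  have d: "0 < d" using nz v(1) by (auto simp: d_def)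
  have eq: "occupation b \<epsilon> s = occupation b \<epsilon> t" if "\<epsilon> < d" for \<epsilon>
  proof -
    have "{0..t} \<inter> {s. \<bar>b s\<bar> \<le> \<epsilon>} = {0..s} \<inter> {s. \<bar>b s\<bar> \<le> \<epsilon>}"
    proof (intro equalityI subsetI)
      fix u assume u: "u \<in> {0..t} \<inter> {s. \<bar>b s\<bar> \<le> \<epsilon>}"
      have "u \<notin> {s..t}" using u v(2)[of u] that by (auto simp: d_def)
      then show "u \<in> {0..s} \<inter> {s. \<bar>b s\<bar> \<le> \<epsilon>}" using u by auto
    qed (use st in auto)
    then show ?thesis by (simp add: occupation_def)
  qed
  have "eventually (\<lambda>\<epsilon>. \<epsilon> < d) (at_right 0)" using d by (simp add: eventually_at_right_field) (use d in blast)
  then have ev: "eventually (\<lambda>\<epsilon>. 1 / (2 * \<epsilon>) * occupation b \<epsilon> t = 1 / (2 * \<epsilon>) * occupation b \<epsilon> s) (at_right 0)"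
    by eventually_elim (simp add: eq)
  have "((\<lambda>\<epsilon>. 1 / (2 * \<epsilon>) * occupation b \<epsilon> s) \<longlongrightarrow> l t) (at_right 0)"
    by (rule Lim_transform_eventually[OF local_time_occupation[OF l] ev]) (use st in auto)
  then show ?thesis
    using local_time_occupation[OF l st(1)] tendsto_unique[of "at_right (0::real)"] by (metis trivial_limit_at_right_real)
qed

text \<open>A continuous substitute for the indicator of [-\<epsilon>, \<epsilon>] divided by
  2\<epsilon>. The linear ramps have width \<epsilon>^2, which is negligible against \<epsilon>, so
  the total mass still tends to 1.\<close>

definition trapezoid :: "real \<Rightarrow> real \<Rightarrow> real" where
  "trapezoid \<epsilon> b = 1 / (2 * \<epsilon>) * min 1 (max 0 ((\<epsilon> * (1 + \<epsilon>) - \<bar>b\<bar>) / \<epsilon>\<^sup>2))"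

lemma trapezoid_minus [simp]: "trapezoid \<epsilon> (- b) = trapezoid \<epsilon> b"
  by (simp add: trapezoid_def)

lemma continuous_on_trapezoid [continuous_intros]:
  "continuous_on S f \<Longrightarrow> continuous_on S (\<lambda>s. trapezoid \<epsilon> (f s))"
  unfolding trapezoid_def divide_inverse
  by (intro continuous_intros)

lemma trapezoid_bounds:
  assumes "0 < \<epsilon>"
  shows "0 \<le> trapezoid \<epsilon> b" "trapezoid \<epsilon> b \<le> 1 / (2 * \<epsilon>)"
    "\<bar>b\<bar> \<le> \<epsilon> \<Longrightarrow> trapezoid \<epsilon> b = 1 / (2 * \<epsilon>)" "\<epsilon> * (1 + \<epsilon>) \<le> \<bar>b\<bar> \<Longrightarrow> trapezoid \<epsilon> b = 0"
proof -
  show "0 \<le> trapezoid \<epsilon> b" using assms unfolding trapezoid_def by simp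
  show "trapezoid \<epsilon> b \<le> 1 / (2 * \<epsilon>)"
    unfolding trapezoid_def using assms by (intro mult_left_le) auto
  show "trapezoid \<epsilon> b = 1 / (2 * \<epsilon>)" if "\<bar>b\<bar> \<le> \<epsilon>"
  proof -
    have "1 \<le> (\<epsilon> * (1 + \<epsilon>) - \<bar>b\<bar>) / \<epsilon>\<^sup>2" using that assms by (simp add: field_simps power2_eq_square)
    then show ?thesis by (simp add: trapezoid_def)
  qed
  show "trapezoid \<epsilon> b = 0" if "\<epsilon> * (1 + \<epsilon>) \<le> \<bar>b\<bar>"
  proof -
    have "(\<epsilon> * (1 + \<epsilon>) - \<bar>b\<bar>) / \<epsilon>\<^sup>2 \<le> 0" using that assms by (simp add: divide_nonpos_pos)
    then show ?thesis by (simp add: trapezoid_def)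
  qed
qed

text \<open>The slope is the height 1/(2\<epsilon>) divided by the ramp width \<epsilon>^2.\<close>

lemma trapezoid_lipschitz:
  assumes "0 < \<epsilon>"
  shows "\<bar>trapezoid \<epsilon> a - trapezoid \<epsilon> b\<bar> \<le> 1 / (2 * \<epsilon> ^ 3) * \<bar>a - b\<bar>"
proof -
  let ?f = "\<lambda>c. (\<epsilon> * (1 + \<epsilon>) - \<bar>c\<bar>) / \<epsilon>\<^sup>2"
  have 1: "\<bar>min 1 (max 0 p) - min 1 (max 0 q)\<bar> \<le> \<bar>p - q\<bar>" for p q :: real by linarith
  have "?f a - ?f b = (\<bar>b\<bar> - \<bar>a\<bar>) / \<epsilon>\<^sup>2" by (simp add: diff_divide_distrib)
  then have 2: "\<bar>?f a - ?f b\<bar> \<le> \<bar>a - b\<bar> / \<epsilon>\<^sup>2"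
    using assms by (auto simp: abs_divide intro!: divide_right_mono)
  have "\<bar>trapezoid \<epsilon> a - trapezoid \<epsilon> b\<bar> = 1 / (2 * \<epsilon>) * \<bar>min 1 (max 0 (?f a)) - min 1 (max 0 (?f b))\<bar>"
    using assms by (simp add: trapezoid_def right_diff_distrib[symmetric] abs_mult del: times_divide_eq_left)
  also have "\<dots> \<le> 1 / (2 * \<epsilon>) * (\<bar>a - b\<bar> / \<epsilon>\<^sup>2)"
    using assms by (intro mult_left_mono order_trans[OF 1 2]) auto
  finally show ?thesis using assms by (simp add: power3_eq_cube power2_eq_square mult.assoc)
qed

text \<open>The trapezoid lies between the scaled indicators of radius \<epsilon> and \<epsilon>(1 +
  \<epsilon>), and both occupation quotients tend to the local time.\<close>

lemma integral_trapezoid_tendsto_local_time: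
  assumes b: "continuous_on {0..} b" and l: "is_symmetric_local_time b l" and t: "0 \<le> t"
  shows "((\<lambda>\<epsilon>. integral {0..t} (\<lambda>s. trapezoid \<epsilon> (b s))) \<longlongrightarrow> l t) (at_right 0)"
proof -
  let ?S = "\<lambda>\<epsilon>. {0..t} \<inter> {s. \<bar>b s\<bar> \<le> \<epsilon>}"
  have int: "(\<lambda>s. indicat_real (?S \<epsilon>) s) integrable_on {0..t}"
    "integral {0..t} (\<lambda>s. indicat_real (?S \<epsilon>) s) = occupation b \<epsilon> t" for \<epsilon>
  proof -
    have m: "?S \<epsilon> \<in> lmeasurable" by (rule occupation_set_lmeasurable[OF b])
    then show "(\<lambda>s. indicat_real (?S \<epsilon>) s) integrable_on {0..t}"
      by (simp add: integrable_on_indicator Int_absorb1 inf_commute)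
    have "integral {0..t} (\<lambda>s. indicat_real (?S \<epsilon>) s) = measure lebesgue (?S \<epsilon> \<inter> {0..t})"
      using m by (intro integral_indicator) (simp add: inf.absorb1 inf.left_commute inf_commute)
    also have "?S \<epsilon> \<inter> {0..t} = ?S \<epsilon>" by auto
    finally show "integral {0..t} (\<lambda>s. indicat_real (?S \<epsilon>) s) = occupation b \<epsilon> t"
      using occupation_set_lmeasurable[OF b] by (simp add: occupation_def)
  qed
  have tint: "(\<lambda>s. trapezoid \<epsilon> (b s)) integrable_on {0..t}" for \<epsilon>
    by (intro integrable_continuous_interval continuous_intros continuous_on_subset[OF b]) auto
  have lower: "1 / (2 * \<epsilon>) * occupation b \<epsilon> t \<le> integral {0..t} (\<lambda>s. trapezoid \<epsilon> (b s))" if "0 < \<epsilon>" for \<epsilon>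
  proof -
    have "integral {0..t} (\<lambda>s. 1 / (2 * \<epsilon>) * indicat_real (?S \<epsilon>) s) \<le> integral {0..t} (\<lambda>s. trapezoid \<epsilon> (b s))"
      using trapezoid_bounds[OF that] that
      by (intro integral_le tint integrable_on_mult_right int) (auto simp: indicator_def)
    then show ?thesis by (simp add: int)
  qed
  \<comment> \<open>Renormalising the larger radius \<epsilon>(1 + \<epsilon>) by its own length
    costs the factor 1 + \<epsilon>, which tends to 1.\<close>
  have upper: "integral {0..t} (\<lambda>s. trapezoid \<epsilon> (b s)) \<le> (1 + \<epsilon>) * (1 / (2 * (\<epsilon> * (1 + \<epsilon>))) * occupation b (\<epsilon> * (1 + \<epsilon>)) t)"
    if "0 < \<epsilon>" for \<epsilon>
  proof -
    have "integral {0..t} (\<lambda>s. trapezoid \<epsilon> (b s)) \<le> integral {0..t} (\<lambda>s. 1 / (2 * \<epsilon>) * indicat_real (?S (\<epsilon> * (1 + \<epsilon>))) s)"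
      using trapezoid_bounds[OF that] that
      by (intro integral_le tint integrable_on_mult_right int) (auto simp: indicator_def)
    then show ?thesis using that by (simp add: int)
  qed
  have lim: "((\<lambda>\<epsilon>. 1 / (2 * \<epsilon>) * occupation b \<epsilon> t) \<longlongrightarrow> l t) (at_right 0)"
    by (rule local_time_occupation[OF l t])
  have flt: "filterlim (\<lambda>\<epsilon>::real. \<epsilon> * (1 + \<epsilon>)) (at_right 0) (at_right 0)"
    unfolding filterlim_at
  proof
    show "eventually (\<lambda>\<epsilon>::real. \<epsilon> * (1 + \<epsilon>) \<in> {0<..} \<and> \<epsilon> * (1 + \<epsilon>) \<noteq> 0) (at_right 0)"
      using eventually_at_right_less[of 0] by eventually_elim (auto simp: add_pos_pos)
    have "((\<lambda>\<epsilon>::real. \<epsilon> * (1 + \<epsilon>)) \<longlongrightarrow> 0 * (1 + 0)) (at_right 0)" by (intro tendsto_intros)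
    then show "((\<lambda>\<epsilon>::real. \<epsilon> * (1 + \<epsilon>)) \<longlongrightarrow> 0) (at_right 0)" by simp
  qed
  have "((\<lambda>\<epsilon>. (1 + \<epsilon>) * (1 / (2 * (\<epsilon> * (1 + \<epsilon>))) * occupation b (\<epsilon> * (1 + \<epsilon>)) t)) \<longlongrightarrow> (1 + 0) * l t) (at_right 0)"
    by (intro tendsto_intros filterlim_compose[OF lim flt])
  then have lim': "((\<lambda>\<epsilon>. (1 + \<epsilon>) * (1 / (2 * (\<epsilon> * (1 + \<epsilon>))) * occupation b (\<epsilon> * (1 + \<epsilon>)) t)) \<longlongrightarrow> l t) (at_right 0)"
    by simp
  show ?thesis
    by (rule tendsto_sandwich[OF _ _ lim lim'])
      (use eventually_at_right_less[of "0::real"] lower upper in \<open>auto elim!: eventually_mono\<close>)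
qed

section \<open>The Brownian filtration\<close>

context standard_brownian_motion
begin

lemma prob_cong_AE:
  assumes "A \<in> events" "B \<in> events" "AE \<omega> in M. \<omega> \<in> A \<longleftrightarrow> \<omega> \<in> B"
  shows "prob A = prob B"
  using assms by (intro finite_measure_eq_AE)

text \<open>Off the null set where W 0 \<noteq> 0, the positions up to index n are partial sums of
  the first n increments, and this block is independent of the last increment.\<close>

lemma grid_indep_increment:
  fixes \<tau> :: "nat \<Rightarrow> real" and A :: "nat \<Rightarrow> real set"
  assumes \<tau>: "\<tau> 0 = 0" "strict_mono_on {..Suc n} \<tau>"
    and A: "\<And>i. A i \<in> sets borel" and C: "C \<in> sets borel"
  shows "prob ({\<omega>\<in>space M. \<forall>i\<le>n. W (\<tau> i) \<omega> \<in> A i} \<inter> {\<omega>\<in>space M. W (\<tau> (Suc n)) \<omega> - W (\<tau> n) \<omega> \<in> C})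
    = prob {\<omega>\<in>space M. \<forall>i\<le>n. W (\<tau> i) \<omega> \<in> A i} * prob {\<omega>\<in>space M. W (\<tau> (Suc n)) \<omega> - W (\<tau> n) \<omega> \<in> C}"
proof -
  define X where "X i \<omega> = W (\<tau> (Suc i)) \<omega> - W (\<tau> i) \<omega>" for i \<omega>
  have \<tau>0: "0 \<le> \<tau> i" if "i \<le> Suc n" for i
    using \<tau> that strict_mono_onD[OF \<tau>(2), of 0 i] by (cases "i = 0") auto
  have Wm [measurable]: "random_variable borel (W (\<tau> i))" if "i \<le> Suc n" for i
    using W_measurable[OF \<tau>0[OF that]] .
  have "indep_vars (\<lambda>_. borel) X {..<Suc n}"
    unfolding X_def using W_indep_increments[of \<tau> "Suc n"] \<tau> by simp
  \<comment> \<open>Split the n + 1 independent increments into the block of the first n and the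
    last one.\<close>
  then have iv: "indep_var (PiM {..<n} (\<lambda>_. borel)) (\<lambda>\<omega>. restrict (\<lambda>i. X i \<omega>) {..<n})
                    (PiM {n} (\<lambda>_. borel)) (\<lambda>\<omega>. restrict (\<lambda>i. X i \<omega>) {n})"
    by (rule indep_var_restrict) auto
  let ?P1 = "PiM {..<n} (\<lambda>_. borel :: real measure)" and ?P2 = "PiM {n} (\<lambda>_. borel :: real measure)"
  define S1 where "S1 = {f \<in> space ?P1. \<forall>i\<in>{..n}. (\<Sum>j<i. f j) \<in> A i}"
  define S2 where "S2 = {f \<in> space ?P2. f n \<in> C}"
  have S1: "S1 \<in> sets ?P1"
    unfolding S1_def
  proof (rule sets.sets_Collect_finite_All)
    fix i assume i: "i \<in> {..n}"
    have [measurable]: "(\<lambda>f. \<Sum>j<i. f j) \<in> borel_measurable ?P1"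
      using i by (intro borel_measurable_sum measurable_component_singleton) auto
    show "{f \<in> space ?P1. (\<Sum>j<i. f j) \<in> A i} \<in> sets ?P1"
      using A[of i] by measurable
  qed (rule finite_atMost)
  have S2: "S2 \<in> sets ?P2"
  proof -
    have [measurable]: "(\<lambda>f. f n) \<in> borel_measurable ?P2"
      by (intro measurable_component_singleton) auto
    show ?thesis unfolding S2_def using C by measurable
  qed
  let ?E1 = "(\<lambda>\<omega>. restrict (\<lambda>i. X i \<omega>) {..<n}) -` S1 \<inter> space M"
  let ?E2 = "(\<lambda>\<omega>. restrict (\<lambda>i. X i \<omega>) {n}) -` S2 \<inter> space M"
  let ?E1' = "{\<omega>\<in>space M. \<forall>i\<le>n. W (\<tau> i) \<omega> \<in> A i}"
  let ?E2' = "{\<omega>\<in>space M. W (\<tau> (Suc n)) \<omega> - W (\<tau> n) \<omega> \<in> C}"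
  have rv: "random_variable ?P1 (\<lambda>\<omega>. restrict (\<lambda>i. X i \<omega>) {..<n})" "random_variable ?P2 (\<lambda>\<omega>. restrict (\<lambda>i. X i \<omega>) {n})"
    using iv by (auto simp: indep_var_eq)
  have ind: "prob (?E1 \<inter> ?E2) = prob ?E1 * prob ?E2"
  proof -
    have "prob ((\<lambda>\<omega>. (restrict (\<lambda>i. X i \<omega>) {..<n}, restrict (\<lambda>i. X i \<omega>) {n})) -` (S1 \<times> S2) \<inter> space M) = prob ?E1 * prob ?E2"
      using indep_varD[OF iv S1 S2] .
    moreover have "(\<lambda>\<omega>. (restrict (\<lambda>i. X i \<omega>) {..<n}, restrict (\<lambda>i. X i \<omega>) {n})) -` (S1 \<times> S2) \<inter> space M = ?E1 \<inter> ?E2"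
      by auto
    ultimately show ?thesis by simp
  qed
  have e1: "?E1 \<in> events" "?E2 \<in> events"
    using measurable_sets[OF rv(1) S1] measurable_sets[OF rv(2) S2] by auto
  have e2: "?E1' \<in> events"
  proof -
    have "{\<omega>\<in>space M. \<forall>i\<in>{..n}. W (\<tau> i) \<omega> \<in> A i} \<in> events"
    proof (rule sets.sets_Collect_finite_All)
      fix i assume "i \<in> {..n}"
      then have [measurable]: "random_variable borel (W (\<tau> i))" by (intro Wm) auto
      show "{\<omega> \<in> space M. W (\<tau> i) \<omega> \<in> A i} \<in> events" using A[of i] by measurable
    qed (rule finite_atMost)
    moreover have "{\<omega>\<in>space M. \<forall>i\<in>{..n}. W (\<tau> i) \<omega> \<in> A i} = ?E1'" by blast
    ultimately show ?thesis by (simp only:)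
  qed
  have E2: "?E2 = ?E2'"
    by (auto simp: S2_def X_def space_PiM PiE_def)
  have sumX: "(\<Sum>j<i. X j \<omega>) = W (\<tau> i) \<omega> - W (\<tau> 0) \<omega>" for i \<omega>
    by (induction i) (auto simp: X_def)
  have ae: "AE \<omega> in M. \<omega> \<in> ?E1 \<longleftrightarrow> \<omega> \<in> ?E1'"
    using W_start AE_space
  proof eventually_elim
    case (elim \<omega>)
    have "(\<Sum>j<i. restrict (\<lambda>i. X i \<omega>) {..<n} j) = W (\<tau> i) \<omega>" if "i \<le> n" for i
    proof -
      have "(\<Sum>j<i. restrict (\<lambda>i. X i \<omega>) {..<n} j) = (\<Sum>j<i. X j \<omega>)"
        using that by (intro sum.cong) auto
      then show ?thesis using sumX[of \<omega> i] elim \<tau>(1) by simp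
    qed
    then show ?case using elim
      by (auto simp: S1_def space_PiM)
  qed
  have p1: "prob ?E1 = prob ?E1'" by (rule prob_cong_AE[OF e1(1) e2 ae])
  have p2: "prob (?E1 \<inter> ?E2') = prob (?E1' \<inter> ?E2')"
  proof (rule prob_cong_AE)
    show "?E1 \<inter> ?E2' \<in> events" "?E1' \<inter> ?E2' \<in> events"
      using e1 e2 unfolding E2 by (rule_tac [!] sets.Int)
    show "AE \<omega> in M. \<omega> \<in> ?E1 \<inter> ?E2' \<longleftrightarrow> \<omega> \<in> ?E1' \<inter> ?E2'"
      using ae by eventually_elim blast
  qed
  show ?thesis using ind unfolding E2 p1 p2 .
qed

text \<open>Finite-dimensional cylinder events up to time s. Arbitrary finite index sets, in place
  of ordered grids, make the family visibly closed under intersection.\<close>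

definition past_events :: "real \<Rightarrow> 'a set set" where
  "past_events s = {{\<omega>\<in>space M. \<forall>j\<in>J. W j \<omega> \<in> A j} | J A. finite J \<and> J \<subseteq> {0..s} \<and> (\<forall>j. A j \<in> sets borel)}"

lemma past_events_measurable: "past_events s \<subseteq> events"
proof
  fix E assume "E \<in> past_events s"
  then obtain J A where E: "E = {\<omega>\<in>space M. \<forall>j\<in>J. W j \<omega> \<in> A j}" "finite J" "J \<subseteq> {0..s}" "\<And>j. A j \<in> sets borel"
    by (auto simp: past_events_def)
  show "E \<in> events" unfolding E(1)
  proof (rule sets.sets_Collect_finite_All[OF _ E(2)])
    fix j assume "j \<in> J"
    then have [measurable]: "random_variable borel (W j)" using E(3) by (intro W_measurable) auto
    show "{\<omega> \<in> space M. W j \<omega> \<in> A j} \<in> events" using E(4)[of j] by measurable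
  qed
qed

text \<open>Sorting the finitely many times turns the cylinder into a grid event; times that were
  only added to complete the grid carry the trivial condition \<open>UNIV\<close>.\<close>

lemma past_events_indep_increment:
  assumes s: "0 \<le> s" "s < u" and E: "E \<in> past_events s" and C: "C \<in> sets borel"
  shows "prob (E \<inter> {\<omega>\<in>space M. W u \<omega> - W s \<omega> \<in> C}) = prob E * prob {\<omega>\<in>space M. W u \<omega> - W s \<omega> \<in> C}"
proof -
  obtain J A where J: "E = {\<omega>\<in>space M. \<forall>j\<in>J. W j \<omega> \<in> A j}" "finite J" "J \<subseteq> {0..s}" "\<And>j. A j \<in> sets borel"
    using E by (auto simp: past_events_def)
  \<comment> \<open>The times 0 and s are inserted so that the sorted grid starts at 0 and has s as
    its last point before u, as \<open>grid_indep_increment\<close> requires.\<close>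
  define K where "K = insert 0 (insert s J)"
  define xs where "xs = sorted_list_of_set K"
  have K: "finite K" "K \<noteq> {}" using J by (auto simp: K_def)
  have xs: "set xs = K" "sorted xs" "distinct xs" "length xs = card K"
    using K by (auto simp: xs_def)
  define n where "n = card K - 1"
  have n: "length xs = Suc n" using K xs by (simp add: n_def card_gt_0_iff)
  have sm: "xs ! i < xs ! j" if "i < j" "j < length xs" for i j
    using that xs sorted_nth_mono[of xs i j] nth_eq_iff_index_eq[of xs i j] by fastforce
  have mem: "xs ! i \<in> K" if "i \<le> n" for i using that n xs(1) nth_mem[of i xs] by simp
  define \<tau> where "\<tau> i = (if i \<le> n then xs ! i else u)" for i
  have Kb: "k \<in> {0..s}" if "k \<in> K" for k using that J s by (auto simp: K_def)
  have \<tau>0: "\<tau> 0 = 0"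
  proof -
    obtain i where i: "i < length xs" "xs ! i = 0" using xs(1) in_set_conv_nth[of 0 xs] by (auto simp: K_def)
    have "xs ! 0 \<le> xs ! i" using xs(2) i by (intro sorted_nth_mono) auto
    then show ?thesis using Kb[OF mem[of 0]] i by (auto simp: \<tau>_def)
  qed
  have \<tau>n: "\<tau> n = s"
  proof -
    obtain i where i: "i < length xs" "xs ! i = s" using xs(1) in_set_conv_nth[of s xs] by (auto simp: K_def)
    have "xs ! i \<le> xs ! n" using xs(2) i n by (intro sorted_nth_mono) auto
    then show ?thesis using Kb[OF mem[of n]] i by (auto simp: \<tau>_def)
  qed
  have \<tau>S: "\<tau> (Suc n) = u" by (simp add: \<tau>_def)
  have smt: "strict_mono_on {..Suc n} \<tau>"
  proof (rule strict_mono_onI)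
    fix i j assume ij: "i \<in> {..Suc n}" "j \<in> {..Suc n}" "i < j"
    show "\<tau> i < \<tau> j"
    proof (cases "j = Suc n")
      case True
      then have "i \<le> n" using ij by auto
      then have "xs ! i \<le> s" using Kb[OF mem[of i]] by auto
      with True \<open>i \<le> n\<close> s show ?thesis by (simp add: \<tau>_def)
    next
      case False
      with ij sm[of i j] n show ?thesis by (simp add: \<tau>_def)
    qed
  qed
  define A' where "A' i = (if \<tau> i \<in> J then A (\<tau> i) else UNIV)" for i
  have E': "E = {\<omega>\<in>space M. \<forall>i\<le>n. W (\<tau> i) \<omega> \<in> A' i}"
  proof -
    have "(\<forall>j\<in>J. W j \<omega> \<in> A j) \<longleftrightarrow> (\<forall>i\<le>n. W (\<tau> i) \<omega> \<in> A' i)" for \<omega>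
    proof
      assume *: "\<forall>i\<le>n. W (\<tau> i) \<omega> \<in> A' i"
      show "\<forall>j\<in>J. W j \<omega> \<in> A j"
      proof
        fix j assume j: "j \<in> J"
        then have "j \<in> set xs" using xs(1) by (simp add: K_def)
        then obtain i where i: "i \<le> n" "xs ! i = j" by (metis in_set_conv_nth less_Suc_eq_le n)
        then have "\<tau> i = j" by (simp add: \<tau>_def)
        then show "W j \<omega> \<in> A j" using *[rule_format, OF i(1)] j by (simp add: A'_def)
      qed
    qed (auto simp: A'_def)
    then show ?thesis using J(1) by auto
  qed
  have A': "A' i \<in> sets borel" for i using J(4) by (simp add: A'_def)
  show ?thesis
    using grid_indep_increment[of \<tau> n A' C, OF \<tau>0 smt A' C] unfolding E'[symmetric] \<tau>n \<tau>S .
qed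

text \<open>The null sets are adjoined because they belong to the generator of the completed
  filtration; meeting any event with one of them gives a null set again.\<close>

lemma Int_stable_past_events: "Int_stable (past_events s \<union> null_sets M)"
proof (rule Int_stableI)
  fix E F assume "E \<in> past_events s \<union> null_sets M" "F \<in> past_events s \<union> null_sets M"
  then consider "E \<in> null_sets M" "F \<in> events" | "F \<in> null_sets M" "E \<in> events"
    | "E \<in> past_events s" "F \<in> past_events s"
    using past_events_measurable by (metis UnE null_setsD2 subsetD)
  then show "E \<inter> F \<in> past_events s \<union> null_sets M"
  proof cases
    case 3
    from 3(1) obtain J A where E: "E = {\<omega>\<in>space M. \<forall>j\<in>J. W j \<omega> \<in> A j}" "finite J" "J \<subseteq> {0..s}" "\<And>j. A j \<in> sets borel"
      by (auto simp: past_events_def)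
    from 3(2) obtain J' A' where F: "F = {\<omega>\<in>space M. \<forall>j\<in>J'. W j \<omega> \<in> A' j}" "finite J'" "J' \<subseteq> {0..s}" "\<And>j. A' j \<in> sets borel"
      by (auto simp: past_events_def)
    define D where "D j = (if j \<in> J then A j else UNIV) \<inter> (if j \<in> J' then A' j else UNIV)" for j
    have "E \<inter> F = {\<omega>\<in>space M. \<forall>j\<in>J \<union> J'. W j \<omega> \<in> D j}"
      unfolding E F by (auto simp: D_def)
    moreover have "\<forall>j. D j \<in> sets borel" using E F by (auto simp: D_def)
    ultimately have "E \<inter> F \<in> past_events s"
      using E(2,3) F(2,3) unfolding past_events_def by (intro CollectI exI[of _ "J \<union> J'"] exI[of _ D]) auto
    then show ?thesis by simp
  qed (auto simp: null_set_Int1 null_set_Int2)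
qed

lemma space_filtration [simp]: "space (completed_natural_filtration M W s) = space M"
  unfolding completed_natural_filtration_def by (rule space_measure_of) (auto dest: null_setsD2 sets.sets_into_space)

lemma sets_filtration:
  "sets (completed_natural_filtration M W t) =
     sigma_sets (space M) ({W s -` A \<inter> space M | s A. 0 \<le> s \<and> s \<le> t \<and> A \<in> sets borel} \<union> null_sets M)"
  unfolding completed_natural_filtration_def by (rule sets_measure_of) (auto dest: null_setsD2 sets.sets_into_space)

lemma filtration_subset_events: "sets (completed_natural_filtration M W t) \<subseteq> events"
  unfolding sets_filtration
  by (rule sets.sigma_sets_subset) (auto intro: measurable_sets[OF W_measurable])

lemma filtration_mono:
  "s \<le> t \<Longrightarrow> sets (completed_natural_filtration M W s) \<subseteq> sets (completed_natural_filtration M W t)"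
  unfolding sets_filtration by (rule sigma_sets_mono') (intro Un_mono subset_refl; fastforce)

lemma filtration_measurable_mono:
  "f \<in> borel_measurable (completed_natural_filtration M W s) \<Longrightarrow> s \<le> t \<Longrightarrow>
    f \<in> borel_measurable (completed_natural_filtration M W t)"
  using filtration_mono[of s t] by (auto simp: measurable_def)

lemma filtration_measurable_M:
  "f \<in> borel_measurable (completed_natural_filtration M W s) \<Longrightarrow> f \<in> borel_measurable M"
  using filtration_subset_events[of s] by (auto simp: measurable_def)

lemma null_sets_filtration: "N \<in> null_sets M \<Longrightarrow> N \<in> sets (completed_natural_filtration M W t)"
  unfolding sets_filtration by auto

text \<open>Every measurable null set belongs to the filtration, so f can be changed on one. As M
  may be incomplete, measurability of g over M is what makes its preimages inside the exceptional
  set measurable null sets.\<close>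

lemma filtration_measurable_AE_cong:
  assumes f: "f \<in> borel_measurable (completed_natural_filtration M W s)"
    and g: "g \<in> borel_measurable M" and ae: "AE \<omega> in M. f \<omega> = g \<omega>"
  shows "g \<in> borel_measurable (completed_natural_filtration M W s)"
proof (rule measurableI)
  fix A :: "'b set" assume A: "A \<in> sets borel"
  obtain N where N: "{\<omega>\<in>space M. f \<omega> \<noteq> g \<omega>} \<subseteq> N" "N \<in> null_sets M"
    using AE_E2[OF ae] ae by (auto elim!: AE_E simp: null_sets_def)
  have 1: "g -` A \<inter> space M \<inter> N \<in> null_sets M"
    using N(2) measurable_sets[OF g A] by (auto intro: null_set_Int1)
  have 2: "f -` A \<inter> space M - N \<in> sets (completed_natural_filtration M W s)"
    using measurable_sets[OF f A] null_sets_filtration[OF N(2)] by auto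
  have eq: "g -` A \<inter> space M = (f -` A \<inter> space M - N) \<union> (g -` A \<inter> space M \<inter> N)"
    using N(1) by auto
  have "(f -` A \<inter> space M - N) \<union> (g -` A \<inter> space M \<inter> N) \<in> sets (completed_natural_filtration M W s)"
    by (intro sets.Un 2 null_sets_filtration 1)
  then show "g -` A \<inter> space (completed_natural_filtration M W s) \<in> sets (completed_natural_filtration M W s)"
    unfolding space_filtration eq[symmetric] .
qed auto

text \<open>Cylinder events and null sets form an intersection-stable generator on which
  independence is known (trivially for null sets); it extends to the generated
  sigma-algebras.\<close>

lemma filtration_indep_increment:
  assumes s: "0 \<le> s" "s < u" and f: "f \<in> borel_measurable (completed_natural_filtration M W s)"
  shows "indep_var borel f borel (\<lambda>\<omega>. W u \<omega> - W s \<omega>)"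
proof -
  let ?D = "\<lambda>\<omega>. W u \<omega> - W s \<omega>"
  have [measurable]: "random_variable borel (W s)" "random_variable borel (W u)" using s by (auto intro: W_measurable)
  define Pi where "Pi = past_events s \<union> null_sets M"
  define Ds where "Ds = {?D -` A \<inter> space M | A. A \<in> sets borel}"
  have "indep_set Pi Ds"
  proof (rule indep_setI)
    show "Pi \<subseteq> events" using past_events_measurable by (auto simp: Pi_def)
    show "Ds \<subseteq> events" by (auto simp: Ds_def intro: measurable_sets)
    fix E F assume E: "E \<in> Pi" and F: "F \<in> Ds"
    then obtain C where C: "F = {\<omega>\<in>space M. ?D \<omega> \<in> C}" "C \<in> sets borel" by (auto simp: Ds_def)
    show "prob (E \<inter> F) = prob E * prob F"
    proof (cases "E \<in> null_sets M")
      case True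
      then have "E \<inter> F \<in> null_sets M" using F \<open>Ds \<subseteq> events\<close> by (intro null_set_Int2) auto
      then show ?thesis using True by (simp add: measure_eq_0_null_sets)
    next
      case False
      then show ?thesis using past_events_indep_increment[OF s _ C(2)] E C(1) by (auto simp: Pi_def)
    qed
  qed
  moreover have "Int_stable Ds"
  proof (rule Int_stableI)
    fix E F assume "E \<in> Ds" "F \<in> Ds"
    then obtain A B where "E = ?D -` A \<inter> space M" "F = ?D -` B \<inter> space M" "A \<in> sets borel" "B \<in> sets borel"
      by (auto simp: Ds_def)
    then show "E \<inter> F \<in> Ds" unfolding Ds_def by (intro CollectI exI[of _ "A \<inter> B"]) auto
  qed
  ultimately have ind: "indep_set (sigma_sets (space M) Pi) (sigma_sets (space M) Ds)"
    using Int_stable_past_events[of s] by (intro indep_set_sigma_sets) (auto simp: Pi_def)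
  have "{W r -` A \<inter> space M | r A. 0 \<le> r \<and> r \<le> s \<and> A \<in> sets borel} \<union> null_sets M \<subseteq> Pi"
  proof -
    have "W r -` A \<inter> space M \<in> past_events s" if "0 \<le> r" "r \<le> s" "A \<in> sets borel" for r A
      unfolding past_events_def using that
      by (intro CollectI exI[of _ "{r}"] exI[of _ "\<lambda>_. A"]) auto
    then show ?thesis by (auto simp: Pi_def)
  qed
  then have "sets (completed_natural_filtration M W s) \<subseteq> sigma_sets (space M) Pi"
    unfolding sets_filtration by (rule sigma_sets_mono')
  then have sub: "sigma_sets (space M) {f -` A \<inter> space M | A. A \<in> sets borel} \<subseteq> sigma_sets (space M) Pi"
    using measurable_sets[OF f] by (intro sigma_sets_mono) auto
  show ?thesis
    unfolding indep_var_eq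
  proof (intro conjI)
    show "indep_set (sigma_sets (space M) {f -` A \<inter> space M | A. A \<in> sets borel})
       (sigma_sets (space M) {?D -` A \<inter> space M | A. A \<in> sets borel})"
      using ind sub unfolding Ds_def indep_sets2_eq by blast
  qed (use filtration_measurable_M[OF f] in auto)
qed

end

section \<open>One step of the heat flow with a potential\<close>

text \<open>Along the line c + \<gamma> v the derivative of
  \<open>exp (- \<theta> * v) * g (c + \<gamma> * v)\<close> is at most C
  \<open>exp (- \<theta> * v)\<close> in size, which is minus the derivative of C/\<theta> times the
  weight. Keeping the bound as a difference of weights lets it telescope over a grid.\<close>

lemma exp_weighted_drift_bound:
  fixes g g' :: "real \<Rightarrow> real"
  assumes g: "\<And>b. (g has_real_derivative g' b) (at b)"
    and "0 < \<theta>" "l0 \<le> l1"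
    and C: "\<And>v. l0 \<le> v \<Longrightarrow> v \<le> l1 \<Longrightarrow> \<bar>\<gamma> * g' (c + \<gamma> * v) - \<theta> * g (c + \<gamma> * v)\<bar> \<le> C"
  shows "\<bar>exp (- \<theta> * l1) * g (c + \<gamma> * l1) - exp (- \<theta> * l0) * g (c + \<gamma> * l0)\<bar>
    \<le> C / \<theta> * (exp (- \<theta> * l0) - exp (- \<theta> * l1))"
proof -
  let ?f = "\<lambda>v. exp (- \<theta> * v) * g (c + \<gamma> * v)" and ?k = "\<lambda>v. C / \<theta> * exp (- \<theta> * v)"
  let ?d = "\<lambda>v. \<gamma> * g' (c + \<gamma> * v) - \<theta> * g (c + \<gamma> * v)"
  have f: "(?f has_real_derivative exp (- \<theta> * v) * ?d v) (at v)" for v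
    by (rule derivative_eq_intros DERIV_chain2[OF g] refl | simp add: algebra_simps)+
  have k: "(?k has_real_derivative - (C * exp (- \<theta> * v))) (at v)" for v
    by (rule derivative_eq_intros refl)+ (use \<open>0 < \<theta>\<close> in \<open>simp\<close>)
  have d: "exp (- \<theta> * v) * ?d v \<le> C * exp (- \<theta> * v)" "- (C * exp (- \<theta> * v)) \<le> exp (- \<theta> * v) * ?d v"
    if "l0 \<le> v" "v \<le> l1" for v
  proof -
    have "\<bar>?d v\<bar> * exp (- \<theta> * v) \<le> C * exp (- \<theta> * v)" using C[OF that] by (intro mult_right_mono) auto
    then have "\<bar>exp (- \<theta> * v) * ?d v\<bar> \<le> C * exp (- \<theta> * v)" by (simp add: abs_mult mult.commute)
    then show "exp (- \<theta> * v) * ?d v \<le> C * exp (- \<theta> * v)" "- (C * exp (- \<theta> * v)) \<le> exp (- \<theta> * v) * ?d v" by linarith+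
  qed
  have "?f l1 + ?k l1 \<le> ?f l0 + ?k l0"
    using \<open>l0 \<le> l1\<close>
  proof (rule DERIV_nonpos_imp_nonincreasing)
    fix v assume v: "l0 \<le> v" "v \<le> l1"
    show "\<exists>y. ((\<lambda>v. ?f v + ?k v) has_real_derivative y) (at v) \<and> y \<le> 0"
      by (intro exI conjI, rule DERIV_add[OF f k]) (use d[OF v] in linarith)
  qed
  moreover have "?k l1 - ?f l1 \<le> ?k l0 - ?f l0"
    using \<open>l0 \<le> l1\<close>
  proof (rule DERIV_nonpos_imp_nonincreasing)
    fix v assume v: "l0 \<le> v" "v \<le> l1"
    show "\<exists>y. ((\<lambda>v. ?k v - ?f v) has_real_derivative y) (at v) \<and> y \<le> 0"
      by (intro exI conjI, rule DERIV_diff[OF k f]) (use d[OF v] in linarith)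
  qed
  ultimately show ?thesis by (simp add: right_diff_distrib abs_le_iff)
qed

lemma taylor2_lipschitz:
  fixes g g' g'' :: "real \<Rightarrow> real"
  assumes g: "\<And>b. (g has_real_derivative g' b) (at b)" and g': "\<And>b. (g' has_real_derivative g'' b) (at b)"
    and K: "\<And>a b. \<bar>g'' a - g'' b\<bar> \<le> K * \<bar>a - b\<bar>"
  shows "\<bar>g (b + y) - g b - g' b * y - g'' b / 2 * y\<^sup>2\<bar> \<le> K * \<bar>y\<bar> ^ 3"
proof -
  \<comment> \<open>The list of derivatives in Maclaurin's formula; order two reads it only at 0, 1
    and 2.\<close>
  define diff where "diff m = (\<lambda>v. (if m = 0 then g else if m = 1 then g' else g'') (b + v))" for m :: nat
  have K0: "0 \<le> K" using K[of 1 0] by (smt (verit) abs_ge_zero mult_cancel_left1)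
  have "\<forall>m v. m < 2 \<and> \<bar>v\<bar> \<le> \<bar>y\<bar> \<longrightarrow> DERIV (diff m) v :> diff (Suc m) v"
  proof (intro allI impI)
    fix m :: nat and v assume "m < 2 \<and> \<bar>v\<bar> \<le> \<bar>y\<bar>"
    then have "m = 0 \<or> m = 1" by auto
    then show "DERIV (diff m) v :> diff (Suc m) v"
      using DERIV_shift[of g "g' (b + v)" v b] DERIV_shift[of g' "g'' (b + v)" v b] g[of "b + v"] g'[of "b + v"]
      by (auto simp: diff_def add.commute)
  qed
  then obtain v where v: "\<bar>v\<bar> \<le> \<bar>y\<bar>" "g (b + y) = (\<Sum>m<2. diff m 0 / fact m * y ^ m) + diff 2 v / fact 2 * y ^ 2"
    using Maclaurin_bi_le[of diff "\<lambda>y. g (b + y)" 2 y] by (auto simp: diff_def)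
  then have "g (b + y) - g b - g' b * y - g'' b / 2 * y\<^sup>2 = (g'' (b + v) - g'' b) / 2 * y\<^sup>2"
    by (simp add: diff_def numeral_2_eq_2 field_simps)
  moreover have "\<bar>(g'' (b + v) - g'' b) / 2\<bar> * y\<^sup>2 \<le> (K * \<bar>y\<bar>) * y\<^sup>2"
  proof (rule mult_right_mono)
    have "\<bar>g'' (b + v) - g'' b\<bar> \<le> K * \<bar>v\<bar>" using K[of "b + v" b] by simp
    also have "\<dots> \<le> K * \<bar>y\<bar>" using v(1) K0 by (rule mult_left_mono)
    finally show "\<bar>(g'' (b + v) - g'' b) / 2\<bar> \<le> K * \<bar>y\<bar>" by simp
  qed simp
  moreover have "\<bar>y\<bar> ^ 3 = \<bar>y\<bar> * y\<^sup>2"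
    by (simp add: power3_eq_cube power2_eq_square)
  ultimately show ?thesis by (simp only: abs_mult) (simp add: mult.assoc)
qed

text \<open>Since h \<le> 1, every intermediate exponential is at most \<open>exp v\<close>, so the
  constants are uniform in the step size h.\<close>

lemma exp_minus_bounds:
  fixes a v :: real
  assumes "\<bar>a\<bar> \<le> h * v" "0 \<le> v" "0 \<le> h" "h \<le> 1"
  shows "\<bar>exp (- a) - 1 + a\<bar> \<le> (h * v)\<^sup>2 * exp v" "\<bar>exp (- a) - 1\<bar> \<le> h * v * exp v" "exp (- a) \<le> exp v"
proof -
  have hv: "h * v \<le> v" using assms mult_right_mono[of h 1 v] by simp
  obtain s where s: "\<bar>s\<bar> \<le> \<bar>- a\<bar>" "exp (- a) = (\<Sum>m<2. (- a) ^ m / fact m) + exp s / fact 2 * (- a) ^ 2"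
    using Maclaurin_exp_le[of "- a" 2] by blast
  have "exp (- a) - 1 + a = exp s / 2 * a\<^sup>2"
    using s(2) by (simp add: numeral_2_eq_2)
  also have "\<bar>\<dots>\<bar> = exp s / 2 * \<bar>a\<bar>\<^sup>2" by (simp add: abs_mult)
  also have "\<dots> \<le> exp v * (h * v)\<^sup>2"
  proof (intro mult_mono power_mono)
    have "exp s \<le> exp v" using s(1) assms hv by simp
    then show "exp s / 2 \<le> exp v" using exp_gt_zero[of s] by linarith
  qed (use assms in auto)
  finally show "\<bar>exp (- a) - 1 + a\<bar> \<le> (h * v)\<^sup>2 * exp v" by (simp add: mult.commute)
  obtain s where s: "\<bar>s\<bar> \<le> \<bar>- a\<bar>" "exp (- a) = (\<Sum>m<1. (- a) ^ m / fact m) + exp s / fact 1 * (- a) ^ 1"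
    using Maclaurin_exp_le[of "- a" 1] by blast
  have "\<bar>exp (- a) - 1\<bar> = exp s * \<bar>a\<bar>" using s(2) by (simp add: abs_mult)
  also have "\<dots> \<le> exp v * (h * v)"
    using s(1) assms hv by (intro mult_mono) auto
  finally show "\<bar>exp (- a) - 1\<bar> \<le> h * v * exp v" by (simp add: mult.commute)
  show "exp (- a) \<le> exp v" using assms hv by simp
qed

text \<open>A discrete form of the bound 1 for the integral of U exp(- integral of U). From (1 + y)
  exp(- y) \<le> 1 follows y \<le> (1 + y)(1 - exp(- y)), and the right side telescopes after
  discounting. The bound depends neither on n nor on the sum of the y i.\<close>

lemma discounted_sum_bound:
  fixes y :: "nat \<Rightarrow> real"
  assumes "\<And>i. 0 \<le> y i" "\<And>i. y i \<le> c"
  shows "(\<Sum>i<n. y i * exp (- (\<Sum>j<i. y j))) \<le> 1 + c"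
proof -
  have c: "0 \<le> c" using assms[of 0] by linarith
  have "y i * exp (- (\<Sum>j<i. y j)) \<le> (1 + c) * (exp (- (\<Sum>j<i. y j)) - exp (- (\<Sum>j<Suc i. y j)))" for i
  proof -
    have "(1 + y i) * exp (- y i) \<le> exp (y i) * exp (- y i)"
      by (intro mult_right_mono) auto
    then have "(1 + y i) * exp (- y i) \<le> 1" by (simp add: exp_minus)
    then have "y i \<le> (1 + y i) * (1 - exp (- y i))" by (simp add: algebra_simps)
    also have "\<dots> \<le> (1 + c) * (1 - exp (- y i))" using assms by (intro mult_right_mono) auto
    finally have "y i * exp (- (\<Sum>j<i. y j)) \<le> (1 + c) * (1 - exp (- y i)) * exp (- (\<Sum>j<i. y j))"
      by (intro mult_right_mono) auto
    moreover have "exp (- (\<Sum>j<Suc i. y j)) = exp (- y i) * exp (- (\<Sum>j<i. y j))"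
      by (simp add: exp_add[symmetric])
    ultimately show ?thesis by (simp add: algebra_simps)
  qed
  then have "(\<Sum>i<n. y i * exp (- (\<Sum>j<i. y j))) \<le> (\<Sum>i<n. (1 + c) * (exp (- (\<Sum>j<i. y j)) - exp (- (\<Sum>j<Suc i. y j))))"
    by (rule sum_mono)
  also have "\<dots> = (1 + c) * (1 - exp (- (\<Sum>j<n. y j)))"
    by (subst sum_distrib_left[symmetric], subst sum_lessThan_telescope') simp
  also have "\<dots> \<le> 1 + c" using c by (simp add: algebra_simps)
  finally show ?thesis .
qed

section \<open>Gaussian increments and the expected change over one step\<close>

context standard_brownian_motion
begin

lemma increment_moments:
  assumes "0 \<le> s" "s < u"
  defines "D \<equiv> \<lambda>\<omega>. W u \<omega> - W s \<omega>"
  shows "integrable M D" "integrable M (\<lambda>\<omega>. (D \<omega>)\<^sup>2)" "integrable M (\<lambda>\<omega>. \<bar>D \<omega>\<bar> ^ 3)"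
    "expectation D = 0" "expectation (\<lambda>\<omega>. (D \<omega>)\<^sup>2) = u - s"
    "expectation (\<lambda>\<omega>. \<bar>D \<omega>\<bar> ^ 3) \<le> 2 * ((u - s) * sqrt (u - s))"
proof -
  let ?\<sigma> = "sqrt (u - s)"
  have \<sigma>: "0 < ?\<sigma>" using assms by simp
  have d: "distributed M lborel D (normal_density 0 ?\<sigma>)"
    unfolding D_def by (rule W_gaussian_increments[OF assms(1,2)])
  note int = distributed_integrable[OF d] and eq = distributed_integral[OF d]
  have i: "integrable lborel (\<lambda>x. normal_density 0 ?\<sigma> x * x ^ k)" "integrable lborel (\<lambda>x. normal_density 0 ?\<sigma> x * \<bar>x\<bar> ^ k)" for k
    using integrable_normal_moment[OF \<sigma>, of 0 k] integrable_normal_moment_abs[OF \<sigma>, of 0 k] by simp_all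
  show "integrable M D" using int[of "\<lambda>x. x"] i(1)[of 1] by simp
  show "integrable M (\<lambda>\<omega>. (D \<omega>)\<^sup>2)" using int[of "\<lambda>x. x\<^sup>2"] i(1)[of 2] by simp
  show "integrable M (\<lambda>\<omega>. \<bar>D \<omega>\<bar> ^ 3)" using int[of "\<lambda>x. \<bar>x\<bar> ^ 3"] i(2)[of 3] by simp
  show "expectation D = 0" using eq[of "\<lambda>x. x"] integral_normal_moment_nz_1[OF \<sigma>, of 0] by simp
  show "expectation (\<lambda>\<omega>. (D \<omega>)\<^sup>2) = u - s"
    using eq[of "\<lambda>x. x\<^sup>2"] integral_normal_moment_even[OF \<sigma>, of 0 1] \<sigma> by simp
  have "expectation (\<lambda>\<omega>. \<bar>D \<omega>\<bar> ^ 3) = 2 * ?\<sigma> ^ 3 * sqrt (2 / pi)"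
    using eq[of "\<lambda>x. \<bar>x\<bar> ^ 3"] integral_normal_moment_abs_odd[OF \<sigma>, of 0 1] by (simp add: numeral_3_eq_3)
  also have "\<dots> \<le> 2 * ?\<sigma> ^ 3 * 1"
    using \<sigma> pi_ge_two by (intro mult_left_mono) auto
  finally show "expectation (\<lambda>\<omega>. \<bar>D \<omega>\<bar> ^ 3) \<le> 2 * ((u - s) * ?\<sigma>)"
    using \<sigma> by (simp add: power3_eq_cube)
qed

lemma integrable_bounded:
  fixes f :: "'a \<Rightarrow> real"
  assumes "f \<in> borel_measurable M" "\<And>\<omega>. \<bar>f \<omega>\<bar> \<le> C"
  shows "integrable M f"
  using assms by (intro integrable_const_bound[where B = C]) auto

text \<open>The weight G and the position X are known at time s, so in the Taylor expansion the
  increment contributes only through its moments. The remaining error is of order h^(3/2), and t/h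
  such errors still sum to zero in the limit.\<close>

lemma gaussian_step:
  fixes g g' g'' V :: "real \<Rightarrow> real"
  assumes s: "0 \<le> s" "s < u" "u - s \<le> 1"
    and X: "X \<in> borel_measurable (completed_natural_filtration M W s)"
    and G: "G \<in> borel_measurable (completed_natural_filtration M W s)" "\<And>\<omega>. \<bar>G \<omega>\<bar> \<le> C"
    and g: "\<And>b. (g has_real_derivative g' b) (at b)" and g': "\<And>b. (g' has_real_derivative g'' b) (at b)"
    and K: "\<And>b. \<bar>g b\<bar> \<le> K" "\<And>b. \<bar>g' b\<bar> \<le> K" "\<And>b. \<bar>g'' b\<bar> \<le> K" "\<And>a b. \<bar>g'' a - g'' b\<bar> \<le> K * \<bar>a - b\<bar>"
    and V: "V \<in> borel_measurable borel" "\<And>b. \<bar>V b\<bar> \<le> v"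
  defines "h \<equiv> u - s"
  shows "\<bar>expectation (\<lambda>\<omega>. G \<omega> * (exp (- (h * V (X \<omega>))) * g (X \<omega> + (W u \<omega> - W s \<omega>)) - g (X \<omega>))
      - G \<omega> * (h * (g'' (X \<omega>) / 2 - V (X \<omega>) * g (X \<omega>))))\<bar> \<le> C * (K * exp v * (2 + v + v\<^sup>2)) * (h * sqrt h)"
proof -
  let ?F = "completed_natural_filtration M W s"
  define D where "D \<omega> = W u \<omega> - W s \<omega>" for \<omega>
  have h: "0 < h" "h \<le> 1" using s by (auto simp: h_def)
  have v0: "0 \<le> v" using V(2)[of 0] by linarith
  have K0: "0 \<le> K" using K(1)[of 0] by linarith
  have C0: "0 \<le> C" using G(2)[of undefined] by linarith
  have cont: "continuous_on UNIV g" "continuous_on UNIV g'"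
    using g g' by (meson DERIV_isCont continuous_at_imp_continuous_on)+
  have "continuous_on UNIV g''"
  proof (rule continuous_onI)
    fix b e :: real assume e: "0 < e"
    show "\<exists>d>0. \<forall>x'\<in>UNIV. dist x' b < d \<longrightarrow> dist (g'' x') (g'' b) \<le> e"
    proof (intro exI[of _ "e / (K + 1)"] conjI ballI impI)
      show "0 < e / (K + 1)" using e K0 by simp
      fix a assume a: "dist a b < e / (K + 1)"
      have "dist (g'' a) (g'' b) \<le> K * \<bar>a - b\<bar>" using K(4) by (simp add: dist_real_def)
      also have "\<dots> \<le> (K + 1) * (e / (K + 1))" using a K0 by (intro mult_mono) (auto simp: dist_real_def)
      finally show "dist (g'' a) (g'' b) \<le> e" using K0 by simp
    qed
  qed
  with cont have gm [measurable]: "g \<in> borel_measurable borel" "g' \<in> borel_measurable borel" "g'' \<in> borel_measurable borel"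
    by (auto intro: borel_measurable_continuous_onI)
  note V(1) [measurable] 
  have [measurable]: "random_variable borel (W s)" "random_variable borel (W u)" using s by (auto intro: W_measurable)
  have [measurable]: "random_variable borel D" unfolding D_def by measurable
  have FM [measurable]: "random_variable borel X" "random_variable borel G"
    using filtration_measurable_M X G by auto
  \<comment> \<open>The potential factor is evaluated at the left end of the step, so it joins the
    weight that is known at time s.\<close>
  define P where "P \<omega> = G \<omega> * exp (- (h * V (X \<omega>)))" for \<omega>
  have hV: "\<bar>h * V b\<bar> \<le> h * v" for b using V(2)[of b] h by (simp add: abs_mult)
  note eb = exp_minus_bounds[OF hV v0 less_imp_le[OF h(1)] h(2)]
  have P: "\<bar>P \<omega>\<bar> \<le> C * exp v" for \<omega>
    unfolding P_def abs_mult using G(2) eb(3) C0 by (intro mult_mono) auto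
  define R where "R \<omega> = g (X \<omega> + D \<omega>) - g (X \<omega>) - g' (X \<omega>) * D \<omega> - g'' (X \<omega>) / 2 * (D \<omega>)\<^sup>2" for \<omega>
  have R: "\<bar>R \<omega>\<bar> \<le> K * \<bar>D \<omega>\<bar> ^ 3" for \<omega>
    unfolding R_def by (rule taylor2_lipschitz[OF g g' K(4)])
  have [measurable]: "random_variable borel P" "random_variable borel R" unfolding P_def R_def by measurable
  note mom = increment_moments[OF s(1,2), folded D_def h_def]
  \<comment> \<open>What remains once the squared increment is replaced by its mean h: the error of
    expanding the potential factor to first order in h. It is of order h^2 and is weakened to
    h^(3/2).\<close>
  define Q where "Q \<omega> = G \<omega> * (exp (- (h * V (X \<omega>))) * (g (X \<omega>) + h / 2 * g'' (X \<omega>)) - g (X \<omega>) - h * (g'' (X \<omega>) / 2 - V (X \<omega>) * g (X \<omega>)))" for \<omega>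
  have [measurable]: "random_variable borel Q" unfolding Q_def by measurable
  have Q: "\<bar>Q \<omega>\<bar> \<le> C * (K * exp v * (v + v\<^sup>2)) * (h * sqrt h)" for \<omega>
  proof -
    define a where "a = h * V (X \<omega>)"
    have hh: "h\<^sup>2 \<le> h * sqrt h"
    proof -
      have "h \<le> sqrt h" using h by (intro real_le_rsqrt) (simp add: power2_eq_square mult_left_le)
      then show ?thesis using h by (simp add: power2_eq_square)
    qed
    have "Q \<omega> = G \<omega> * ((exp (- a) - 1 + a) * g (X \<omega>) + h / 2 * g'' (X \<omega>) * (exp (- a) - 1))"
      by (simp add: Q_def a_def field_simps)
    also have "\<bar>\<dots>\<bar> \<le> C * ((h * v)\<^sup>2 * exp v * K + h * K * (h * v * exp v))"
      unfolding abs_mult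
    proof (intro mult_mono order_trans[OF abs_triangle_ineq] add_mono G(2))
      show "\<bar>(exp (- a) - 1 + a) * g (X \<omega>)\<bar> \<le> (h * v)\<^sup>2 * exp v * K"
        unfolding abs_mult a_def using eb(1) K(1) by (intro mult_mono) auto
      have "\<bar>h / 2 * g'' (X \<omega>)\<bar> \<le> h * K" unfolding abs_mult using h K(3)[of "X \<omega>"] by (intro mult_mono) auto
      then show "\<bar>h / 2 * g'' (X \<omega>) * (exp (- a) - 1)\<bar> \<le> h * K * (h * v * exp v)"
        unfolding abs_mult[of "h / 2 * g'' (X \<omega>)"] a_def using eb(2) K0 h by (intro mult_mono) auto
    qed (use C0 in auto)
    also have "\<dots> = C * (K * exp v * (v + v\<^sup>2)) * h\<^sup>2"
      by (simp add: power2_eq_square algebra_simps)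
    also have "\<dots> \<le> C * (K * exp v * (v + v\<^sup>2)) * (h * sqrt h)"
      using C0 K0 v0 hh by (intro mult_left_mono mult_nonneg_nonneg) auto
    finally show ?thesis .
  qed
  \<comment> \<open>The first two summands are known weights times centred functions of the
    increment, hence have expectation zero; the other two are the Taylor remainder and the error of
    the potential factor.\<close>
  have eq: "G \<omega> * (exp (- (h * V (X \<omega>))) * g (X \<omega> + (W u \<omega> - W s \<omega>)) - g (X \<omega>))
      - G \<omega> * (h * (g'' (X \<omega>) / 2 - V (X \<omega>) * g (X \<omega>)))
    = (P \<omega> * g' (X \<omega>)) * D \<omega> + (P \<omega> * g'' (X \<omega>) / 2) * ((D \<omega>)\<^sup>2 - h) + P \<omega> * R \<omega> + Q \<omega>" for \<omega>
    by (simp add: P_def R_def Q_def D_def field_simps)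
  have i1: "expectation (\<lambda>\<omega>. (P \<omega> * g' (X \<omega>)) * D \<omega>) = 0" "integrable M (\<lambda>\<omega>. (P \<omega> * g' (X \<omega>)) * D \<omega>)"
  proof -
    have "(\<lambda>\<omega>. P \<omega> * g' (X \<omega>)) \<in> borel_measurable ?F"
      unfolding P_def using X G V(1) gm by (intro borel_measurable_times borel_measurable_exp borel_measurable_uminus measurable_compose[OF X] borel_measurable_const) auto
    from filtration_indep_increment[OF s(1,2) this, folded D_def]
    have iv: "indep_var borel (\<lambda>\<omega>. P \<omega> * g' (X \<omega>)) borel D" .
    have int: "integrable M (\<lambda>\<omega>. P \<omega> * g' (X \<omega>))"
      by (rule integrable_bounded[where C = "C * exp v * K"]) (auto simp: abs_mult C0 intro!: mult_mono P K)
    show "expectation (\<lambda>\<omega>. (P \<omega> * g' (X \<omega>)) * D \<omega>) = 0" "integrable M (\<lambda>\<omega>. (P \<omega> * g' (X \<omega>)) * D \<omega>)"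
      using indep_var_lebesgue_integral[OF iv int mom(1)] indep_var_integrable[OF iv int mom(1)] mom(4) by auto
  qed
  have i2: "expectation (\<lambda>\<omega>. (P \<omega> * g'' (X \<omega>) / 2) * ((D \<omega>)\<^sup>2 - h)) = 0" "integrable M (\<lambda>\<omega>. (P \<omega> * g'' (X \<omega>) / 2) * ((D \<omega>)\<^sup>2 - h))"
  proof -
    have "(\<lambda>\<omega>. P \<omega> * g'' (X \<omega>) / 2) \<in> borel_measurable ?F"
      unfolding P_def using X G V(1) gm by (intro borel_measurable_divide borel_measurable_times borel_measurable_exp borel_measurable_uminus measurable_compose[OF X] borel_measurable_const) auto
    from filtration_indep_increment[OF s(1,2) this, folded D_def]
    have "indep_var borel (\<lambda>\<omega>. P \<omega> * g'' (X \<omega>) / 2) borel D" .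
    from indep_var_compose[OF this, of "\<lambda>x. x" borel "\<lambda>y. y\<^sup>2 - h" borel]
    have iv: "indep_var borel (\<lambda>\<omega>. P \<omega> * g'' (X \<omega>) / 2) borel (\<lambda>\<omega>. (D \<omega>)\<^sup>2 - h)" by (simp add: comp_def)
    have "\<bar>P \<omega> * g'' (X \<omega>) / 2\<bar> \<le> C * exp v * K" for \<omega>
    proof -
      have "\<bar>P \<omega>\<bar> * \<bar>g'' (X \<omega>)\<bar> \<le> C * exp v * K" using P K C0 by (intro mult_mono) auto
      then show ?thesis by (simp add: abs_mult) (smt (verit) abs_ge_zero mult_nonneg_nonneg)
    qed
    then have int: "integrable M (\<lambda>\<omega>. P \<omega> * g'' (X \<omega>) / 2)"
      by (rule integrable_bounded[rotated]) auto
    have int2: "integrable M (\<lambda>\<omega>. (D \<omega>)\<^sup>2 - h)" using mom(2) by auto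
    have "expectation (\<lambda>\<omega>. (D \<omega>)\<^sup>2 - h) = 0" using mom(2,5) by (simp add: prob_space)
    then show "expectation (\<lambda>\<omega>. (P \<omega> * g'' (X \<omega>) / 2) * ((D \<omega>)\<^sup>2 - h)) = 0" "integrable M (\<lambda>\<omega>. (P \<omega> * g'' (X \<omega>) / 2) * ((D \<omega>)\<^sup>2 - h))"
      using indep_var_lebesgue_integral[OF iv int int2] indep_var_integrable[OF iv int int2] by auto
  qed
  have PR: "\<bar>P \<omega> * R \<omega>\<bar> \<le> C * exp v * K * \<bar>D \<omega>\<bar> ^ 3" for \<omega>
  proof -
    have "\<bar>P \<omega> * R \<omega>\<bar> \<le> C * exp v * (K * \<bar>D \<omega>\<bar> ^ 3)" unfolding abs_mult using P R C0 by (intro mult_mono) auto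
    then show ?thesis by (simp add: mult.assoc)
  qed
  have iD: "integrable M (\<lambda>\<omega>. C * exp v * K * \<bar>D \<omega>\<bar> ^ 3)" using mom(3) by auto
  have iPR: "integrable M (\<lambda>\<omega>. P \<omega> * R \<omega>)"
    by (rule Bochner_Integration.integrable_bound[OF iD]) (use PR in \<open>auto intro: order_trans[OF _ abs_ge_self]\<close>)
  have ePR: "\<bar>expectation (\<lambda>\<omega>. P \<omega> * R \<omega>)\<bar> \<le> C * exp v * K * (2 * (h * sqrt h))"
  proof -
    have "\<bar>expectation (\<lambda>\<omega>. P \<omega> * R \<omega>)\<bar> \<le> expectation (\<lambda>\<omega>. \<bar>P \<omega> * R \<omega>\<bar>)" by (rule integral_abs_bound)
    also have "\<dots> \<le> expectation (\<lambda>\<omega>. C * exp v * K * \<bar>D \<omega>\<bar> ^ 3)"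
      using PR iPR iD by (intro integral_mono) auto
    also have "\<dots> = C * exp v * K * expectation (\<lambda>\<omega>. \<bar>D \<omega>\<bar> ^ 3)" by simp
    also have "\<dots> \<le> C * exp v * K * (2 * (h * sqrt h))"
      using mom(6) C0 K0 by (intro mult_left_mono) auto
    finally show ?thesis .
  qed
  have iQ: "integrable M Q" by (rule integrable_bounded[OF _ Q]) auto
  have eQ: "\<bar>expectation Q\<bar> \<le> C * (K * exp v * (v + v\<^sup>2)) * (h * sqrt h)"
  proof -
    have "\<bar>expectation Q\<bar> \<le> expectation (\<lambda>\<omega>. \<bar>Q \<omega>\<bar>)" by (rule integral_abs_bound)
    also have "\<dots> \<le> expectation (\<lambda>\<omega>. C * (K * exp v * (v + v\<^sup>2)) * (h * sqrt h))"
      using Q iQ by (intro integral_mono) auto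
    finally show ?thesis by (simp add: prob_space)
  qed
  have "expectation (\<lambda>\<omega>. G \<omega> * (exp (- (h * V (X \<omega>))) * g (X \<omega> + (W u \<omega> - W s \<omega>)) - g (X \<omega>))
      - G \<omega> * (h * (g'' (X \<omega>) / 2 - V (X \<omega>) * g (X \<omega>)))) = expectation (\<lambda>\<omega>. P \<omega> * R \<omega>) + expectation Q"
    unfolding eq using i1 i2 iPR iQ by simp
  moreover have "C * exp v * K * (2 * (h * sqrt h)) + C * (K * exp v * (v + v\<^sup>2)) * (h * sqrt h)
      = C * (K * exp v * (2 + v + v\<^sup>2)) * (h * sqrt h)"
    by (simp add: algebra_simps)
  ultimately show ?thesis using ePR eQ by linarith
qed

end

section \<open>The Ito-Tanaka formula in expectation\<close>

lemma bounded_deriv_lipschitz: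
  fixes g g' :: "real \<Rightarrow> real"
  assumes "\<And>b. (g has_real_derivative g' b) (at b)" "\<And>b. \<bar>g' b\<bar> \<le> K"
  shows "\<bar>g a - g b\<bar> \<le> K * \<bar>a - b\<bar>"
  using field_differentiable_bound[of UNIV g g' K a b] assms
  by (simp add: norm_minus_commute)

text \<open>With the Brownian part already moved to time u, both arguments of g lie on the line x +
  w u + \<gamma> v, so only the drift in the local time variable counts. The first bound is crude
  and serves domination. In the second, either the local time is constant on [s, u] and both sides
  vanish, or b has a zero there; then every argument is within 2\<delta> of 0 and the drift is close
  to its value at 0.\<close>

lemma path_local_time_step:
  fixes g g' g'' b w l :: "real \<Rightarrow> real"
  assumes b: "continuous_on {0..} b" and l: "is_symmetric_local_time b l"
    and eq: "\<And>s. 0 \<le> s \<Longrightarrow> b s = x + w s + \<gamma> * l s"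
    and g: "\<And>b. (g has_real_derivative g' b) (at b)" and g': "\<And>b. (g' has_real_derivative g'' b) (at b)"
    and K: "\<And>b. \<bar>g b\<bar> \<le> K" "\<And>b. \<bar>g' b\<bar> \<le> K" "\<And>b. \<bar>g'' b\<bar> \<le> K"
    and \<theta>: "0 < \<theta>" and su: "0 \<le> s" "s \<le> u"
  defines "d \<equiv> \<bar>exp (- \<theta> * l u) * g (b u) - exp (- \<theta> * l s) * g (b s + (w u - w s))\<bar>"
  shows "d \<le> (\<theta> + \<bar>\<gamma>\<bar>) * K / \<theta> * (exp (- \<theta> * l s) - exp (- \<theta> * l u))"
    and "\<And>\<delta>. (\<And>r. s \<le> r \<Longrightarrow> r \<le> u \<Longrightarrow> \<bar>b r - b s\<bar> \<le> \<delta> \<and> \<bar>b r - b u\<bar> \<le> \<delta>) \<Longrightarrow> \<bar>w u - w s\<bar> \<le> \<delta> \<Longrightarrow>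
      d \<le> (\<bar>\<gamma> * g' 0 - \<theta> * g 0\<bar> + (\<theta> + \<bar>\<gamma>\<bar>) * K * (2 * \<delta>)) / \<theta> * (exp (- \<theta> * l s) - exp (- \<theta> * l u))"
proof -
  have mono: "l s \<le> l u" by (rule local_time_mono[OF b l su])
  have bu: "b u = x + w u + \<gamma> * l u" and bs: "b s + (w u - w s) = x + w u + \<gamma> * l s"
    using eq su by auto
  have d: "d = \<bar>exp (- \<theta> * l u) * g (x + w u + \<gamma> * l u) - exp (- \<theta> * l s) * g (x + w u + \<gamma> * l s)\<bar>"
    unfolding d_def bu bs by simp
  note step = exp_weighted_drift_bound[OF g \<theta> mono, of \<gamma> "x + w u", folded d]
  have K0: "0 \<le> K" using K(1)[of 0] by linarith
  show "d \<le> (\<theta> + \<bar>\<gamma>\<bar>) * K / \<theta> * (exp (- \<theta> * l s) - exp (- \<theta> * l u))"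
  proof (rule step)
    fix v
    have "\<bar>\<gamma> * g' (x + w u + \<gamma> * v) - \<theta> * g (x + w u + \<gamma> * v)\<bar> \<le> \<bar>\<gamma>\<bar> * K + \<theta> * K"
      using K \<theta> by (intro order_trans[OF abs_triangle_ineq4] add_mono) (auto simp: abs_mult mult_left_mono)
    then show "\<bar>\<gamma> * g' (x + w u + \<gamma> * v) - \<theta> * g (x + w u + \<gamma> * v)\<bar> \<le> (\<theta> + \<bar>\<gamma>\<bar>) * K"
      by (simp add: algebra_simps)
  qed
  fix \<delta> assume \<delta>: "\<And>r. s \<le> r \<Longrightarrow> r \<le> u \<Longrightarrow> \<bar>b r - b s\<bar> \<le> \<delta> \<and> \<bar>b r - b u\<bar> \<le> \<delta>" "\<bar>w u - w s\<bar> \<le> \<delta>"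
  let ?c0 = "\<bar>\<gamma> * g' 0 - \<theta> * g 0\<bar>" and ?C1 = "(\<theta> + \<bar>\<gamma>\<bar>) * K"
  show "d \<le> (?c0 + ?C1 * (2 * \<delta>)) / \<theta> * (exp (- \<theta> * l s) - exp (- \<theta> * l u))"
  proof (cases "l s = l u")
    case True
    then show ?thesis by (simp add: d)
  next
    case False
    then obtain r where r: "s \<le> r" "r \<le> u" "b r = 0"
      using local_time_constant_off_zeros[OF b l su] by blast
    have bd: "\<bar>b s\<bar> \<le> \<delta>" "\<bar>b u\<bar> \<le> \<delta>" using \<delta>(1)[OF r(1,2)] r(3) by auto
    show ?thesis
    proof (rule step)
      fix v assume v: "l s \<le> v" "v \<le> l u"
      let ?b = "x + w u + \<gamma> * v"
      have "?b \<in> closed_segment (x + w u + \<gamma> * l s) (x + w u + \<gamma> * l u)"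
        using v by (cases "0 \<le> \<gamma>") (auto simp: closed_segment_eq_real_ivl mult_left_mono mult_left_mono_neg)
      \<comment> \<open>The left end is b s plus a Brownian increment, each at most \<delta>; this
        is the source of the factor 2.\<close>
      moreover have "\<bar>x + w u + \<gamma> * l s\<bar> \<le> 2 * \<delta>" "\<bar>x + w u + \<gamma> * l u\<bar> \<le> 2 * \<delta>"
        using bd \<delta>(2) bs bu by linarith+
      ultimately have b2: "\<bar>?b\<bar> \<le> 2 * \<delta>"
        by (auto simp: closed_segment_eq_real_ivl split: if_splits)
      have "\<bar>\<gamma> * g' ?b - \<theta> * g ?b\<bar> \<le> ?c0 + \<bar>\<gamma> * (g' ?b - g' 0)\<bar> + \<bar>\<theta> * (g ?b - g 0)\<bar>"
        by (simp add: algebra_simps)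
      also have "\<dots> \<le> ?c0 + \<bar>\<gamma>\<bar> * (K * \<bar>?b\<bar>) + \<theta> * (K * \<bar>?b\<bar>)"
        using bounded_deriv_lipschitz[OF g K(2), of ?b 0] bounded_deriv_lipschitz[OF g' K(3), of ?b 0] \<theta>
        by (intro add_mono order_refl) (auto simp: abs_mult intro!: mult_left_mono)
      also have "\<dots> = ?c0 + ?C1 * \<bar>?b\<bar>" by (simp add: algebra_simps)
      also have "\<dots> \<le> ?c0 + ?C1 * (2 * \<delta>)"
        using b2 K0 \<theta> by (intro add_left_mono mult_left_mono) auto
      finally show "\<bar>\<gamma> * g' ?b - \<theta> * g ?b\<bar> \<le> ?c0 + ?C1 * (2 * \<delta>)" .
    qed
  qed
qed

text \<open>Supplies the modulus \<delta> of \<open>path_local_time_step\<close> for all cells of a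
  fine grid at once.\<close>

lemma uniform_grid_modulus:
  fixes f :: "real \<Rightarrow> real"
  assumes f: "continuous_on {0..} f" and t: "0 \<le> t" and \<delta>: "0 < \<delta>"
  shows "\<exists>N. \<forall>n\<ge>N. \<forall>i<n. \<forall>r r'. real i * (t / real n) \<le> r \<and> r \<le> real (Suc i) * (t / real n) \<and>
    real i * (t / real n) \<le> r' \<and> r' \<le> real (Suc i) * (t / real n) \<longrightarrow> \<bar>f r - f r'\<bar> \<le> \<delta>"
proof -
  have "uniformly_continuous_on {0..t} f"
    using f by (intro compact_uniformly_continuous continuous_on_subset[OF f]) auto
  then obtain d where d: "0 < d" "\<And>u v. u \<in> {0..t} \<Longrightarrow> v \<in> {0..t} \<Longrightarrow> dist v u < d \<Longrightarrow> dist (f v) (f u) < \<delta>"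
    unfolding uniformly_continuous_on_def using \<delta> by metis
  obtain N :: nat where N: "t / d < real N" using reals_Archimedean2 by blast
  show ?thesis
  proof (intro exI[of _ "Suc N"] allI impI)
    fix n i r r' assume n: "Suc N \<le> n" and i: "i < n" and
      r: "real i * (t / real n) \<le> r \<and> r \<le> real (Suc i) * (t / real n) \<and>
        real i * (t / real n) \<le> r' \<and> r' \<le> real (Suc i) * (t / real n)"
    have np: "0 < real n" and Nn: "real N < real n" using n by auto
    have "t / d < real n" using N Nn by simp
    then have hd: "t / real n < d" using d(1) np by (simp add: field_simps)
    have h0: "0 \<le> t / real n" using t by simp
    have "real (Suc i) * (t / real n) \<le> real n * (t / real n)"
      using i h0 by (intro mult_right_mono) auto
    then have it: "real (Suc i) * (t / real n) \<le> t" using np by simp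
    have "0 \<le> real i * (t / real n)" using h0 by (intro mult_nonneg_nonneg) auto
    then have "r \<in> {0..t}" "r' \<in> {0..t}" using r it by auto
    moreover have "dist r r' < d"
    proof -
      have "real (Suc i) * (t / real n) = real i * (t / real n) + t / real n"
        by (simp only: of_nat_Suc distrib_right mult_1_left add.commute)
      then show ?thesis unfolding dist_real_def using r hd by linarith
    qed
    ultimately show "\<bar>f r - f r'\<bar> \<le> \<delta>" using d(2)[of r' r] by (simp add: dist_real_def)
  qed
qed

text \<open>With continuity and nonnegativity holding everywhere, path integrals and exponential
  weights are defined and bounded at every sample point. \<open>skew_continuous_modification\<close>
  reduces the general case to this one.\<close>

locale skew_continuous = skew_brownian_motion +
  assumes B_paths: "\<And>\<omega>. \<omega> \<in> space M \<Longrightarrow> continuous_on {0..} (\<lambda>s. B s \<omega>)"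
    and L_nonneg: "\<And>t \<omega>. 0 \<le> L t \<omega>"
begin

abbreviation "\<F> \<equiv> completed_natural_filtration M W"

abbreviation "\<gamma> \<equiv> 2 * \<alpha> - 1"

text \<open>For n = 0 the mesh \<open>s / real n\<close> is 0 by convention, so the claim covers the
  degenerate grid as well.\<close>

lemma grid_mem: "0 \<le> s \<Longrightarrow> i \<le> n \<Longrightarrow> 0 \<le> real i * (s / real n) \<and> real i * (s / real n) \<le> s"
  by (cases "n = 0") (auto simp: field_simps mult_left_mono)

lemma B_adapted': "0 \<le> r \<Longrightarrow> r \<le> s \<Longrightarrow> B r \<in> borel_measurable (\<F> s)"
  using filtration_measurable_mono[OF B_adapted] by blast

lemma B_measurable: "0 \<le> s \<Longrightarrow> random_variable borel (B s)"
  using filtration_measurable_M[OF B_adapted] by blast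

text \<open>Each Riemann sum reads the path only at times up to s, and the sums converge at every
  sample point.\<close>

lemma path_integral_adapted:
  fixes \<phi> :: "real \<Rightarrow> real"
  assumes \<phi>: "continuous_on UNIV \<phi>" and s: "0 \<le> s"
  shows "(\<lambda>\<omega>. integral {0..s} (\<lambda>u. \<phi> (B u \<omega>))) \<in> borel_measurable (\<F> s)"
proof (rule borel_measurable_LIMSEQ_real)
  fix \<omega> assume "\<omega> \<in> space (\<F> s)"
  then have "continuous_on {0..s} (\<lambda>u. \<phi> (B u \<omega>))"
    using continuous_on_compose2[OF \<phi> continuous_on_subset[OF B_paths, of \<omega> "{0..s}"]] by auto
  then show "(\<lambda>n. s / real n * (\<Sum>i<n. \<phi> (B (real i * (s / real n)) \<omega>))) \<longlonglongrightarrow> integral {0..s} (\<lambda>u. \<phi> (B u \<omega>))"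
    using riemann_sum_tendsto[of s "\<lambda>u. \<phi> (B u \<omega>)"] s by simp
next
  fix n
  show "(\<lambda>\<omega>. s / real n * (\<Sum>i<n. \<phi> (B (real i * (s / real n)) \<omega>))) \<in> borel_measurable (\<F> s)"
    using grid_mem[OF s]
    by (intro borel_measurable_times borel_measurable_const borel_measurable_sum
         measurable_compose[OF B_adapted' borel_measurable_continuous_onI[OF \<phi>]]) (auto intro: less_imp_le)
qed

lemma AE_path:
  "AE \<omega> in M. continuous_on {0..} (\<lambda>s. B s \<omega>) \<and> continuous_on {0..} (\<lambda>s. W s \<omega>) \<and>
     is_symmetric_local_time (\<lambda>s. B s \<omega>) (\<lambda>s. L s \<omega>) \<and> W 0 \<omega> = 0 \<and>
     (\<forall>t\<ge>0. B t \<omega> = x + W t \<omega> + \<gamma> * L t \<omega>)"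
  using B_continuous W_continuous local_time W_start skew_equation by eventually_elim auto

lemma trapezoid_sequence_tendsto:
  assumes "continuous_on {0..} (\<lambda>s. B s \<omega>)" "is_symmetric_local_time (\<lambda>s. B s \<omega>) (\<lambda>s. L s \<omega>)" "0 \<le> s"
  shows "(\<lambda>n. integral {0..s} (\<lambda>u. trapezoid (inverse (real (Suc n))) (B u \<omega>))) \<longlonglongrightarrow> L s \<omega>"
proof -
  have "filterlim (\<lambda>n. inverse (real (Suc n))) (at_right 0) sequentially"
    unfolding filterlim_at using LIMSEQ_inverse_real_of_nat by simp
  from filterlim_compose[OF integral_trapezoid_tendsto_local_time[OF assms] this] show ?thesis .
qed

text \<open>L is assumed measurable only over M. Almost surely it is the limit of trapezoid
  integrals of B, which are adapted, and the null sets in the filtration absorb the exceptional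
  set.\<close>

lemma L_adapted:
  assumes s: "0 \<le> s" shows "L s \<in> borel_measurable (\<F> s)"
proof (rule filtration_measurable_AE_cong)
  let ?f = "\<lambda>n \<omega>. integral {0..s} (\<lambda>u. trapezoid (inverse (real (Suc n))) (B u \<omega>))"
  show "(\<lambda>\<omega>. lim (\<lambda>n. ?f n \<omega>)) \<in> borel_measurable (\<F> s)"
    by (intro borel_measurable_lim_metric path_integral_adapted s continuous_intros)
  show "AE \<omega> in M. lim (\<lambda>n. ?f n \<omega>) = L s \<omega>"
    using AE_path by eventually_elim (use trapezoid_sequence_tendsto s in \<open>auto intro!: limI\<close>)
qed (rule local_time_measurable[OF s])

lemma L_adapted': "0 \<le> r \<Longrightarrow> r \<le> s \<Longrightarrow> L r \<in> borel_measurable (\<F> s)"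
  using filtration_measurable_mono[OF L_adapted] by blast

text \<open>An Ito-Tanaka formula in expectation.  Between two grid points the path is moved first by the
  Brownian increment (second-order Taylor expansion) and then by the local time; the latter contributes
  only near \<open>B = 0\<close>, where the drift of \<open>exp (- \<theta> l) g b\<close> is \<open>\<gamma> g' 0 - \<theta> g 0\<close>.\<close>

lemma ito_inequality:
  fixes g g' g'' U :: "real \<Rightarrow> real"
  assumes t: "0 < t" and \<theta>: "0 < \<theta>" and \<kappa>: "0 \<le> \<kappa>"
    and g: "\<And>b. (g has_real_derivative g' b) (at b)" and g': "\<And>b. (g' has_real_derivative g'' b) (at b)"
    and K: "\<And>b. \<bar>g b\<bar> \<le> K" "\<And>b. \<bar>g' b\<bar> \<le> K" "\<And>b. \<bar>g'' b\<bar> \<le> K" "\<And>a b. \<bar>g'' a - g'' b\<bar> \<le> K * \<bar>a - b\<bar>"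
    and U: "continuous_on UNIV U" "\<And>b. 0 \<le> U b" "\<And>b. U b \<le> u"
    and \<eta>: "\<And>b. \<bar>g'' b / 2 - (U b - \<kappa>) * g b\<bar> \<le> \<eta> * U b" "0 \<le> \<eta>"
  defines "c0 \<equiv> \<bar>\<gamma> * g' 0 - \<theta> * g 0\<bar>"
  shows "\<bar>expectation (\<lambda>\<omega>. exp (- \<theta> * L t \<omega>) * exp (\<kappa> * t - integral {0..t} (\<lambda>s. U (B s \<omega>))) * g (B t \<omega>)) - g x\<bar>
    \<le> exp (\<kappa> * t) * (\<eta> + c0 / \<theta> * (1 - expectation (\<lambda>\<omega>. exp (- \<theta> * L t \<omega>))))"
proof -
  define h where "h n = t / real n" for n
  define \<tau> where "\<tau> n i = real i * h n" for n i
  define S where "S n i \<omega> = (\<Sum>j<i. h n * U (B (\<tau> n j) \<omega>))" for n i \<omega>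
  define E where "E n i \<omega> = exp (\<kappa> * \<tau> n i - S n i \<omega>)" for n i \<omega>
  define G where "G n i \<omega> = exp (- \<theta> * L (\<tau> n i) \<omega>) * E n i \<omega>" for n i \<omega>
  define Y where "Y n i \<omega> = G n i \<omega> * g (B (\<tau> n i) \<omega>)" for n i \<omega>
  define \<Delta> where "\<Delta> n i \<omega> = W (\<tau> n (Suc i)) \<omega> - W (\<tau> n i) \<omega>" for n i \<omega>
  define J where "J n i \<omega> = exp (- \<theta> * L (\<tau> n (Suc i)) \<omega>) * g (B (\<tau> n (Suc i)) \<omega>)
    - exp (- \<theta> * L (\<tau> n i) \<omega>) * g (B (\<tau> n i) \<omega> + \<Delta> n i \<omega>)" for n i \<omega>
  \<comment> \<open>The increment of Y splits into T1, the move by the local time with the potential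
    factor already updated, and T3, the Brownian move with the local time weight still at the left
    end. The quantity q is the first-order drift of T3.\<close>
  define T1 where "T1 n i \<omega> = E n (Suc i) \<omega> * J n i \<omega>" for n i \<omega>
  define T3 where "T3 n i \<omega> = G n i \<omega> * (exp (- (h n * (U (B (\<tau> n i) \<omega>) - \<kappa>))) * g (B (\<tau> n i) \<omega> + \<Delta> n i \<omega>) - g (B (\<tau> n i) \<omega>))" for n i \<omega>
  define q where "q n i \<omega> = G n i \<omega> * (h n * (g'' (B (\<tau> n i) \<omega>) / 2 - (U (B (\<tau> n i) \<omega>) - \<kappa>) * g (B (\<tau> n i) \<omega>)))" for n i \<omega>
  define a where "a = exp (\<kappa> * t) / \<theta>"
  define C1 where "C1 = (\<theta> + \<bar>\<gamma>\<bar>) * K"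
  \<comment> \<open>The constant of \<open>gaussian_step\<close> for a weight bounded by
    \<open>exp (\<kappa> * t)\<close> and a potential U - \<kappa> bounded by u + \<kappa>.\<close>
  define Cst where "Cst = exp (\<kappa> * t) * (K * exp (u + \<kappa>) * (2 + (u + \<kappa>) + (u + \<kappa>)\<^sup>2))"
  let ?l = "\<lambda>n i \<omega>. exp (- \<theta> * L (\<tau> n i) \<omega>)"
  have K0: "0 \<le> K" using K(1)[of 0] by linarith
  have C10: "0 \<le> C1" using K0 \<theta> by (simp add: C1_def)
  have c00: "0 \<le> c0" by (simp add: c0_def)
  have a0: "0 < a" using \<theta> by (simp add: a_def)
  have u0: "0 \<le> u" using U(2,3)[of 0] by linarith
  have h0: "0 \<le> h n" for n using t by (simp add: h_def)
  have \<tau>b: "0 \<le> \<tau> n i" "i \<le> n \<Longrightarrow> \<tau> n i \<le> t" for n i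
    using grid_mem[of t i n] t h0[of n] by (auto simp: \<tau>_def h_def)
  have \<tau>n: "\<tau> n n = t" if "0 < n" for n using that by (simp add: \<tau>_def h_def)
  have \<tau>0: "\<tau> n 0 = 0" for n by (simp add: \<tau>_def)
  have \<tau>S: "\<tau> n (Suc i) = \<tau> n i + h n" for n i by (simp add: \<tau>_def algebra_simps)
  have gm: "g \<in> borel_measurable borel" 
    using g by (meson DERIV_isCont continuous_at_imp_continuous_on borel_measurable_continuous_onI)
  have g''m: "g'' \<in> borel_measurable borel"
  proof (intro borel_measurable_continuous_onI continuous_on_subset[OF lipschitz_on_continuous_on])
    show "K-lipschitz_on UNIV g''" using K(4) K0 by (auto simp: lipschitz_on_def dist_real_def)
  qed auto
  note Um = borel_measurable_continuous_onI[OF U(1)]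
  note [measurable] = gm g''m Um
  have [measurable]: "random_variable borel (B (\<tau> n i))" "random_variable borel (L (\<tau> n i))" "random_variable borel (W (\<tau> n i))" for n i
    using \<tau>b(1) by (auto intro: B_measurable local_time_measurable W_measurable)
  have [measurable]: "random_variable borel (S n i)" "random_variable borel (\<Delta> n i)" for n i unfolding S_def \<Delta>_def by measurable
  have [measurable]: "random_variable borel (E n i)" for n i unfolding E_def by measurable
  have [measurable]: "random_variable borel (G n i)" for n i unfolding G_def by measurable
  have [measurable]: "random_variable borel (Y n i)" "random_variable borel (J n i)" for n i
    unfolding Y_def J_def by measurable
  have [measurable]: "random_variable borel (T1 n i)" "random_variable borel (T3 n i)" "random_variable borel (q n i)" for n i
    unfolding T1_def T3_def q_def by measurable
  have S0: "0 \<le> S n i \<omega>" for n i \<omega> unfolding S_def using h0 U by (intro sum_nonneg mult_nonneg_nonneg) auto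
  have lb: "0 \<le> ?l n i \<omega>" "?l n i \<omega> \<le> 1" for n i \<omega> using L_nonneg \<theta> by auto
  have Eb: "0 \<le> E n i \<omega>" "i \<le> n \<Longrightarrow> E n i \<omega> \<le> exp (\<kappa> * t)" for n i \<omega>
  proof -
    show "0 \<le> E n i \<omega>" by (simp add: E_def)
    assume "i \<le> n"
    then have "\<kappa> * \<tau> n i \<le> \<kappa> * t" using \<tau>b \<kappa> by (intro mult_left_mono) auto
    then show "E n i \<omega> \<le> exp (\<kappa> * t)" unfolding E_def using S0[of n i \<omega>] by auto
  qed
  have Gb: "\<bar>G n i \<omega>\<bar> \<le> exp (\<kappa> * t)" if "i \<le> n" for n i \<omega>
  proof -
    have "\<bar>G n i \<omega>\<bar> \<le> 1 * exp (\<kappa> * t)"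
      unfolding G_def abs_mult using lb Eb that by (intro mult_mono) auto
    then show ?thesis by simp
  qed
  have Yb: "\<bar>Y n i \<omega>\<bar> \<le> exp (\<kappa> * t) * K" if "i \<le> n" for n i \<omega>
    unfolding Y_def abs_mult using Gb[OF that] K(1) by (intro mult_mono) auto
  have Jb: "\<bar>J n i \<omega>\<bar> \<le> 2 * K" for n i \<omega>
  proof -
    have "\<bar>?l n (Suc i) \<omega> * g (B (\<tau> n (Suc i)) \<omega>)\<bar> \<le> 1 * K" "\<bar>?l n i \<omega> * g (B (\<tau> n i) \<omega> + \<Delta> n i \<omega>)\<bar> \<le> 1 * K"
      unfolding abs_mult using lb K(1) by (intro mult_mono; auto)+
    then show ?thesis unfolding J_def by linarith
  qed
  have T1b: "\<bar>T1 n i \<omega>\<bar> \<le> exp (\<kappa> * t) * (2 * K)" if "i < n" for n i \<omega>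
    unfolding T1_def abs_mult using Eb(1)[of n "Suc i"] Eb(2)[of "Suc i" n] that Jb by (intro mult_mono) auto
  have step: "Y n (Suc i) \<omega> - Y n i \<omega> = T1 n i \<omega> + T3 n i \<omega>" for n i \<omega>
  proof -
    have "E n (Suc i) \<omega> = E n i \<omega> * exp (- (h n * (U (B (\<tau> n i) \<omega>) - \<kappa>)))"
      by (simp add: E_def S_def \<tau>S exp_add[symmetric] algebra_simps)
    then show ?thesis by (simp add: Y_def G_def T1_def T3_def J_def algebra_simps)
  qed
  have iY: "integrable M (Y n i)" if "i \<le> n" for n i
    by (rule integrable_bounded[OF _ Yb[OF that]]) auto
  have iT1: "integrable M (T1 n i)" if "i < n" for n i
    by (rule integrable_bounded[OF _ T1b[OF that]]) auto
  have iT3: "integrable M (T3 n i)" if "i < n" for n i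
  proof -
    have "T3 n i = (\<lambda>\<omega>. Y n (Suc i) \<omega> - Y n i \<omega> - T1 n i \<omega>)" using step by (intro ext) (simp add: algebra_simps)
    then show ?thesis using iY[of "Suc i" n] iY[of i n] iT1[OF that] that by simp
  qed
  \<comment> \<open>The drift is at most \<eta> h U, and G contains the factor exp(- S), the
    discount required by \<open>discounted_sum_bound\<close>. The estimate tends to
    \<open>exp (\<kappa> * t) * \<eta>\<close> as the mesh shrinks.\<close>
  have qsum: "(\<Sum>i<n. \<bar>q n i \<omega>\<bar>) \<le> exp (\<kappa> * t) * \<eta> * (1 + h n * u)" for n \<omega>
  proof -
    have "\<bar>q n i \<omega>\<bar> \<le> exp (\<kappa> * t) * \<eta> * (h n * U (B (\<tau> n i) \<omega>) * exp (- S n i \<omega>))" if "i < n" for i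
    proof -
      have "\<bar>G n i \<omega>\<bar> \<le> exp (\<kappa> * t) * exp (- S n i \<omega>)"
      proof -
        have "\<kappa> * \<tau> n i \<le> \<kappa> * t" using \<tau>b(2)[of i n] \<kappa> that by (intro mult_left_mono) auto
        then have "E n i \<omega> \<le> exp (\<kappa> * t) * exp (- S n i \<omega>)" unfolding E_def exp_add[symmetric] by simp
        then have "?l n i \<omega> * E n i \<omega> \<le> 1 * (exp (\<kappa> * t) * exp (- S n i \<omega>))"
          using lb Eb(1) by (intro mult_mono) auto
        then show ?thesis using Eb(1) lb(1) unfolding G_def abs_mult by simp
      qed
      moreover have "\<bar>h n * (g'' (B (\<tau> n i) \<omega>) / 2 - (U (B (\<tau> n i) \<omega>) - \<kappa>) * g (B (\<tau> n i) \<omega>))\<bar>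
          \<le> h n * (\<eta> * U (B (\<tau> n i) \<omega>))"
        unfolding abs_mult[of "h n"] using \<eta>(1) h0 by (intro mult_mono) auto
      ultimately have "\<bar>q n i \<omega>\<bar> \<le> exp (\<kappa> * t) * exp (- S n i \<omega>) * (h n * (\<eta> * U (B (\<tau> n i) \<omega>)))"
        unfolding q_def abs_mult[of "G n i \<omega>"] by (intro mult_mono) auto
      then show ?thesis by (simp add: algebra_simps)
    qed
    then have "(\<Sum>i<n. \<bar>q n i \<omega>\<bar>) \<le> (\<Sum>i<n. exp (\<kappa> * t) * \<eta> * (h n * U (B (\<tau> n i) \<omega>) * exp (- S n i \<omega>)))"
      by (intro sum_mono) auto
    also have "\<dots> = exp (\<kappa> * t) * \<eta> * (\<Sum>i<n. h n * U (B (\<tau> n i) \<omega>) * exp (- S n i \<omega>))"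
      by (simp add: sum_distrib_left)
    also have "\<dots> \<le> exp (\<kappa> * t) * \<eta> * (1 + h n * u)"
      unfolding S_def using \<eta>(2) h0 U(2,3) by (intro mult_left_mono discounted_sum_bound) (auto intro: mult_left_mono)
    finally show ?thesis .
  qed
  have iq: "integrable M (q n i)" if "i < n" for n i
  proof (rule integrable_bounded)
    fix \<omega>
    have "\<bar>q n i \<omega>\<bar> \<le> (\<Sum>i<n. \<bar>q n i \<omega>\<bar>)" using that by (intro member_le_sum) auto
    then show "\<bar>q n i \<omega>\<bar> \<le> exp (\<kappa> * t) * \<eta> * (1 + h n * u)" using qsum[of n \<omega>] by linarith
  qed auto
  have gs: "\<bar>expectation (\<lambda>\<omega>. T3 n i \<omega> - q n i \<omega>)\<bar> \<le> Cst * (h n * sqrt (h n))"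
    if "i < n" "h n \<le> 1" for n i
  proof -
    have hn: "h n = \<tau> n (Suc i) - \<tau> n i" by (simp add: \<tau>S)
    have FX: "B (\<tau> n i) \<in> borel_measurable (\<F> (\<tau> n i))" by (rule B_adapted[OF \<tau>b(1)])
    have FG: "G n i \<in> borel_measurable (\<F> (\<tau> n i))"
    proof -
      have "B (\<tau> n j) \<in> borel_measurable (\<F> (\<tau> n i))" if "j < i" for j
        using that \<tau>b(1) h0[of n] by (intro B_adapted') (auto simp: \<tau>_def mult_right_mono)
      moreover have "L (\<tau> n i) \<in> borel_measurable (\<F> (\<tau> n i))" by (rule L_adapted[OF \<tau>b(1)])
      ultimately show ?thesis
        unfolding G_def E_def S_def
        by (intro borel_measurable_times borel_measurable_exp borel_measurable_diff borel_measurable_const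
            borel_measurable_sum measurable_compose[OF _ Um]) auto
    qed
    have V: "\<bar>U b - \<kappa>\<bar> \<le> u + \<kappa>" for b using U(2,3)[of b] \<kappa> u0 by auto
    have Vm: "(\<lambda>b. U b - \<kappa>) \<in> borel_measurable borel" by measurable
    have "0 < h n" using t that by (simp add: h_def)
    then have lt: "\<tau> n i < \<tau> n (Suc i)" by (simp add: \<tau>S)
    have le: "\<tau> n (Suc i) - \<tau> n i \<le> 1" using that by (simp add: \<tau>S)
    show ?thesis
      unfolding T3_def q_def \<Delta>_def Cst_def
      using gaussian_step[OF \<tau>b(1) lt le FX FG Gb[OF less_imp_le[OF that(1)]] g g' K Vm V] unfolding hn[symmetric] .
  qed
  let ?lt = "\<lambda>\<omega>. exp (- \<theta> * L t \<omega>)"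
  \<comment> \<open>The excess of the local time part over the bound claimed in the limit. It is
    dominated by the crude path estimate and tends to 0 by the refined one, so its expectation
    vanishes.\<close>
  define Z where "Z n \<omega> = max 0 (\<bar>\<Sum>i<n. T1 n i \<omega>\<bar> - a * c0 * (1 - ?lt \<omega>))" for n \<omega>
  have [measurable]: "random_variable borel (L t)" "random_variable borel (B t)" using t by (auto intro: local_time_measurable B_measurable)
  have [measurable]: "random_variable borel (Z n)" for n unfolding Z_def by measurable
  have T1sum: "AE \<omega> in M. \<bar>\<Sum>i<n. T1 n i \<omega>\<bar> \<le> a * C1 * (1 - ?lt \<omega>)" if "0 < n" for n
    using AE_path
  proof eventually_elim
    case (elim \<omega>)
    then have b: "continuous_on {0..} (\<lambda>s. B s \<omega>)" and l: "is_symmetric_local_time (\<lambda>s. B s \<omega>) (\<lambda>s. L s \<omega>)"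
      and eq: "\<And>s. 0 \<le> s \<Longrightarrow> B s \<omega> = x + W s \<omega> + \<gamma> * L s \<omega>" by auto
    have "\<bar>T1 n i \<omega>\<bar> \<le> exp (\<kappa> * t) * (C1 / \<theta> * (?l n i \<omega> - ?l n (Suc i) \<omega>))" if "i < n" for i
    proof -
      have "\<bar>J n i \<omega>\<bar> \<le> C1 / \<theta> * (?l n i \<omega> - ?l n (Suc i) \<omega>)"
        unfolding J_def C1_def \<Delta>_def
        using path_local_time_step(1)[OF b l eq g g' K(1-3) \<theta> \<tau>b(1)[of n i], of "\<tau> n (Suc i)"] h0[of n] by (simp add: \<tau>S)
      then show ?thesis unfolding T1_def abs_mult using Eb(1)[of n "Suc i"] Eb(2)[of "Suc i" n] that by (intro mult_mono) auto
    qed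
    then have "\<bar>\<Sum>i<n. T1 n i \<omega>\<bar> \<le> (\<Sum>i<n. exp (\<kappa> * t) * (C1 / \<theta> * (?l n i \<omega> - ?l n (Suc i) \<omega>)))"
      by (intro order_trans[OF sum_abs] sum_mono) auto
    also have "\<dots> = a * C1 * (\<Sum>i<n. ?l n i \<omega> - ?l n (Suc i) \<omega>)"
      unfolding sum_distrib_left a_def by (intro sum.cong refl) (simp add: mult.assoc)
    also have "\<dots> = a * C1 * (1 - ?lt \<omega>)"
      using local_time_0[OF l] \<tau>n[OF that] by (subst sum_lessThan_telescope') (simp add: \<tau>0)
    finally show ?case .
  qed
  have Zlim: "AE \<omega> in M. (\<lambda>n. Z n \<omega>) \<longlonglongrightarrow> 0"
    using AE_path
  proof eventually_elim
    case (elim \<omega>)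
    then have b: "continuous_on {0..} (\<lambda>s. B s \<omega>)" and w: "continuous_on {0..} (\<lambda>s. W s \<omega>)"
      and l: "is_symmetric_local_time (\<lambda>s. B s \<omega>) (\<lambda>s. L s \<omega>)"
      and eq: "\<And>s. 0 \<le> s \<Longrightarrow> B s \<omega> = x + W s \<omega> + \<gamma> * L s \<omega>" by auto
    show "(\<lambda>n. Z n \<omega>) \<longlonglongrightarrow> 0"
    proof (rule LIMSEQ_I)
      fix r :: real assume r: "0 < r"
      \<comment> \<open>Chosen so that (a C1 + 1) * 2\<delta> = r / 2; the summand 1 keeps the
        denominator positive.\<close>
      define \<delta> where "\<delta> = r / (2 * (a * C1 + 1) * 2)"
      have aC: "0 \<le> a * C1" using a0 C10 by simp
      have \<delta>: "0 < \<delta>" using r aC by (simp add: \<delta>_def)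
      obtain N1 where N1: "\<forall>n\<ge>N1. \<forall>i<n. \<forall>r r'. real i * (t / real n) \<le> r \<and> r \<le> real (Suc i) * (t / real n) \<and>
        real i * (t / real n) \<le> r' \<and> r' \<le> real (Suc i) * (t / real n) \<longrightarrow> \<bar>B r \<omega> - B r' \<omega>\<bar> \<le> \<delta>"
        using uniform_grid_modulus[OF b less_imp_le[OF t] \<delta>] by blast
      obtain N2 where N2: "\<forall>n\<ge>N2. \<forall>i<n. \<forall>r r'. real i * (t / real n) \<le> r \<and> r \<le> real (Suc i) * (t / real n) \<and>
        real i * (t / real n) \<le> r' \<and> r' \<le> real (Suc i) * (t / real n) \<longrightarrow> \<bar>W r \<omega> - W r' \<omega>\<bar> \<le> \<delta>"
        using uniform_grid_modulus[OF w less_imp_le[OF t] \<delta>] by blast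
      show "\<exists>no. \<forall>n\<ge>no. norm (Z n \<omega> - 0) < r"
      proof (intro exI[of _ "Suc (max N1 N2)"] allI impI)
        fix n assume n: "Suc (max N1 N2) \<le> n"
        then have np: "0 < n" by simp
        let ?c = "c0 + C1 * (2 * \<delta>)"
        have c: "0 \<le> ?c" using c00 C10 \<delta> by simp
        have "\<bar>T1 n i \<omega>\<bar> \<le> exp (\<kappa> * t) * (?c / \<theta> * (?l n i \<omega> - ?l n (Suc i) \<omega>))" if i: "i < n" for i
        proof -
          have "\<bar>J n i \<omega>\<bar> \<le> ?c / \<theta> * (?l n i \<omega> - ?l n (Suc i) \<omega>)"
            unfolding J_def C1_def c0_def \<Delta>_def
          proof (rule path_local_time_step(2)[OF b l eq g g' K(1-3) \<theta> \<tau>b(1)[of n i]])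
            show "\<tau> n i \<le> \<tau> n (Suc i)" using h0[of n] by (simp add: \<tau>S)
            then show "\<bar>W (\<tau> n (Suc i)) \<omega> - W (\<tau> n i) \<omega>\<bar> \<le> \<delta>"
              using N2[rule_format, of n i "\<tau> n (Suc i)" "\<tau> n i"] n i by (simp add: \<tau>_def h_def)
            fix r assume r: "\<tau> n i \<le> r" "r \<le> \<tau> n (Suc i)"
            then show "\<bar>B r \<omega> - B (\<tau> n i) \<omega>\<bar> \<le> \<delta> \<and> \<bar>B r \<omega> - B (\<tau> n (Suc i)) \<omega>\<bar> \<le> \<delta>"
              using N1[rule_format, of n i r "\<tau> n i"] N1[rule_format, of n i r "\<tau> n (Suc i)"] n i
              by (simp add: \<tau>_def h_def)
          qed auto
          then show ?thesis unfolding T1_def abs_mult using Eb(1)[of n "Suc i"] Eb(2)[of "Suc i" n] that by (intro mult_mono) auto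
        qed
        then have "\<bar>\<Sum>i<n. T1 n i \<omega>\<bar> \<le> (\<Sum>i<n. exp (\<kappa> * t) * (?c / \<theta> * (?l n i \<omega> - ?l n (Suc i) \<omega>)))"
          by (intro order_trans[OF sum_abs] sum_mono) auto
        also have "\<dots> = a * ?c * (\<Sum>i<n. ?l n i \<omega> - ?l n (Suc i) \<omega>)"
          unfolding sum_distrib_left a_def by (intro sum.cong refl) (simp add: mult.assoc)
        also have "\<dots> = a * ?c * (1 - ?lt \<omega>)"
          using local_time_0[OF l] \<tau>n[OF np] by (subst sum_lessThan_telescope') (simp add: \<tau>0)
        also have "\<dots> = a * c0 * (1 - ?lt \<omega>) + a * C1 * (2 * \<delta>) * (1 - ?lt \<omega>)" by (simp add: algebra_simps)
        also have "\<dots> \<le> a * c0 * (1 - ?lt \<omega>) + a * C1 * (2 * \<delta>)"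
          using aC \<delta> by (intro add_left_mono mult_left_le) auto
        also have "a * C1 * (2 * \<delta>) \<le> (a * C1 + 1) * (2 * \<delta>)" using \<delta> by (intro mult_right_mono) auto
        also have "\<dots> = r / 2" using aC by (simp add: \<delta>_def field_simps)
        finally have "Z n \<omega> \<le> r / 2" unfolding Z_def using r by linarith
        moreover have "0 \<le> Z n \<omega>" by (simp add: Z_def)
        ultimately show "norm (Z n \<omega> - 0) < r" unfolding real_norm_def using r by linarith
      qed
    qed
  qed
  \<comment> \<open>Indices are shifted to \<open>Suc n\<close> because the grid with n = 0 does not
    reach t.\<close>
  have ZE: "(\<lambda>n. expectation (Z (Suc n))) \<longlonglongrightarrow> 0"
  proof -
    have "(\<lambda>n. expectation (Z (Suc n))) \<longlonglongrightarrow> expectation (\<lambda>_. 0)"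
    proof (rule integral_dominated_convergence[where w = "\<lambda>_. a * C1"])
      show "AE \<omega> in M. (\<lambda>n. Z (Suc n) \<omega>) \<longlonglongrightarrow> 0"
        using Zlim by eventually_elim (rule LIMSEQ_Suc)
      fix n
      show "AE \<omega> in M. norm (Z (Suc n) \<omega>) \<le> a * C1"
        using T1sum[OF zero_less_Suc[of n]]
      proof eventually_elim
        case (elim \<omega>)
        have "0 \<le> a * c0 * (1 - ?lt \<omega>)" using a0 c00 L_nonneg \<theta> by simp
        moreover have "a * C1 * (1 - ?lt \<omega>) \<le> a * C1" using a0 C10 by (intro mult_left_le) auto
        moreover have "0 \<le> a * C1" using a0 C10 by simp
        ultimately show ?case using elim unfolding Z_def real_norm_def by linarith
      qed
    qed auto
    then show ?thesis by simp
  qed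
  have iZ: "integrable M (Z n)" for n
  proof (rule integrable_bounded)
    fix \<omega>
    have "\<bar>\<Sum>i<n. T1 n i \<omega>\<bar> \<le> (\<Sum>i<n. exp (\<kappa> * t) * (2 * K))"
      using T1b by (intro order_trans[OF sum_abs] sum_mono) auto
    moreover have "0 \<le> a * c0 * (1 - ?lt \<omega>)" using a0 c00 L_nonneg \<theta> by simp
    moreover have "0 \<le> (\<Sum>i<n. exp (\<kappa> * t) * (2 * K))" using K0 by (intro sum_nonneg) auto
    ultimately show "\<bar>Z n \<omega>\<bar> \<le> (\<Sum>i<n. exp (\<kappa> * t) * (2 * K))" unfolding Z_def by linarith
  qed auto
  have ilt: "integrable M ?lt" by (rule integrable_bounded[where C = 1]) (use L_nonneg \<theta> in auto)
  have bound: "\<bar>expectation (Y n n) - g x\<bar>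
      \<le> a * c0 * (1 - expectation ?lt) + expectation (Z n) + real n * (Cst * (h n * sqrt (h n))) + exp (\<kappa> * t) * \<eta> * (1 + h n * u)"
    if n: "0 < n" "h n \<le> 1" for n
  proof -
    have "expectation (Y n 0) = expectation (\<lambda>_. g x)"
    proof (rule integral_cong_AE)
      show "AE \<omega> in M. Y n 0 \<omega> = g x"
        using AE_path
      proof eventually_elim
        case (elim \<omega>)
        then have "L 0 \<omega> = 0" "B 0 \<omega> = x" using local_time_0[of "\<lambda>s. B s \<omega>" "\<lambda>s. L s \<omega>"] by auto
        then show ?case by (simp add: Y_def G_def E_def S_def \<tau>0)
      qed
    qed auto
    then have Y0: "expectation (Y n 0) = g x" by (simp add: prob_space)
    \<comment> \<open>Telescoping, with the compensator q subtracted from and added back to the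
      Brownian part.\<close>
    have tel: "Y n n \<omega> - Y n 0 \<omega> = (\<Sum>i<n. T1 n i \<omega>) + (\<Sum>i<n. T3 n i \<omega> - q n i \<omega>) + (\<Sum>i<n. q n i \<omega>)" for \<omega>
    proof -
      have "Y n n \<omega> - Y n 0 \<omega> = (\<Sum>i<n. Y n (Suc i) \<omega> - Y n i \<omega>)" using sum_lessThan_telescope[of "\<lambda>i. Y n i \<omega>" n] by simp
      then show ?thesis by (simp add: step sum.distrib sum_subtractf)
    qed
    have "expectation (Y n n) - g x = expectation (\<lambda>\<omega>. Y n n \<omega> - Y n 0 \<omega>)"
      using iY[of n n] iY[of 0 n] Y0 by simp
    also have "\<dots> = expectation (\<lambda>\<omega>. \<Sum>i<n. T1 n i \<omega>) + (\<Sum>i<n. expectation (\<lambda>\<omega>. T3 n i \<omega> - q n i \<omega>)) + expectation (\<lambda>\<omega>. \<Sum>i<n. q n i \<omega>)"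
    proof -
      have "integrable M (\<lambda>\<omega>. \<Sum>i<n. T1 n i \<omega>)" "integrable M (\<lambda>\<omega>. \<Sum>i<n. q n i \<omega>)"
        "integrable M (\<lambda>\<omega>. \<Sum>i<n. T3 n i \<omega> - q n i \<omega>)"
        using iT1 iT3 iq by (auto intro!: Bochner_Integration.integrable_sum Bochner_Integration.integrable_diff)
      moreover have "expectation (\<lambda>\<omega>. \<Sum>i<n. T3 n i \<omega> - q n i \<omega>) = (\<Sum>i<n. expectation (\<lambda>\<omega>. T3 n i \<omega> - q n i \<omega>))"
        using iT3 iq by (intro Bochner_Integration.integral_sum Bochner_Integration.integrable_diff) auto
      ultimately show ?thesis
        unfolding tel by (simp only: Bochner_Integration.integral_add Bochner_Integration.integrable_add)
    qed
    finally have "\<bar>expectation (Y n n) - g x\<bar> \<le> \<bar>expectation (\<lambda>\<omega>. \<Sum>i<n. T1 n i \<omega>)\<bar>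
        + \<bar>\<Sum>i<n. expectation (\<lambda>\<omega>. T3 n i \<omega> - q n i \<omega>)\<bar> + \<bar>expectation (\<lambda>\<omega>. \<Sum>i<n. q n i \<omega>)\<bar>"
      by linarith
    also have "\<bar>expectation (\<lambda>\<omega>. \<Sum>i<n. T1 n i \<omega>)\<bar> \<le> a * c0 * (1 - expectation ?lt) + expectation (Z n)"
    proof -
      have "\<bar>expectation (\<lambda>\<omega>. \<Sum>i<n. T1 n i \<omega>)\<bar> \<le> expectation (\<lambda>\<omega>. \<bar>\<Sum>i<n. T1 n i \<omega>\<bar>)"
        by (rule integral_abs_bound)
      also have "\<dots> \<le> expectation (\<lambda>\<omega>. a * c0 * (1 - ?lt \<omega>) + Z n \<omega>)"
      proof (rule integral_mono)
        show "integrable M (\<lambda>\<omega>. \<bar>\<Sum>i<n. T1 n i \<omega>\<bar>)"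
          using iT1 by (auto intro!: integrable_abs Bochner_Integration.integrable_sum)
        show "integrable M (\<lambda>\<omega>. a * c0 * (1 - ?lt \<omega>) + Z n \<omega>)"
          using ilt iZ[of n] by (intro Bochner_Integration.integrable_add integrable_mult_right Bochner_Integration.integrable_diff) auto
        show "\<bar>\<Sum>i<n. T1 n i \<omega>\<bar> \<le> a * c0 * (1 - ?lt \<omega>) + Z n \<omega>" for \<omega>
          unfolding Z_def by linarith
      qed
      also have "\<dots> = a * c0 * (1 - expectation ?lt) + expectation (Z n)"
        using ilt iZ[of n] by (simp add: prob_space)
      finally show ?thesis .
    qed
    also have "\<bar>\<Sum>i<n. expectation (\<lambda>\<omega>. T3 n i \<omega> - q n i \<omega>)\<bar> \<le> (\<Sum>i<n. Cst * (h n * sqrt (h n)))"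
      using gs n by (intro order_trans[OF sum_abs] sum_mono) auto
    also have "\<dots> = real n * (Cst * (h n * sqrt (h n)))" by simp
    also have "\<bar>expectation (\<lambda>\<omega>. \<Sum>i<n. q n i \<omega>)\<bar> \<le> exp (\<kappa> * t) * \<eta> * (1 + h n * u)"
    proof -
      have "\<bar>expectation (\<lambda>\<omega>. \<Sum>i<n. q n i \<omega>)\<bar> \<le> expectation (\<lambda>\<omega>. \<bar>\<Sum>i<n. q n i \<omega>\<bar>)"
        by (rule integral_abs_bound)
      also have "\<dots> \<le> expectation (\<lambda>\<omega>. exp (\<kappa> * t) * \<eta> * (1 + h n * u))"
        using iq by (intro integral_mono integrable_abs Bochner_Integration.integrable_sum) (auto intro: order_trans[OF sum_abs qsum])
      finally show ?thesis by (simp add: prob_space)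
    qed
    finally show ?thesis by simp
  qed
  let ?Y = "\<lambda>\<omega>. exp (- \<theta> * L t \<omega>) * exp (\<kappa> * t - integral {0..t} (\<lambda>s. U (B s \<omega>))) * g (B t \<omega>)"
  have limY: "(\<lambda>n. expectation (Y (Suc n) (Suc n))) \<longlonglongrightarrow> expectation ?Y"
  proof (rule integral_dominated_convergence[where w = "\<lambda>_. exp (\<kappa> * t) * K"])
    show "?Y \<in> borel_measurable M"
      using filtration_measurable_M[OF path_integral_adapted[OF U(1) less_imp_le[OF t]]] by measurable
    show "AE \<omega> in M. (\<lambda>n. Y (Suc n) (Suc n) \<omega>) \<longlonglongrightarrow> ?Y \<omega>"
    proof (rule AE_I2)
      fix \<omega> assume \<omega>: "\<omega> \<in> space M"
      have "continuous_on {0..t} (\<lambda>s. U (B s \<omega>))"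
        using continuous_on_compose2[OF U(1) continuous_on_subset[OF B_paths[OF \<omega>], of "{0..t}"]] by auto
      from LIMSEQ_Suc[OF riemann_sum_tendsto[OF this less_imp_le[OF t]]]
      have "(\<lambda>n. S (Suc n) (Suc n) \<omega>) \<longlonglongrightarrow> integral {0..t} (\<lambda>s. U (B s \<omega>))"
        by (simp only: S_def \<tau>_def h_def sum_distrib_left)
      then show "(\<lambda>n. Y (Suc n) (Suc n) \<omega>) \<longlonglongrightarrow> ?Y \<omega>"
        unfolding Y_def G_def E_def by (simp only: \<tau>n zero_less_Suc) (intro tendsto_intros)
    qed
    show "AE \<omega> in M. norm (Y (Suc n) (Suc n) \<omega>) \<le> exp (\<kappa> * t) * K" for n
      using Yb[of "Suc n" "Suc n"] by (intro AE_I2) (simp add: less_imp_le)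
  qed auto
  have h_lim: "(\<lambda>n. h (Suc n)) \<longlonglongrightarrow> 0"
    unfolding h_def using LIMSEQ_Suc[OF lim_const_over_n[of t]] by simp
  \<comment> \<open>Since n h = t, summing n errors of size h^(3/2) leaves t times the square root
    of h.\<close>
  have rate: "(\<lambda>n. real (Suc n) * (Cst * (h (Suc n) * sqrt (h (Suc n))))) \<longlonglongrightarrow> 0"
  proof -
    have lim: "(\<lambda>n. Cst * (t * sqrt (h (Suc n)))) \<longlonglongrightarrow> Cst * (t * sqrt 0)"
      by (intro tendsto_intros h_lim)
    have eq: "real (Suc n) * (Cst * (h (Suc n) * sqrt (h (Suc n)))) = Cst * (t * sqrt (h (Suc n)))" for n
      by (simp add: h_def)
    show ?thesis unfolding eq using lim by simp
  qed
  have ev: "eventually (\<lambda>n. h (Suc n) \<le> 1) sequentially"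
    using order_tendstoD(2)[OF h_lim, of 1] by (auto elim: eventually_mono)
  have lhs: "(\<lambda>n. \<bar>expectation (Y (Suc n) (Suc n)) - g x\<bar>) \<longlonglongrightarrow> \<bar>expectation ?Y - g x\<bar>"
    by (intro tendsto_intros limY)
  have rhs: "(\<lambda>n. a * c0 * (1 - expectation ?lt) + expectation (Z (Suc n)) + real (Suc n) * (Cst * (h (Suc n) * sqrt (h (Suc n))))
      + exp (\<kappa> * t) * \<eta> * (1 + h (Suc n) * u)) \<longlonglongrightarrow> a * c0 * (1 - expectation ?lt) + 0 + 0 + exp (\<kappa> * t) * \<eta> * (1 + 0 * u)"
    by (intro tendsto_intros ZE rate h_lim)
  have "\<bar>expectation ?Y - g x\<bar> \<le> a * c0 * (1 - expectation ?lt) + 0 + 0 + exp (\<kappa> * t) * \<eta> * (1 + 0 * u)"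
  proof (rule tendsto_le[OF _ rhs lhs])
    show "eventually (\<lambda>n. \<bar>expectation (Y (Suc n) (Suc n)) - g x\<bar> \<le> a * c0 * (1 - expectation ?lt) + expectation (Z (Suc n))
        + real (Suc n) * (Cst * (h (Suc n) * sqrt (h (Suc n)))) + exp (\<kappa> * t) * \<eta> * (1 + h (Suc n) * u)) sequentially"
      using ev by eventually_elim (rule bound[OF zero_less_Suc])
  qed simp
  then show ?thesis by (simp add: a_def algebra_simps)
qed

end

section \<open>Robin eigenfunctions\<close>

lemma antiderivative_on_reals:
  fixes f :: "real \<Rightarrow> real"
  assumes "continuous_on UNIV f"
  obtains F where "\<And>b. (F has_real_derivative f b) (at b)" "F 0 = 0"
proof -
  have "isCont f b" for b using assms by (simp add: continuous_on_eq_continuous_at)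
  then obtain F where F: "\<And>b. (F has_vector_derivative f b) (at b)"
    using einterval_antiderivative[of "- \<infinity>" \<infinity> f] by auto
  show ?thesis
  proof
    show "((\<lambda>b. F b - F 0) has_real_derivative f b) (at b)" for b
      using F[of b] by (auto simp: has_real_derivative_iff_has_vector_derivative intro!: derivative_eq_intros)
  qed simp
qed

text \<open>Outside [- r, r] the function is constant, so its value at b equals the value at b
  clamped to this interval.\<close>

lemma bounded_by_supported_deriv:
  fixes f f' :: "real \<Rightarrow> real"
  assumes f: "\<And>b. (f has_real_derivative f' b) (at b)" "f 0 = 0"
    and M: "\<And>b. \<bar>f' b\<bar> \<le> M" and r: "0 \<le> r" "\<And>b. r \<le> \<bar>b\<bar> \<Longrightarrow> f' b = 0"
  shows "\<bar>f b\<bar> \<le> M * \<bar>b\<bar>" "\<bar>f b\<bar> \<le> M * r"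
proof -
  have M0: "0 \<le> M" using M[of 0] by linarith
  have lip: "\<bar>f b\<bar> \<le> M * \<bar>b\<bar>" for b using bounded_deriv_lipschitz[OF f(1) M, of b 0] f(2) by simp
  then show "\<bar>f b\<bar> \<le> M * \<bar>b\<bar>" .
  define c where "c = max (- r) (min r b)"
  have "f b = f c"
  proof -
    consider "r < b" "c = r" | "b < - r" "c = - r" | "c = b" using r(1) unfolding c_def by linarith
    then show ?thesis
    proof cases
      case 1
      then obtain z where "r < z" "f b - f r = (b - r) * f' z" using MVT2[of r b f f'] f(1) by blast
      then show ?thesis using r(2)[of z] 1 by simp
    next
      case 2
      then obtain z where "z < - r" "f (- r) - f b = (- r - b) * f' z" using MVT2[of b "- r" f f'] f(1) by blast
      then show ?thesis using r(2)[of z] 2 by simp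
    qed simp
  qed
  moreover have "M * \<bar>c\<bar> \<le> M * r" using M0 r(1) by (intro mult_left_mono) (auto simp: c_def)
  ultimately show "\<bar>f b\<bar> \<le> M * r" using lip[of c] by simp
qed

lemma abs_sin_cos_comb: "\<bar>x\<bar> \<le> X \<Longrightarrow> \<bar>y\<bar> \<le> Y \<Longrightarrow> \<bar>x * cos r + y * sin r\<bar> \<le> X + Y" for x y r :: real
  by (rule order_trans[OF abs_triangle_ineq], rule add_mono)
    (auto simp: abs_mult intro!: order_trans[OF mult_left_le])

text \<open>Variation of constants gives a smooth even solution \<open>g\<close> of \<open>g'' + k\<^sup>2 g = 2 \<mu> k \<phi>\<close>, where \<open>\<phi>\<close> is
  the trapezoid; it converges to the Robin eigenfunction \<open>k cos (k b) + \<mu> sin (k \<bar>b\<bar>)\<close>.\<close>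

lemma robin_test_function:
  fixes k \<mu> \<epsilon> :: real
  assumes \<epsilon>: "0 < \<epsilon>" "\<epsilon> \<le> 1" and \<mu>: "0 < \<mu>"
  shows "\<exists>g g' g'' K. (\<forall>b. (g has_real_derivative g' b) (at b)) \<and> (\<forall>b. (g' has_real_derivative g'' b) (at b)) \<and>
    (\<forall>b. \<bar>g b\<bar> \<le> K) \<and> (\<forall>b. \<bar>g' b\<bar> \<le> K) \<and> (\<forall>b. \<bar>g'' b\<bar> \<le> K) \<and> (\<forall>a b. \<bar>g'' a - g'' b\<bar> \<le> K * \<bar>a - b\<bar>) \<and>
    g 0 = k \<and> g' 0 = 0 \<and> (\<forall>b. \<bar>g b\<bar> \<le> \<bar>k\<bar> + 4 * \<mu>) \<and>
    (\<forall>b. \<bar>g'' b / 2 - (\<mu> * trapezoid \<epsilon> b - k\<^sup>2 / 2) * g b\<bar> \<le> 2 * \<epsilon> * (k\<^sup>2 + 4 * \<mu> * \<bar>k\<bar>) * (\<mu> * trapezoid \<epsilon> b)) \<and>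
    (\<forall>b. 2 * \<epsilon> \<le> \<bar>b\<bar> \<longrightarrow> \<bar>g b - (k * cos (k * b) + \<mu> * sin (k * \<bar>b\<bar>))\<bar> \<le> \<mu> * (1 + 8 * \<bar>k\<bar>) * \<epsilon>)"
proof -
  let ?\<phi> = "trapezoid \<epsilon>"
  define r where "r = \<epsilon> * (1 + \<epsilon>)"
  have r: "0 \<le> r" "\<epsilon> \<le> r" "r \<le> 2 * \<epsilon>" using \<epsilon> by (auto simp: r_def algebra_simps mult_left_le)
  note tb = trapezoid_bounds[OF \<epsilon>(1), folded r_def]
  have c\<phi>: "continuous_on UNIV ?\<phi>" by (intro continuous_intros)
  \<comment> \<open>C and S are the coefficients in the variation of constants; F, the integral of
    the trapezoid alone, serves to compute the limit of C.\<close>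
  obtain C where C: "\<And>b. (C has_real_derivative cos (k * b) * ?\<phi> b) (at b)" "C 0 = 0"
    by (rule antiderivative_on_reals[of "\<lambda>b. cos (k * b) * ?\<phi> b"]) (intro continuous_intros, blast)
  obtain S where S: "\<And>b. (S has_real_derivative sin (k * b) * ?\<phi> b) (at b)" "S 0 = 0"
    by (rule antiderivative_on_reals[of "\<lambda>b. sin (k * b) * ?\<phi> b"]) (intro continuous_intros, blast)
  obtain F where F: "\<And>b. (F has_real_derivative ?\<phi> b) (at b)" "F 0 = 0"
    by (rule antiderivative_on_reals[OF c\<phi>]) blast
  have le1: "\<bar>c * ?\<phi> b\<bar> \<le> 1 / (2 * \<epsilon>)" if "\<bar>c\<bar> \<le> 1" for c b
  proof -
    have "\<bar>c * ?\<phi> b\<bar> \<le> 1 * (1 / (2 * \<epsilon>))" unfolding abs_mult using tb(1,2)[of b] that by (intro mult_mono) auto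
    then show ?thesis by simp
  qed
  \<comment> \<open>A factor vanishing linearly at 0 compensates the height 1/(2\<epsilon>) on a
    support of radius at most 2\<epsilon>, so the bound is free of \<epsilon>.\<close>
  have small: "\<bar>c * ?\<phi> b\<bar> \<le> \<bar>k\<bar>" if "\<bar>c\<bar> \<le> \<bar>k\<bar> * \<bar>b\<bar>" for c b
  proof (cases "r \<le> \<bar>b\<bar>")
    case False
    have "\<bar>c\<bar> \<le> \<bar>k\<bar> * (2 * \<epsilon>)" using that False r by (intro order_trans[OF that] mult_left_mono) auto
    then have "\<bar>c\<bar> * \<bar>?\<phi> b\<bar> \<le> \<bar>k\<bar> * (2 * \<epsilon>) * (1 / (2 * \<epsilon>))" using tb(1,2)[of b] \<epsilon> by (intro mult_mono) auto
    then show ?thesis using \<epsilon> by (simp add: abs_mult)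
  qed (simp add: tb(4))
  have sinle: "\<bar>sin (k * b)\<bar> \<le> \<bar>k\<bar> * \<bar>b\<bar>" for b
    using abs_sin_x_le_abs_x[of "k * b"] by (simp add: abs_mult)
  have cosle: "\<bar>cos (k * b) - 1\<bar> \<le> \<bar>k\<bar> * \<bar>b\<bar>" for b
    using bounded_deriv_lipschitz[of cos "\<lambda>b. - sin b" 1 "k * b" 0] by (simp add: abs_mult)
  have M1: "1 / (2 * \<epsilon>) * r \<le> 1" using r \<epsilon> by (simp add: field_simps)
  have C1: "\<bar>C b\<bar> \<le> 1" for b
    using bounded_by_supported_deriv(2)[OF C, of "1 / (2 * \<epsilon>)" r b] le1 tb(4) r M1 by force
  have S1: "\<bar>S b\<bar> \<le> 1" for b
    using bounded_by_supported_deriv(2)[OF S, of "1 / (2 * \<epsilon>)" r b] le1 tb(4) r M1 by force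
  have Sk: "\<bar>S b\<bar> \<le> \<bar>k\<bar> * \<bar>b\<bar>" "\<bar>S b\<bar> \<le> \<bar>k\<bar> * r" for b
    using bounded_by_supported_deriv[OF S, of "\<bar>k\<bar>" r b] small[OF sinle] tb(4) r by auto
  have CF: "\<bar>C b - F b\<bar> \<le> \<bar>k\<bar> * r" for b
  proof (rule bounded_by_supported_deriv(2)[where f = "\<lambda>b. C b - F b"])
    show "((\<lambda>b. C b - F b) has_real_derivative (cos (k * b) - 1) * ?\<phi> b) (at b)" for b
      using DERIV_diff[OF C(1)[of b] F(1)[of b]] by (simp add: algebra_simps)
    show "\<bar>(cos (k * b) - 1) * ?\<phi> b\<bar> \<le> \<bar>k\<bar>" for b by (rule small[OF cosle])
  qed (use C F r tb(4) in auto)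
  \<comment> \<open>The plateau contributes exactly 1/2; the ramp adds at most its width
    \<epsilon>^2 times the height 1/(2\<epsilon>).\<close>
  have Fb: "\<bar>F b - 1 / 2\<bar> \<le> \<epsilon> / 2" if b: "2 * \<epsilon> \<le> b" for b
  proof -
    have "\<epsilon> < r" using \<epsilon> by (simp add: r_def)
    obtain z1 where z1: "0 < z1" "z1 < \<epsilon>" "F \<epsilon> - F 0 = (\<epsilon> - 0) * ?\<phi> z1" using MVT2[of 0 \<epsilon> F ?\<phi>] F(1) \<epsilon> by blast
    have e1: "F \<epsilon> = 1 / 2" using z1 F(2) tb(3)[of z1] \<epsilon> by simp
    obtain z2 where z2: "\<epsilon> < z2" "z2 < r" "F r - F \<epsilon> = (r - \<epsilon>) * ?\<phi> z2" using MVT2[of \<epsilon> r F ?\<phi>] F(1) \<open>\<epsilon> < r\<close> by blast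
    have re: "r - \<epsilon> = \<epsilon> * \<epsilon>" by (simp add: r_def algebra_simps)
    have "(r - \<epsilon>) * ?\<phi> z2 \<le> \<epsilon> * \<epsilon> * (1 / (2 * \<epsilon>))" unfolding re using tb(2) \<epsilon> by (intro mult_left_mono) auto
    also have "\<dots> = \<epsilon> / 2" using \<epsilon> by simp
    finally have "(r - \<epsilon>) * ?\<phi> z2 \<le> \<epsilon> / 2" .
    moreover have "0 \<le> (r - \<epsilon>) * ?\<phi> z2" using tb(1) \<open>\<epsilon> < r\<close> by simp
    moreover have "F b = F r"
    proof (cases "r < b")
      case True
      then obtain z where "r < z" "F b - F r = (b - r) * ?\<phi> z" using MVT2[of r b F ?\<phi>] F(1) by blast
      then show ?thesis using tb(4)[of z] by simp
    next
      case False
      then have "b = r" using b r by linarith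
      then show ?thesis by simp
    qed
    ultimately show ?thesis using z2(3) e1 by auto
  qed
  \<comment> \<open>The bracket is the integral of sin(k (b - s)) \<phi>(s) over s from 0 to b. As C
    tends to 1/2 and S to 0 for b > 0, the limit there is k cos(k b) + \<mu> sin(k b).\<close>
  define g where "g b = k * cos (k * b) + 2 * \<mu> * (sin (k * b) * C b - cos (k * b) * S b)" for b
  define g' where "g' b = - k\<^sup>2 * sin (k * b) + 2 * \<mu> * k * (cos (k * b) * C b + sin (k * b) * S b)" for b
  define g'' where "g'' b = - k\<^sup>2 * g b + 2 * \<mu> * k * ?\<phi> b" for b
  have dg: "(g has_real_derivative g' b) (at b)" for b
  proof -
    have "(g has_real_derivative k * (- sin (k * b) * k) + 2 * \<mu> * ((cos (k * b) * k * C b + (cos (k * b) * ?\<phi> b) * sin (k * b))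
        - (- sin (k * b) * k * S b + (sin (k * b) * ?\<phi> b) * cos (k * b)))) (at b)"
      unfolding g_def
      by (auto intro!: derivative_eq_intros C(1) S(1))
    then show ?thesis by (simp add: g'_def algebra_simps power2_eq_square)
  qed
  have dg': "(g' has_real_derivative g'' b) (at b)" for b
  proof -
    have "(g' has_real_derivative - k\<^sup>2 * (cos (k * b) * k) + 2 * \<mu> * k * ((- sin (k * b) * k * C b + (cos (k * b) * ?\<phi> b) * cos (k * b))
        + (cos (k * b) * k * S b + (sin (k * b) * ?\<phi> b) * sin (k * b)))) (at b)"
      unfolding g'_def
      by (auto intro!: derivative_eq_intros C(1) S(1))
    moreover have "- k\<^sup>2 * (cos (k * b) * k) + 2 * \<mu> * k * ((- sin (k * b) * k * C b + (cos (k * b) * ?\<phi> b) * cos (k * b))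
        + (cos (k * b) * k * S b + (sin (k * b) * ?\<phi> b) * sin (k * b)))
      = - k\<^sup>2 * g b + 2 * \<mu> * k * ?\<phi> b * ((sin (k * b))\<^sup>2 + (cos (k * b))\<^sup>2)"
    proof -
      have "- k\<^sup>2 * (c * k) + 2 * \<mu> * k * ((- s * k * C b + (c * ?\<phi> b) * c) + (c * k * S b + (s * ?\<phi> b) * s))
        = - k\<^sup>2 * (k * c + 2 * \<mu> * (s * C b - c * S b)) + 2 * \<mu> * k * ?\<phi> b * (s\<^sup>2 + c\<^sup>2)" for s c
        by (simp add: algebra_simps power2_eq_square)
      then show ?thesis unfolding g_def .
    qed
    ultimately show ?thesis by (simp add: g''_def)
  qed
  have scb: "\<bar>sin (k * b) * C b - cos (k * b) * S b\<bar> \<le> 2" "\<bar>cos (k * b) * C b + sin (k * b) * S b\<bar> \<le> 2" for b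
    using abs_sin_cos_comb[of "- S b" 1 "C b" 1 "k * b"] abs_sin_cos_comb[of "C b" 1 "S b" 1 "k * b"] C1[of b] S1[of b]
    by (auto simp: algebra_simps)
  have gb: "\<bar>g b\<bar> \<le> \<bar>k\<bar> + 4 * \<mu>" for b
  proof -
    have "\<bar>k * cos (k * b)\<bar> \<le> \<bar>k\<bar>" by (simp add: abs_mult mult_left_le)
    moreover have "\<bar>2 * \<mu> * (sin (k * b) * C b - cos (k * b) * S b)\<bar> \<le> 2 * \<mu> * 2"
      unfolding abs_mult[of "2 * \<mu>"] using scb(1)[of b] \<mu> by (intro mult_mono) auto
    ultimately show ?thesis unfolding g_def by linarith
  qed
  have g'b: "\<bar>g' b\<bar> \<le> k\<^sup>2 + 4 * \<mu> * \<bar>k\<bar>" for b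
  proof -
    have "\<bar>- k\<^sup>2 * sin (k * b)\<bar> \<le> k\<^sup>2" by (simp add: abs_mult mult_left_le)
    moreover have "\<bar>2 * \<mu> * k * (cos (k * b) * C b + sin (k * b) * S b)\<bar> \<le> 2 * \<mu> * \<bar>k\<bar> * 2"
      unfolding abs_mult[of "2 * \<mu> * k"] using scb(2)[of b] \<mu> by (intro mult_mono) (auto simp: abs_mult)
    ultimately show ?thesis unfolding g'_def by linarith
  qed
  \<comment> \<open>The sum of the bounds for g, g', g'' and for the Lipschitz constant of g''. It
    explodes as \<epsilon> tends to 0, which is harmless because the conclusion of
    \<open>ito_inequality\<close> does not contain it.\<close>
  define K where "K = (\<bar>k\<bar> + 4 * \<mu>) + (k\<^sup>2 + 4 * \<mu> * \<bar>k\<bar>) + (k\<^sup>2 * (\<bar>k\<bar> + 4 * \<mu>) + 2 * \<mu> * \<bar>k\<bar> * (1 / (2 * \<epsilon>)))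
    + (k\<^sup>2 * (k\<^sup>2 + 4 * \<mu> * \<bar>k\<bar>) + 2 * \<mu> * \<bar>k\<bar> * (1 / (2 * \<epsilon> ^ 3)))"
  have pos: "0 \<le> \<bar>k\<bar> + 4 * \<mu>" "0 \<le> k\<^sup>2 + 4 * \<mu> * \<bar>k\<bar>" "0 \<le> k\<^sup>2 * (\<bar>k\<bar> + 4 * \<mu>) + 2 * \<mu> * \<bar>k\<bar> * (1 / (2 * \<epsilon>))"
    "0 \<le> k\<^sup>2 * (k\<^sup>2 + 4 * \<mu> * \<bar>k\<bar>) + 2 * \<mu> * \<bar>k\<bar> * (1 / (2 * \<epsilon> ^ 3))"
    using \<mu> \<epsilon> by (auto intro!: add_nonneg_nonneg mult_nonneg_nonneg)
  have g''b: "\<bar>g'' b\<bar> \<le> K" for b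
  proof -
    have "\<bar>- k\<^sup>2 * g b\<bar> \<le> k\<^sup>2 * (\<bar>k\<bar> + 4 * \<mu>)" using gb[of b] by (simp add: abs_mult mult_left_mono)
    moreover have "\<bar>2 * \<mu> * k * ?\<phi> b\<bar> \<le> 2 * \<mu> * \<bar>k\<bar> * (1 / (2 * \<epsilon>))"
      unfolding abs_mult[of "2 * \<mu> * k"] using tb(1,2)[of b] \<mu> by (intro mult_mono) (auto simp: abs_mult)
    ultimately show ?thesis unfolding g''_def K_def using pos by linarith
  qed
  have g''l: "\<bar>g'' a - g'' b\<bar> \<le> K * \<bar>a - b\<bar>" for a b
  proof -
    have "\<bar>g'' a - g'' b\<bar> \<le> k\<^sup>2 * \<bar>g a - g b\<bar> + 2 * \<mu> * \<bar>k\<bar> * \<bar>?\<phi> a - ?\<phi> b\<bar>"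
    proof -
      have "g'' a - g'' b = - k\<^sup>2 * (g a - g b) + 2 * \<mu> * k * (?\<phi> a - ?\<phi> b)" by (simp add: g''_def algebra_simps)
      then show ?thesis using abs_triangle_ineq[of "- k\<^sup>2 * (g a - g b)" "2 * \<mu> * k * (?\<phi> a - ?\<phi> b)"] \<mu> by (simp add: abs_mult)
    qed
    also have "\<dots> \<le> k\<^sup>2 * ((k\<^sup>2 + 4 * \<mu> * \<bar>k\<bar>) * \<bar>a - b\<bar>) + 2 * \<mu> * \<bar>k\<bar> * (1 / (2 * \<epsilon> ^ 3) * \<bar>a - b\<bar>)"
      using bounded_deriv_lipschitz[OF dg g'b, of a b] trapezoid_lipschitz[OF \<epsilon>(1), of a b] \<mu>
      by (intro add_mono mult_left_mono) auto
    also have "\<dots> = (k\<^sup>2 * (k\<^sup>2 + 4 * \<mu> * \<bar>k\<bar>) + 2 * \<mu> * \<bar>k\<bar> * (1 / (2 * \<epsilon> ^ 3))) * \<bar>a - b\<bar>"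
      by (simp add: algebra_simps)
    also have "\<dots> \<le> K * \<bar>a - b\<bar>" using pos by (intro mult_right_mono) (auto simp: K_def)
    finally show ?thesis .
  qed
  have near: "\<bar>g'' b / 2 - (\<mu> * ?\<phi> b - k\<^sup>2 / 2) * g b\<bar> \<le> 2 * \<epsilon> * (k\<^sup>2 + 4 * \<mu> * \<bar>k\<bar>) * (\<mu> * ?\<phi> b)" for b
  proof -
    \<comment> \<open>The forcing term is k \<phi> where an exact solution with the potential would
      have g \<phi>. Since g 0 = k, the difference is small on the support of \<phi> and
      proportional to the potential, as the hypothesis on \<eta> demands.\<close>
    have eq: "g'' b / 2 - (\<mu> * ?\<phi> b - k\<^sup>2 / 2) * g b = (k - g b) * (\<mu> * ?\<phi> b)"
      by (simp add: g''_def field_simps)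
    show ?thesis
    proof (cases "r \<le> \<bar>b\<bar>")
      case True
      then show ?thesis unfolding eq using tb(4) by simp
    next
      case False
      have "\<bar>k * (cos (k * b) - 1)\<bar> \<le> \<bar>k\<bar> * (\<bar>k\<bar> * \<bar>b\<bar>)" unfolding abs_mult[of k] by (intro mult_left_mono cosle) auto
      moreover have "\<bar>sin (k * b) * C b\<bar> \<le> (\<bar>k\<bar> * \<bar>b\<bar>) * 1" unfolding abs_mult[of "sin (k * b)"] by (intro mult_mono sinle C1) auto
      moreover have "\<bar>cos (k * b) * S b\<bar> \<le> 1 * (\<bar>k\<bar> * \<bar>b\<bar>)" unfolding abs_mult[of "cos (k * b)"] by (intro mult_mono Sk) auto
      ultimately have 1: "\<bar>k * (cos (k * b) - 1)\<bar> \<le> k\<^sup>2 * \<bar>b\<bar>" "\<bar>sin (k * b) * C b - cos (k * b) * S b\<bar> \<le> 2 * (\<bar>k\<bar> * \<bar>b\<bar>)"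
        by (simp_all only: mult.assoc[symmetric] abs_mult_self_eq power2_eq_square mult_1_left mult_1_right) linarith
      have "\<bar>2 * \<mu> * (sin (k * b) * C b - cos (k * b) * S b)\<bar> \<le> 2 * \<mu> * (2 * (\<bar>k\<bar> * \<bar>b\<bar>))"
        unfolding abs_mult[of "2 * \<mu>"] using 1(2) \<mu> by (intro mult_mono) auto
      moreover have "g b - k = k * (cos (k * b) - 1) + 2 * \<mu> * (sin (k * b) * C b - cos (k * b) * S b)"
        by (simp add: g_def algebra_simps)
      ultimately have "\<bar>k - g b\<bar> \<le> (k\<^sup>2 + 4 * \<mu> * \<bar>k\<bar>) * \<bar>b\<bar>"
        using 1(1) by (simp add: algebra_simps)
      also have "\<dots> \<le> (k\<^sup>2 + 4 * \<mu> * \<bar>k\<bar>) * (2 * \<epsilon>)" using False r pos by (intro mult_left_mono) auto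
      finally show ?thesis unfolding eq abs_mult[of "k - g b"] using tb(1)[of b] \<mu> 
        by (intro mult_mono) (auto simp: mult_ac)
    qed
  qed
  have far: "\<bar>g b - (k * cos (k * b) + \<mu> * sin (k * b))\<bar> \<le> \<mu> * (1 + 8 * \<bar>k\<bar>) * \<epsilon>" if b: "2 * \<epsilon> \<le> b" for b
  proof -
    have "\<bar>C b - 1 / 2\<bar> \<le> \<bar>k\<bar> * r + \<epsilon> / 2" using CF[of b] Fb[OF b] by linarith
    then have "\<bar>- S b * cos (k * b) + (C b - 1 / 2) * sin (k * b)\<bar> \<le> \<bar>k\<bar> * r + (\<bar>k\<bar> * r + \<epsilon> / 2)"
      using Sk(2)[of b] by (intro abs_sin_cos_comb) auto
    also have "\<dots> \<le> (1 + 8 * \<bar>k\<bar>) * \<epsilon> / 2" using mult_left_mono[OF r(3), of "\<bar>k\<bar>"] by (simp add: algebra_simps)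
    finally have "2 * \<mu> * \<bar>- S b * cos (k * b) + (C b - 1 / 2) * sin (k * b)\<bar> \<le> 2 * \<mu> * ((1 + 8 * \<bar>k\<bar>) * \<epsilon> / 2)"
      using \<mu> by (intro mult_left_mono) auto
    moreover have "g b - (k * cos (k * b) + \<mu> * sin (k * b)) = 2 * \<mu> * (- S b * cos (k * b) + (C b - 1 / 2) * sin (k * b))"
      by (simp add: g_def algebra_simps)
    ultimately show ?thesis using \<mu> by (simp add: abs_mult)
  qed
  \<comment> \<open>The trapezoid is even, so C is odd and S even; thus g is even and the estimate
    for positive b carries over to negative b.\<close>
  have Codd: "C (- b) = - C b" for b
  proof -
    have "((\<lambda>b. C b + C (- b)) has_real_derivative 0) (at b)" for b
      using DERIV_add[OF C(1)[of b] DERIV_chain2[OF C(1)[of "- b"] DERIV_minus[OF DERIV_ident]]] by simp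
    then have "C b + C (- b) = C 0 + C (- 0)" using DERIV_isconst_all by blast
    then show ?thesis using C(2) by simp
  qed
  have Seven: "S (- b) = S b" for b
  proof -
    have "((\<lambda>b. S b - S (- b)) has_real_derivative 0) (at b)" for b
      using DERIV_diff[OF S(1)[of b] DERIV_chain2[OF S(1)[of "- b"] DERIV_minus[OF DERIV_ident]]] by simp
    then have "S b - S (- b) = S 0 - S (- 0)" using DERIV_isconst_all by blast
    then show ?thesis by simp
  qed
  have "g (- b) = g b" for b by (simp add: g_def Codd Seven)
  then have "g \<bar>b\<bar> = g b" for b by (auto simp: abs_if)
  moreover have "cos (k * \<bar>b\<bar>) = cos (k * b)" for b by (cases "0 \<le> b") auto
  ultimately have far': "\<bar>g b - (k * cos (k * b) + \<mu> * sin (k * \<bar>b\<bar>))\<bar> \<le> \<mu> * (1 + 8 * \<bar>k\<bar>) * \<epsilon>" if "2 * \<epsilon> \<le> \<bar>b\<bar>" for b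
    using far[OF that] by simp
  have g0: "g 0 = k" "g' 0 = 0" by (simp_all add: g_def g'_def C(2) S(2))
  have gK: "\<bar>g b\<bar> \<le> K" "\<bar>g' b\<bar> \<le> K" for b using gb[of b] g'b[of b] pos unfolding K_def by linarith+
  show ?thesis
    using dg dg' gK g''b g''l g0 gb near far' by blast
qed

section \<open>The two Robin identities for the process\<close>

context skew_continuous
begin

text \<open>Here \<open>ito_inequality\<close> is applied with zero potential and \<kappa> = k^2/2:
  g is an exact eigenfunction, so \<eta> = 0, and the drift of \<open>exp (- \<theta> l) g b\<close>
  along the local time vanishes at 0. The error bound is then 0.\<close>

lemma skew_identity:
  assumes t: "0 < t" and \<theta>: "0 < \<theta>"
  shows "expectation (\<lambda>\<omega>. exp (- \<theta> * L t \<omega>) * (\<theta> * sin (k * B t \<omega>) + \<gamma> * k * cos (k * B t \<omega>)))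
    = exp (- (k\<^sup>2 * t / 2)) * (\<theta> * sin (k * x) + \<gamma> * k * cos (k * x))"
proof -
  define g where "g b = \<theta> * sin (k * b) + \<gamma> * k * cos (k * b)" for b
  define g' where "g' b = \<theta> * k * cos (k * b) - \<gamma> * k\<^sup>2 * sin (k * b)" for b
  define g'' where "g'' b = - k\<^sup>2 * g b" for b
  define A where "A = \<theta> + \<bar>\<gamma> * k\<bar>"
  define K where "K = A + \<bar>k\<bar> * A + k\<^sup>2 * A + k\<^sup>2 * (\<bar>k\<bar> * A)"
  have A: "0 \<le> A" "0 \<le> \<bar>k\<bar> * A" "0 \<le> k\<^sup>2 * A" "0 \<le> k\<^sup>2 * (\<bar>k\<bar> * A)" using \<theta> by (auto simp: A_def)
  have gb: "\<bar>g b\<bar> \<le> A" for b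
    using abs_sin_cos_comb[of "\<gamma> * k" "\<bar>\<gamma> * k\<bar>" \<theta> \<theta> "k * b"] \<theta> by (simp add: g_def A_def add.commute)
  have g'b: "\<bar>g' b\<bar> \<le> \<bar>k\<bar> * A" for b
  proof -
    have "g' b = k * (\<theta> * cos (k * b) + (- \<gamma> * k) * sin (k * b))" by (simp add: g'_def algebra_simps power2_eq_square)
    moreover have "\<bar>\<theta> * cos (k * b) + (- \<gamma> * k) * sin (k * b)\<bar> \<le> A"
      unfolding A_def
    proof (rule abs_sin_cos_comb)
      show "\<bar>- \<gamma> * k\<bar> \<le> \<bar>\<gamma> * k\<bar>" by (simp only: mult_minus_left abs_minus_cancel order_refl)
    qed (use \<theta> in simp)
    ultimately show ?thesis by (simp only: abs_mult[of k] mult_left_mono abs_ge_zero)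
  qed
  have g: "(g has_real_derivative g' b) (at b)" for b
    unfolding g_def g'_def by (auto intro!: derivative_eq_intros simp: power2_eq_square algebra_simps)
  have g': "(g' has_real_derivative g'' b) (at b)" for b
    unfolding g_def g'_def g''_def by (auto intro!: derivative_eq_intros simp: power2_eq_square algebra_simps)
  have c0: "\<bar>\<gamma> * g' 0 - \<theta> * g 0\<bar> = 0" by (simp add: g_def g'_def)
  have g''b: "\<bar>g'' b\<bar> \<le> k\<^sup>2 * A" for b unfolding g''_def abs_mult using gb[of b] by (simp add: mult_left_mono)
  have g''l: "\<bar>g'' a - g'' b\<bar> \<le> K * \<bar>a - b\<bar>" for a b
  proof -
    have "\<bar>g'' a - g'' b\<bar> = k\<^sup>2 * \<bar>g a - g b\<bar>" unfolding g''_def right_diff_distrib[symmetric] abs_mult by simp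
    also have "\<dots> \<le> k\<^sup>2 * (\<bar>k\<bar> * A * \<bar>a - b\<bar>)"
      using bounded_deriv_lipschitz[OF g g'b, of a b] by (intro mult_left_mono) auto
    also have "\<dots> = k\<^sup>2 * (\<bar>k\<bar> * A) * \<bar>a - b\<bar>" by (simp add: mult.assoc)
    also have "\<dots> \<le> K * \<bar>a - b\<bar>" using A by (intro mult_right_mono) (auto simp: K_def)
    finally show ?thesis .
  qed
  have "\<bar>expectation (\<lambda>\<omega>. exp (- \<theta> * L t \<omega>) * exp (k\<^sup>2 / 2 * t - integral {0..t} (\<lambda>s. 0)) * g (B t \<omega>)) - g x\<bar>
    \<le> exp (k\<^sup>2 / 2 * t) * (0 + \<bar>\<gamma> * g' 0 - \<theta> * g 0\<bar> / \<theta> * (1 - expectation (\<lambda>\<omega>. exp (- \<theta> * L t \<omega>))))"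
  proof (rule ito_inequality[OF t \<theta> _ g g' _ _ _ g''l, where u = 0])
    show "\<bar>g b\<bar> \<le> K" "\<bar>g' b\<bar> \<le> K" "\<bar>g'' b\<bar> \<le> K" for b
      using gb[of b] g'b[of b] g''b[of b] A unfolding K_def by linarith+
    show "\<bar>g'' b / 2 - (0 - k\<^sup>2 / 2) * g b\<bar> \<le> 0 * 0" for b by (simp add: g''_def)
  qed auto
  then have "expectation (\<lambda>\<omega>. exp (- \<theta> * L t \<omega>) * exp (k\<^sup>2 / 2 * t) * g (B t \<omega>)) = g x"
    unfolding c0 by simp
  moreover have "expectation (\<lambda>\<omega>. exp (- \<theta> * L t \<omega>) * exp (k\<^sup>2 / 2 * t) * g (B t \<omega>))
      = exp (k\<^sup>2 / 2 * t) * expectation (\<lambda>\<omega>. exp (- \<theta> * L t \<omega>) * g (B t \<omega>))"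
    by (subst Bochner_Integration.integral_mult_right_zero[symmetric]) (simp add: mult_ac)
  ultimately have "exp (k\<^sup>2 / 2 * t) * expectation (\<lambda>\<omega>. exp (- \<theta> * L t \<omega>) * g (B t \<omega>)) = g x" by simp
  then have "expectation (\<lambda>\<omega>. exp (- \<theta> * L t \<omega>) * g (B t \<omega>)) = exp (- (k\<^sup>2 * t / 2)) * g x"
    by (simp add: exp_minus field_simps)
  then show ?thesis by (simp only: g_def)
qed

text \<open>Let \<theta> tend to 0 in \<open>ito_inequality\<close>. With g' 0 = 0 the drift
  constant divided by \<theta> is |g 0|, independent of \<theta>, while 1 - E exp(- \<theta> L)
  tends to 0. The local time weight disappears and only the potential remains.\<close>

lemma smoothed_robin_identity:
  assumes t: "0 < t" and \<kappa>: "0 \<le> \<kappa>"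
    and g: "\<And>b. (g has_real_derivative g' b) (at b)" and g': "\<And>b. (g' has_real_derivative g'' b) (at b)"
    and K: "\<And>b. \<bar>g b\<bar> \<le> K" "\<And>b. \<bar>g' b\<bar> \<le> K" "\<And>b. \<bar>g'' b\<bar> \<le> K" "\<And>a b. \<bar>g'' a - g'' b\<bar> \<le> K * \<bar>a - b\<bar>"
    and U: "continuous_on UNIV U" "\<And>b. 0 \<le> U b" "\<And>b. U b \<le> u"
    and \<eta>: "\<And>b. \<bar>g'' b / 2 - (U b - \<kappa>) * g b\<bar> \<le> \<eta> * U b" "0 \<le> \<eta>"
    and g'0: "g' 0 = 0"
  shows "\<bar>expectation (\<lambda>\<omega>. exp (\<kappa> * t - integral {0..t} (\<lambda>s. U (B s \<omega>))) * g (B t \<omega>)) - g x\<bar> \<le> exp (\<kappa> * t) * \<eta>"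
proof -
  let ?X = "\<lambda>\<omega>. exp (\<kappa> * t - integral {0..t} (\<lambda>s. U (B s \<omega>))) * g (B t \<omega>)"
  define \<theta> where "\<theta> n = inverse (real (Suc n))" for n
  have \<theta>: "0 < \<theta> n" for n by (simp add: \<theta>_def)
  have \<theta>lim: "\<theta> \<longlonglongrightarrow> 0" unfolding \<theta>_def by (rule LIMSEQ_inverse_real_of_nat)
  have [measurable]: "random_variable borel (L t)" "random_variable borel (B t)"
    using t by (auto intro: local_time_measurable B_measurable)
  have gm [measurable]: "g \<in> borel_measurable borel"
    using g by (meson DERIV_isCont continuous_at_imp_continuous_on borel_measurable_continuous_onI)
  have [measurable]: "random_variable borel (\<lambda>\<omega>. integral {0..t} (\<lambda>s. U (B s \<omega>)))"
    using filtration_measurable_M[OF path_integral_adapted[OF U(1) less_imp_le[OF t]]] .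
  have K0: "0 \<le> K" using K(1)[of 0] by linarith
  have Xb: "\<bar>?X \<omega>\<bar> \<le> exp (\<kappa> * t) * K" if \<omega>: "\<omega> \<in> space M" for \<omega>
  proof -
    have "continuous_on {0..t} (\<lambda>s. U (B s \<omega>))"
      using continuous_on_compose2[OF U(1) continuous_on_subset[OF B_paths[OF \<omega>], of "{0..t}"]] by auto
    then have "0 \<le> integral {0..t} (\<lambda>s. U (B s \<omega>))"
      using U(2) by (intro integral_nonneg integrable_continuous_interval) auto
    then show ?thesis unfolding abs_mult using K(1) K0 by (intro mult_mono) auto
  qed
  have l01: "0 \<le> exp (- \<theta> n * L t \<omega>)" "exp (- \<theta> n * L t \<omega>) \<le> 1" for n \<omega>
    using \<theta>[of n] L_nonneg[of t \<omega>] by auto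
  have llim: "(\<lambda>n. exp (- \<theta> n * L t \<omega>)) \<longlonglongrightarrow> 1" for \<omega>
    using tendsto_exp[OF tendsto_mult_left_zero[OF tendsto_minus[OF \<theta>lim, simplified], of "L t \<omega>"]] by simp
  have bound: "\<bar>expectation (\<lambda>\<omega>. exp (- \<theta> n * L t \<omega>) * ?X \<omega>) - g x\<bar>
      \<le> exp (\<kappa> * t) * (\<eta> + \<bar>g 0\<bar> * (1 - expectation (\<lambda>\<omega>. exp (- \<theta> n * L t \<omega>))))" for n
    using ito_inequality[OF t \<theta>[of n] \<kappa> g g' K U \<eta>] \<theta>[of n] by (simp add: g'0 abs_mult mult.assoc)
  have "(\<lambda>n. expectation (\<lambda>\<omega>. exp (- \<theta> n * L t \<omega>))) \<longlonglongrightarrow> expectation (\<lambda>_. 1)"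
    by (rule integral_dominated_convergence[where w = "\<lambda>_. 1"]) (use llim l01 in auto)
  then have lim1: "(\<lambda>n. expectation (\<lambda>\<omega>. exp (- \<theta> n * L t \<omega>))) \<longlonglongrightarrow> 1" by (simp add: prob_space)
  have limX: "(\<lambda>n. expectation (\<lambda>\<omega>. exp (- \<theta> n * L t \<omega>) * ?X \<omega>)) \<longlonglongrightarrow> expectation ?X"
  proof (rule integral_dominated_convergence[where w = "\<lambda>_. exp (\<kappa> * t) * K"])
    show "AE \<omega> in M. (\<lambda>n. exp (- \<theta> n * L t \<omega>) * ?X \<omega>) \<longlonglongrightarrow> ?X \<omega>"
      using tendsto_mult_right[OF llim] by (intro AE_I2) fastforce
    fix n
    show "AE \<omega> in M. norm (exp (- \<theta> n * L t \<omega>) * ?X \<omega>) \<le> exp (\<kappa> * t) * K"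
    proof (rule AE_I2)
      fix \<omega> assume \<omega>: "\<omega> \<in> space M"
      have "\<bar>exp (- \<theta> n * L t \<omega>)\<bar> * \<bar>?X \<omega>\<bar> \<le> 1 * (exp (\<kappa> * t) * K)"
        using l01[of n \<omega>] Xb[OF \<omega>] by (intro mult_mono) auto
      then show "norm (exp (- \<theta> n * L t \<omega>) * ?X \<omega>) \<le> exp (\<kappa> * t) * K" unfolding real_norm_def abs_mult[of "exp (- \<theta> n * L t \<omega>)"] by simp
    qed
  qed auto
  have "\<bar>expectation ?X - g x\<bar> \<le> exp (\<kappa> * t) * (\<eta> + \<bar>g 0\<bar> * (1 - 1))"
    by (rule LIMSEQ_le[OF tendsto_rabs[OF tendsto_diff[OF limX tendsto_const]] tendsto_mult_left[OF tendsto_add[OF tendsto_const tendsto_mult_left[OF tendsto_diff[OF tendsto_const lim1]]]]])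
      (use bound in blast)
  then show ?thesis by simp
qed

text \<open>Let \<epsilon> tend to 0 in the smoothed identity: the integrated potential tends to
  \<mu> L, the smooth functions tend to the eigenfunction, and \<eta> tends to 0. The bound |k| +
  4\<mu>, uniform in \<epsilon>, provides the domination.\<close>

lemma robin_identity:
  assumes t: "0 < t" and \<mu>: "0 < \<mu>"
  shows "expectation (\<lambda>\<omega>. exp (- \<mu> * L t \<omega>) * (\<mu> * sin (k * \<bar>B t \<omega>\<bar>) + k * cos (k * \<bar>B t \<omega>\<bar>)))
    = exp (- (k\<^sup>2 * t / 2)) * (\<mu> * sin (k * \<bar>x\<bar>) + k * cos (k * \<bar>x\<bar>))"
proof -
  define \<kappa> where "\<kappa> = k\<^sup>2 / 2"
  define \<epsilon> where "\<epsilon> n = inverse (real (Suc n))" for n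
  have \<epsilon>: "0 < \<epsilon> n" "\<epsilon> n \<le> 1" for n by (auto simp: \<epsilon>_def field_simps)
  have \<epsilon>lim: "\<epsilon> \<longlonglongrightarrow> 0" unfolding \<epsilon>_def by (rule LIMSEQ_inverse_real_of_nat)
  define f where "f b = k * cos (k * b) + \<mu> * sin (k * \<bar>b\<bar>)" for b
  define \<eta> where "\<eta> n = 2 * \<epsilon> n * (k\<^sup>2 + 4 * \<mu> * \<bar>k\<bar>)" for n
  have "\<forall>n. \<exists>g. continuous_on UNIV g \<and> g 0 = k \<and> (\<forall>b. \<bar>g b\<bar> \<le> \<bar>k\<bar> + 4 * \<mu>) \<and>
      (\<forall>b. 2 * \<epsilon> n \<le> \<bar>b\<bar> \<longrightarrow> \<bar>g b - f b\<bar> \<le> \<mu> * (1 + 8 * \<bar>k\<bar>) * \<epsilon> n) \<and>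
      \<bar>expectation (\<lambda>\<omega>. exp (\<kappa> * t - integral {0..t} (\<lambda>s. \<mu> * trapezoid (\<epsilon> n) (B s \<omega>))) * g (B t \<omega>)) - g x\<bar> \<le> exp (\<kappa> * t) * \<eta> n"
  proof
    fix n
    obtain g g' g'' K where g: "\<And>b. (g has_real_derivative g' b) (at b)" "\<And>b. (g' has_real_derivative g'' b) (at b)"
      "\<And>b. \<bar>g b\<bar> \<le> K" "\<And>b. \<bar>g' b\<bar> \<le> K" "\<And>b. \<bar>g'' b\<bar> \<le> K" "\<And>a b. \<bar>g'' a - g'' b\<bar> \<le> K * \<bar>a - b\<bar>"
      "g 0 = k" "g' 0 = 0" "\<And>b. \<bar>g b\<bar> \<le> \<bar>k\<bar> + 4 * \<mu>"
      "\<And>b. \<bar>g'' b / 2 - (\<mu> * trapezoid (\<epsilon> n) b - k\<^sup>2 / 2) * g b\<bar> \<le> 2 * \<epsilon> n * (k\<^sup>2 + 4 * \<mu> * \<bar>k\<bar>) * (\<mu> * trapezoid (\<epsilon> n) b)"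
      "\<And>b. 2 * \<epsilon> n \<le> \<bar>b\<bar> \<Longrightarrow> \<bar>g b - (k * cos (k * b) + \<mu> * sin (k * \<bar>b\<bar>))\<bar> \<le> \<mu> * (1 + 8 * \<bar>k\<bar>) * \<epsilon> n"
      using robin_test_function[OF \<epsilon>[of n] \<mu>, of k] by blast
    have "\<bar>expectation (\<lambda>\<omega>. exp (\<kappa> * t - integral {0..t} (\<lambda>s. \<mu> * trapezoid (\<epsilon> n) (B s \<omega>))) * g (B t \<omega>)) - g x\<bar> \<le> exp (\<kappa> * t) * \<eta> n"
    proof (rule smoothed_robin_identity[OF t _ g(1-6), where u = "\<mu> * (1 / (2 * \<epsilon> n))"])
      show "continuous_on UNIV (\<lambda>b. \<mu> * trapezoid (\<epsilon> n) b)" by (intro continuous_intros)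
      show "0 \<le> \<mu> * trapezoid (\<epsilon> n) b" "\<mu> * trapezoid (\<epsilon> n) b \<le> \<mu> * (1 / (2 * \<epsilon> n))" for b
        using trapezoid_bounds(1,2)[OF \<epsilon>(1), of n b] \<mu> by (auto intro!: mult_left_mono simp del: times_divide_eq_right)
      show "\<bar>g'' b / 2 - (\<mu> * trapezoid (\<epsilon> n) b - \<kappa>) * g b\<bar> \<le> \<eta> n * (\<mu> * trapezoid (\<epsilon> n) b)" for b
        unfolding \<kappa>_def \<eta>_def by (rule g(10))
      show "0 \<le> \<eta> n" unfolding \<eta>_def using \<epsilon>(1)[of n] \<mu> by (intro mult_nonneg_nonneg add_nonneg_nonneg) auto
    qed (auto simp: \<kappa>_def g(8))
    then show "\<exists>g. continuous_on UNIV g \<and> g 0 = k \<and> (\<forall>b. \<bar>g b\<bar> \<le> \<bar>k\<bar> + 4 * \<mu>) \<and>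
      (\<forall>b. 2 * \<epsilon> n \<le> \<bar>b\<bar> \<longrightarrow> \<bar>g b - f b\<bar> \<le> \<mu> * (1 + 8 * \<bar>k\<bar>) * \<epsilon> n) \<and>
      \<bar>expectation (\<lambda>\<omega>. exp (\<kappa> * t - integral {0..t} (\<lambda>s. \<mu> * trapezoid (\<epsilon> n) (B s \<omega>))) * g (B t \<omega>)) - g x\<bar> \<le> exp (\<kappa> * t) * \<eta> n"
      using g(7,9,11) DERIV_isCont[OF g(1)] unfolding f_def
      by (intro exI[of _ g]) (auto intro: continuous_at_imp_continuous_on)
  qed
  from choice[OF this] obtain G where G: "\<And>n. continuous_on UNIV (G n)" "\<And>n. G n 0 = k" "\<And>n b. \<bar>G n b\<bar> \<le> \<bar>k\<bar> + 4 * \<mu>"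
    "\<And>n b. 2 * \<epsilon> n \<le> \<bar>b\<bar> \<Longrightarrow> \<bar>G n b - f b\<bar> \<le> \<mu> * (1 + 8 * \<bar>k\<bar>) * \<epsilon> n"
    "\<And>n. \<bar>expectation (\<lambda>\<omega>. exp (\<kappa> * t - integral {0..t} (\<lambda>s. \<mu> * trapezoid (\<epsilon> n) (B s \<omega>))) * G n (B t \<omega>)) - G n x\<bar> \<le> exp (\<kappa> * t) * \<eta> n"
    by blast
  have Glim: "(\<lambda>n. G n b) \<longlonglongrightarrow> f b" for b
  \<comment> \<open>The estimate for |b| \<ge> 2\<epsilon> never reaches 0, where all approximations
    equal k exactly. This point matters, for instance when x = 0.\<close>
  proof (cases "b = 0")
    case True
    then show ?thesis using G(2) by (simp add: f_def)
  next
    case False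
    have "eventually (\<lambda>n. \<epsilon> n < \<bar>b\<bar> / 2) sequentially"
      using False by (intro order_tendstoD(2)[OF \<epsilon>lim]) auto
    then have "eventually (\<lambda>n. norm (G n b - f b) \<le> \<mu> * (1 + 8 * \<bar>k\<bar>) * \<epsilon> n) sequentially"
      by eventually_elim (use G(4) in auto)
    moreover have "(\<lambda>n. \<mu> * (1 + 8 * \<bar>k\<bar>) * \<epsilon> n) \<longlonglongrightarrow> 0" using tendsto_mult_right_zero[OF \<epsilon>lim] by simp
    ultimately have "(\<lambda>n. G n b - f b) \<longlonglongrightarrow> 0" by (rule Lim_null_comparison)
    then show ?thesis by (simp add: LIM_zero_iff)
  qed
  let ?I = "\<lambda>n \<omega>. integral {0..t} (\<lambda>s. trapezoid (\<epsilon> n) (B s \<omega>))"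
  have I: "integral {0..t} (\<lambda>s. \<mu> * trapezoid (\<epsilon> n) (B s \<omega>)) = \<mu> * ?I n \<omega>" for n \<omega> by simp
  have Im [measurable]: "random_variable borel (\<lambda>\<omega>. ?I n \<omega>)" for n
    using t by (intro filtration_measurable_M[OF path_integral_adapted] continuous_intros) auto
  have [measurable]: "random_variable borel (L t)" "random_variable borel (B t)"
    using t by (auto intro: local_time_measurable B_measurable)
  have Gm [measurable]: "G n \<in> borel_measurable borel" for n by (rule borel_measurable_continuous_onI[OF G(1)])
  have fm [measurable]: "f \<in> borel_measurable borel" unfolding f_def by measurable
  let ?X = "\<lambda>n \<omega>. exp (\<kappa> * t - \<mu> * ?I n \<omega>) * G n (B t \<omega>)"
  let ?Y = "\<lambda>\<omega>. exp (\<kappa> * t - \<mu> * L t \<omega>) * f (B t \<omega>)"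
  have "(\<lambda>n. expectation (?X n)) \<longlonglongrightarrow> expectation ?Y"
  proof (rule integral_dominated_convergence[where w = "\<lambda>_. exp (\<kappa> * t) * (\<bar>k\<bar> + 4 * \<mu>)"])
    show "AE \<omega> in M. (\<lambda>n. ?X n \<omega>) \<longlonglongrightarrow> ?Y \<omega>"
      using AE_path
    proof eventually_elim
      case (elim \<omega>)
      then have "(\<lambda>n. ?I n \<omega>) \<longlonglongrightarrow> L t \<omega>"
        unfolding \<epsilon>_def using t by (intro trapezoid_sequence_tendsto) auto
      then show ?case by (intro tendsto_intros Glim)
    qed
    fix n
    show "AE \<omega> in M. norm (?X n \<omega>) \<le> exp (\<kappa> * t) * (\<bar>k\<bar> + 4 * \<mu>)"
    proof (rule AE_I2)
      fix \<omega> assume \<omega>: "\<omega> \<in> space M"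
      have "0 \<le> ?I n \<omega>"
        using trapezoid_bounds(1)[OF \<epsilon>(1)[of n]]
        by (intro integral_nonneg integrable_continuous_interval continuous_intros continuous_on_subset[OF B_paths[OF \<omega>]]) auto
      then show "norm (?X n \<omega>) \<le> exp (\<kappa> * t) * (\<bar>k\<bar> + 4 * \<mu>)"
        unfolding real_norm_def abs_mult using G(3) \<mu> by (intro mult_mono) auto
    qed
  qed auto
  then have "(\<lambda>n. expectation (?X n) - G n x) \<longlonglongrightarrow> expectation ?Y - f x"
    by (intro tendsto_diff Glim)
  moreover have "(\<lambda>n. expectation (?X n) - G n x) \<longlonglongrightarrow> 0"
  proof (rule Lim_null_comparison)
    show "\<forall>\<^sub>F n in sequentially. norm (expectation (?X n) - G n x) \<le> exp (\<kappa> * t) * \<eta> n"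
      using G(5) unfolding I by (simp add: always_eventually)
    have "(\<lambda>n. exp (\<kappa> * t) * (2 * \<epsilon> n * (k\<^sup>2 + 4 * \<mu> * \<bar>k\<bar>))) \<longlonglongrightarrow> exp (\<kappa> * t) * (2 * 0 * (k\<^sup>2 + 4 * \<mu> * \<bar>k\<bar>))"
      by (intro tendsto_intros \<epsilon>lim)
    then show "(\<lambda>n. exp (\<kappa> * t) * \<eta> n) \<longlonglongrightarrow> 0" by (simp add: \<eta>_def)
  qed
  ultimately have "expectation ?Y = f x" using LIMSEQ_unique by fastforce
  moreover have "expectation ?Y = exp (\<kappa> * t) * expectation (\<lambda>\<omega>. exp (- \<mu> * L t \<omega>) * f (B t \<omega>))"
    by (subst Bochner_Integration.integral_mult_right_zero[symmetric]) (simp add: exp_diff exp_minus divide_inverse mult_ac)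
  ultimately have "expectation (\<lambda>\<omega>. exp (- \<mu> * L t \<omega>) * f (B t \<omega>)) = exp (- (k\<^sup>2 * t / 2)) * f x"
    by (simp add: \<kappa>_def exp_minus field_simps)
  moreover have "f b = \<mu> * sin (k * \<bar>b\<bar>) + k * cos (k * \<bar>b\<bar>)" for b
    by (cases "0 \<le> b") (auto simp: f_def)
  ultimately show ?thesis by simp
qed

end

section \<open>Uniqueness for the Robin and Laplace transforms\<close>

text \<open>Levy's theorem is stated for probability laws. The case k = 0 of the cosine hypothesis
  gives equal total masses, so both measures can be normalised by the same constant unless they
  vanish.\<close>

lemma finite_measure_fourier_unique:
  fixes P Q :: "real measure"
  assumes P: "finite_measure P" "sets P = sets borel" and Q: "finite_measure Q" "sets Q = sets borel"
    and cos: "\<And>k. (\<integral>y. cos (k * y) \<partial>P) = (\<integral>y. cos (k * y) \<partial>Q)"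
    and sin: "\<And>k. (\<integral>y. sin (k * y) \<partial>P) = (\<integral>y. sin (k * y) \<partial>Q)"
  shows "P = Q"
proof -
  interpret P: finite_measure P by fact
  interpret Q: finite_measure Q by fact
  have sp: "space P = UNIV" "space Q = UNIV" using sets_eq_imp_space_eq[OF P(2)] sets_eq_imp_space_eq[OF Q(2)] by auto
  have meas: "borel_measurable P = (borel_measurable borel :: (real \<Rightarrow> _) set)" "borel_measurable Q = (borel_measurable borel :: (real \<Rightarrow> _) set)"
    using measurable_cong_sets[OF P(2) refl] measurable_cong_sets[OF Q(2) refl] by auto
  define m where "m = measure P UNIV"
  have mQ: "m = measure Q UNIV" using cos[of 0] sp by (simp add: m_def)
  show ?thesis
  proof (cases "m = 0")
    case True
    then have "emeasure P UNIV = 0" "emeasure Q UNIV = 0"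
      using mQ sp by (auto simp: m_def P.emeasure_eq_measure Q.emeasure_eq_measure)
    then have "emeasure P A = 0" "emeasure Q A = 0" if "A \<in> sets borel" for A
      using emeasure_mono[of A UNIV P] emeasure_mono[of A UNIV Q] P(2) Q(2) by auto
    then show ?thesis using P(2) Q(2) by (intro measure_eqI) auto
  next
    case False
    then have m: "0 < m" by (simp add: m_def zero_less_measure_iff)
    define P' where "P' = density P (\<lambda>_. ennreal (1 / m))"
    define Q' where "Q' = density Q (\<lambda>_. ennreal (1 / m))"
    have rd: "real_distribution P'" "real_distribution Q'"
    proof -
      have "emeasure P' (space P') = 1"
        using m sp P(2) by (simp add: P'_def emeasure_density_const P.emeasure_eq_measure m_def ennreal_mult[symmetric])
      then show "real_distribution P'"
        using sp P(2) by (auto simp: real_distribution_def real_distribution_axioms_def P'_def intro: prob_spaceI)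
      have "emeasure Q' (space Q') = 1"
        using m sp Q(2) by (simp add: Q'_def emeasure_density_const Q.emeasure_eq_measure mQ ennreal_mult[symmetric])
      then show "real_distribution Q'"
        using sp Q(2) by (auto simp: real_distribution_def real_distribution_axioms_def Q'_def intro: prob_spaceI)
    qed
    have iexp: "iexp r = complex_of_real (cos r) + \<i> * complex_of_real (sin r)" for r
      by (simp add: exp_Euler cos_of_real sin_of_real)
    have int: "integrable P (\<lambda>y. complex_of_real (cos (k * y)))" "integrable P (\<lambda>y. \<i> * complex_of_real (sin (k * y)))"
      "integrable Q (\<lambda>y. complex_of_real (cos (k * y)))" "integrable Q (\<lambda>y. \<i> * complex_of_real (sin (k * y)))" for k
      by (auto intro!: P.integrable_const_bound[where B = 1] Q.integrable_const_bound[where B = 1] simp: norm_mult meas)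
    have "char P' = char Q'"
    proof
      fix k
      have "char P' k = (1 / m) *\<^sub>R (CLINT y|P. iexp (k * y))"
        unfolding char_def P'_def using m by (subst integral_density) (auto simp: meas)
      also have "(CLINT y|P. iexp (k * y)) = (CLINT y|Q. iexp (k * y))"
        unfolding iexp using int cos[of k] sin[of k] by simp
      also have "(1 / m) *\<^sub>R (CLINT y|Q. iexp (k * y)) = char Q' k"
        unfolding char_def Q'_def using m by (subst integral_density) (auto simp: meas)
      finally show "char P' k = char Q' k" .
    qed
    then have eq: "P' = Q'" using Levy_uniqueness rd by blast
    have "density P' (\<lambda>_. ennreal m) = P" "density Q' (\<lambda>_. ennreal m) = Q"
      using m by (auto simp: P'_def Q'_def density_density_eq ennreal_mult[symmetric] density_1)
    then show ?thesis using eq by simp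
  qed
qed

section \<open>Exponential smoothing and its trigonometric transforms\<close>

lemma LBINT_FTC_atLeast:
  fixes F f :: "real \<Rightarrow> real"
  assumes F: "\<And>z. a \<le> z \<Longrightarrow> (F has_real_derivative f z) (at z)" and f: "\<And>z. isCont f z"
    and int: "set_integrable lborel {a..} f" and lim: "(F \<longlongrightarrow> l) at_top"
  shows "(LBINT z:{a..}. f z) = l - F a"
proof -
  have "((\<lambda>b. LBINT z:{a..b}. f z) \<longlongrightarrow> (LBINT z:{a..}. f z)) at_top"
    using int by (intro tendsto_set_lebesgue_integral_at_top) auto
  moreover have "eventually (\<lambda>b. (LBINT z:{a..b}. f z) = F b - F a) at_top"
    using eventually_ge_at_top[of a]
  proof eventually_elim
    case (elim b)
    have "(LBINT z. f z * indicator {a..b} z) = F b - F a"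
    proof (rule integral_FTC_Icc_real[OF elim])
      fix z assume "a \<le> z" "z \<le> b"
      then show "DERIV F z :> f z" using F by auto
    qed (rule f)
    then show ?case by (simp add: set_lebesgue_integral_def mult.commute)
  qed
  ultimately have "((\<lambda>b. F b - F a) \<longlongrightarrow> (LBINT z:{a..}. f z)) at_top"
    by (rule Lim_transform_eventually)
  moreover have "((\<lambda>b. F b - F a) \<longlongrightarrow> l - F a) at_top" by (intro tendsto_intros lim)
  ultimately show ?thesis by (rule tendsto_unique[OF trivial_limit_at_top_linorder])
qed

text \<open>The kernel is the density of a plus an exponential variable of rate \<theta>; its sine
  transform has the Robin function of a as numerator.\<close>

lemma exp_kernel_integrals:
  fixes \<theta> a k :: real
  assumes \<theta>: "0 < \<theta>"
  defines "e \<equiv> \<lambda>z. \<theta> * exp (- \<theta> * (z - a)) * indicator {a..} z"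
  shows "integrable lborel e" "(LBINT z. e z) = 1"
    "(LBINT z. cos (k * z) * e z) = \<theta> * (\<theta> * cos (k * a) - k * sin (k * a)) / (\<theta>\<^sup>2 + k\<^sup>2)"
    "(LBINT z. sin (k * z) * e z) = \<theta> * (\<theta> * sin (k * a) + k * cos (k * a)) / (\<theta>\<^sup>2 + k\<^sup>2)"
proof -
  have d: "0 < \<theta>\<^sup>2 + k\<^sup>2" using \<theta> by (simp add: add_pos_nonneg)
  let ?E = "\<lambda>z. exp (- \<theta> * (z - a))"
  have Elim: "(?E \<longlongrightarrow> 0) at_top" using \<theta> by real_asymp
  have nn: "(\<integral>\<^sup>+z\<in>{a..}. ennreal (\<theta> * ?E z) \<partial>lborel) = ennreal (0 - (- ?E a))"
  proof (rule nn_integral_FTC_atLeast[where F = "\<lambda>z. - ?E z" and T = 0])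
    show "((\<lambda>z. - ?E z) has_real_derivative \<theta> * ?E z) (at z)" for z
      by (auto intro!: derivative_eq_intros)
    show "((\<lambda>z. - ?E z) \<longlongrightarrow> 0) at_top" using tendsto_minus[OF Elim] by simp
  qed (use \<theta> in auto)
  have e0: "0 \<le> e z" for z using \<theta> by (simp add: e_def)
  have em [measurable]: "e \<in> borel_measurable borel" unfolding e_def by measurable
  have "(\<integral>\<^sup>+z. ennreal (e z) \<partial>lborel) = (\<integral>\<^sup>+z\<in>{a..}. ennreal (\<theta> * ?E z) \<partial>lborel)"
    by (intro nn_integral_cong) (simp add: e_def indicator_def)
  with nn have nn': "(\<integral>\<^sup>+z. ennreal (e z) \<partial>lborel) = 1" by simp
  show ie: "integrable lborel e"
    using nn' e0 by (intro integrableI_nonneg) auto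
  show "(LBINT z. e z) = 1"
    using nn' e0 by (subst integral_eq_nn_integral) auto
  have bnd: "integrable lborel (\<lambda>z. c z * e z)" if "c \<in> borel_measurable borel" "\<And>z. \<bar>c z\<bar> \<le> 1" for c :: "real \<Rightarrow> real"
    by (rule Bochner_Integration.integrable_bound[OF ie]) (use that e0 in \<open>auto simp: abs_mult intro!: mult_left_le_one_le\<close>)
  have lim: "((\<lambda>z. ?E z * c z) \<longlongrightarrow> 0) at_top" if "\<And>z. \<bar>c z\<bar> \<le> K" for c :: "real \<Rightarrow> real" and K
  proof (rule Lim_null_comparison)
    show "((\<lambda>z. K * ?E z) \<longlongrightarrow> 0) at_top" using tendsto_mult_right_zero[OF Elim] by simp
    show "\<forall>\<^sub>F z in at_top. norm (?E z * c z) \<le> K * ?E z"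
      using that by (intro always_eventually allI) (simp add: abs_mult)
  qed
  have trig: "\<bar>x * cos r + y * sin r\<bar> \<le> \<bar>x\<bar> + \<bar>y\<bar>" for x y r :: real
    using mult_left_le[of "\<bar>cos r\<bar>" "\<bar>x\<bar>"] mult_left_le[of "\<bar>sin r\<bar>" "\<bar>y\<bar>"]
    by (intro order_trans[OF abs_triangle_ineq] add_mono) (auto simp: abs_mult)
  \<comment> \<open>The antiderivative is sought as the exponential times A cos(k z) + B sin(k z).
    The linear system for A and B has determinant \<theta>^2 + k^2, the denominator in the
    results.\<close>
  have main: "(LBINT z. (p * cos (k * z) + q * sin (k * z)) * (?E z * indicator {a..} z)) = - (A * cos (k * a) + B * sin (k * a))"
    if pq: "p = - \<theta> * A + k * B" "q = - \<theta> * B - k * A" for p q A B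
  proof -
    have "(LBINT z:{a..}. (p * cos (k * z) + q * sin (k * z)) * ?E z) = 0 - ?E a * (A * cos (k * a) + B * sin (k * a))"
    proof (rule LBINT_FTC_atLeast[where F = "\<lambda>z. ?E z * (A * cos (k * z) + B * sin (k * z))"])
      fix z
      show "((\<lambda>z. ?E z * (A * cos (k * z) + B * sin (k * z))) has_real_derivative (p * cos (k * z) + q * sin (k * z)) * ?E z) (at z)"
        unfolding pq by (auto intro!: derivative_eq_intros simp: algebra_simps)
    next
      have "integrable lborel (\<lambda>z. p / \<theta> * (cos (k * z) * e z) + q / \<theta> * (sin (k * z) * e z))"
        by (intro Bochner_Integration.integrable_add integrable_mult_right bnd) auto
      then show "set_integrable lborel {a..} (\<lambda>z. (p * cos (k * z) + q * sin (k * z)) * ?E z)"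
        using \<theta> by (simp add: set_integrable_def e_def algebra_simps)
      show "((\<lambda>z. ?E z * (A * cos (k * z) + B * sin (k * z))) \<longlongrightarrow> 0) at_top"
        by (rule lim) (rule trig)
    qed (intro continuous_intros)
    then show ?thesis by (simp add: set_lebesgue_integral_def mult_ac)
  qed
  show "(LBINT z. cos (k * z) * e z) = \<theta> * (\<theta> * cos (k * a) - k * sin (k * a)) / (\<theta>\<^sup>2 + k\<^sup>2)"
  proof -
    have "(LBINT z. (\<theta> * cos (k * z) + 0 * sin (k * z)) * (?E z * indicator {a..} z))
        = - ((- \<theta>\<^sup>2 / (\<theta>\<^sup>2 + k\<^sup>2)) * cos (k * a) + (\<theta> * k / (\<theta>\<^sup>2 + k\<^sup>2)) * sin (k * a))"
    proof (rule main)
      have "\<theta> * (\<theta>\<^sup>2 + k\<^sup>2) / (\<theta>\<^sup>2 + k\<^sup>2) = - \<theta> * (- \<theta>\<^sup>2 / (\<theta>\<^sup>2 + k\<^sup>2)) + k * (\<theta> * k / (\<theta>\<^sup>2 + k\<^sup>2))"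
        by (simp add: add_divide_distrib distrib_left power2_eq_square mult_ac)
      then show "\<theta> = - \<theta> * (- \<theta>\<^sup>2 / (\<theta>\<^sup>2 + k\<^sup>2)) + k * (\<theta> * k / (\<theta>\<^sup>2 + k\<^sup>2))"
        unfolding nonzero_mult_div_cancel_right[OF less_imp_neq[OF d, symmetric]] .
    qed (simp add: power2_eq_square mult_ac)
    also have "\<dots> = \<theta> * (\<theta> * cos (k * a) - k * sin (k * a)) / (\<theta>\<^sup>2 + k\<^sup>2)"
      by (simp add: diff_divide_distrib right_diff_distrib power2_eq_square mult_ac)
    finally show ?thesis by (simp add: e_def mult_ac)
  qed
  show "(LBINT z. sin (k * z) * e z) = \<theta> * (\<theta> * sin (k * a) + k * cos (k * a)) / (\<theta>\<^sup>2 + k\<^sup>2)"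
  proof -
    have "(LBINT z. (0 * cos (k * z) + \<theta> * sin (k * z)) * (?E z * indicator {a..} z))
        = - ((- \<theta> * k / (\<theta>\<^sup>2 + k\<^sup>2)) * cos (k * a) + (- \<theta>\<^sup>2 / (\<theta>\<^sup>2 + k\<^sup>2)) * sin (k * a))"
    proof (rule main)
      have "\<theta> * (\<theta>\<^sup>2 + k\<^sup>2) / (\<theta>\<^sup>2 + k\<^sup>2) = - \<theta> * (- \<theta>\<^sup>2 / (\<theta>\<^sup>2 + k\<^sup>2)) - k * (- \<theta> * k / (\<theta>\<^sup>2 + k\<^sup>2))"
        by (simp add: add_divide_distrib distrib_left power2_eq_square mult_ac)
      then show "\<theta> = - \<theta> * (- \<theta>\<^sup>2 / (\<theta>\<^sup>2 + k\<^sup>2)) - k * (- \<theta> * k / (\<theta>\<^sup>2 + k\<^sup>2))"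
        unfolding nonzero_mult_div_cancel_right[OF less_imp_neq[OF d, symmetric]] .
    qed (simp add: power2_eq_square mult_ac)
    also have "\<dots> = \<theta> * (\<theta> * sin (k * a) + k * cos (k * a)) / (\<theta>\<^sup>2 + k\<^sup>2)"
      by (simp add: add_divide_distrib distrib_left power2_eq_square mult_ac)
    finally show ?thesis by (simp add: e_def mult_ac)
  qed
qed

text \<open>The law of \<open>\<bar>y\<bar> + e\<close> for an independent exponential variable \<open>e\<close> of rate \<open>\<theta>\<close> has the
  density below; its sine transform is the Robin transform of the law of \<open>y\<close>.\<close>

definition exp_smoothing :: "real \<Rightarrow> real measure \<Rightarrow> real \<Rightarrow> real" where
  "exp_smoothing \<theta> P z = (\<integral>y. \<theta> * exp (- \<theta> * (z - \<bar>y\<bar>)) * indicator {\<bar>y\<bar>..} z \<partial>P)"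

lemma exp_smoothing:
  fixes P :: "real measure"
  assumes P: "finite_measure P" "sets P = sets borel" and \<theta>: "0 < \<theta>"
  shows "exp_smoothing \<theta> P \<in> borel_measurable borel" "0 \<le> exp_smoothing \<theta> P z" "z < 0 \<Longrightarrow> exp_smoothing \<theta> P z = 0"
    "integrable lborel (exp_smoothing \<theta> P)"
    "(LBINT z. cos (k * z) * exp_smoothing \<theta> P z) = (\<integral>y. \<theta> * (\<theta> * cos (k * \<bar>y\<bar>) - k * sin (k * \<bar>y\<bar>)) / (\<theta>\<^sup>2 + k\<^sup>2) \<partial>P)"
    "(LBINT z. sin (k * z) * exp_smoothing \<theta> P z) = (\<integral>y. \<theta> * (\<theta> * sin (k * \<bar>y\<bar>) + k * cos (k * \<bar>y\<bar>)) / (\<theta>\<^sup>2 + k\<^sup>2) \<partial>P)"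
proof -
  interpret P: finite_measure P by fact
  interpret PL: pair_sigma_finite P lborel
    by (simp add: pair_sigma_finite_def P.sigma_finite_measure_axioms sigma_finite_lborel)
  note [measurable_cong] = P(2)
  define e where "e y z = \<theta> * exp (- \<theta> * (z - \<bar>y\<bar>)) * indicator {\<bar>y\<bar>..} z" for y z :: real
  have ey [measurable]: "e y \<in> borel_measurable borel" for y unfolding e_def by measurable
  have es_eq: "exp_smoothing \<theta> P z = (\<integral>y. e y z \<partial>P)" for z by (simp add: exp_smoothing_def e_def)
  note kern = exp_kernel_integrals[OF \<theta>, where a = "\<bar>y\<bar>" for y, folded e_def]
  have e0: "0 \<le> e y z" for y z using \<theta> by (simp add: e_def)
  have "(\<lambda>(y, z). e y z) = (\<lambda>(y, z). \<theta> * exp (- \<theta> * (z - \<bar>y\<bar>)) * (if \<bar>y\<bar> \<le> z then 1 else 0))"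
    by (auto simp: e_def indicator_def)
  also have "\<dots> \<in> borel_measurable (borel \<Otimes>\<^sub>M borel)" by measurable
  finally have em': "(\<lambda>(y, z). e y z) \<in> borel_measurable (borel \<Otimes>\<^sub>M borel)" .
  then have em [measurable]: "(\<lambda>(y, z). e y z) \<in> borel_measurable (P \<Otimes>\<^sub>M lborel)" by simp
  have es: "(\<lambda>(z, y). e y z) \<in> borel_measurable (borel \<Otimes>\<^sub>M P)"
    using measurable_compose[OF measurable_pair_swap' em'] by (simp add: split_beta')
  show m [measurable]: "exp_smoothing \<theta> P \<in> borel_measurable borel"
    unfolding es_eq by (rule P.borel_measurable_lebesgue_integral[OF es])
  show "0 \<le> exp_smoothing \<theta> P z" for z unfolding es_eq by (intro integral_nonneg_AE AE_I2 e0)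
  show "z < 0 \<Longrightarrow> exp_smoothing \<theta> P z = 0"
  proof -
    assume "z < 0"
    then have "\<not> \<bar>y\<bar> \<le> z" for y by linarith
    then have "exp_smoothing \<theta> P z = (\<integral>y. 0 \<partial>P)"
      unfolding es_eq by (intro Bochner_Integration.integral_cong) (auto simp: e_def indicator_def)
    then show ?thesis by simp
  qed
  have gen: "integrable lborel (\<lambda>z. c z * exp_smoothing \<theta> P z)"
       "(LBINT z. c z * exp_smoothing \<theta> P z) = (\<integral>y. (LBINT z. c z * e y z) \<partial>P)"
    if c [measurable]: "c \<in> borel_measurable borel" and c1: "\<And>z. \<bar>c z\<bar> \<le> 1" for c :: "real \<Rightarrow> real"
  proof -
    have ci: "integrable lborel (\<lambda>z. c z * e y z)" for y
      by (rule Bochner_Integration.integrable_bound[OF kern(1)[of y]])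
        (use c1 e0 in \<open>auto simp: abs_mult abs_of_nonneg[OF e0] intro!: mult_left_le_one_le\<close>)
    have cm: "(\<lambda>y. LBINT z. \<bar>c z * e y z\<bar>) \<in> borel_measurable P" by measurable
    have le: "(LBINT z. \<bar>c z * e y z\<bar>) \<le> 1" for y
    proof -
      have "(LBINT z. \<bar>c z * e y z\<bar>) \<le> (LBINT z. e y z)"
        by (rule integral_mono[OF integrable_abs[OF ci[of y]] kern(1)[of y]])
          (use c1 e0 in \<open>auto simp: abs_mult abs_of_nonneg[OF e0] intro!: mult_left_le_one_le\<close>)
      then show ?thesis using kern(2)[of y] by simp
    qed
    have int: "integrable (P \<Otimes>\<^sub>M lborel) (\<lambda>(y, z). c z * e y z)"
    proof (rule PL.Fubini_integrable)
      show "(\<lambda>(y, z). c z * e y z) \<in> borel_measurable (P \<Otimes>\<^sub>M lborel)" by measurable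
      show "integrable P (\<lambda>y. LBINT z. norm (case (y, z) of (y, z) \<Rightarrow> c z * e y z))"
        using cm le by (intro P.integrable_const_bound[where B = 1]) (auto simp: abs_of_nonneg)
      show "AE y in P. integrable lborel (\<lambda>z. case (y, z) of (y, z) \<Rightarrow> c z * e y z)" using ci by simp
    qed
    have eq: "c z * exp_smoothing \<theta> P z = (\<integral>y. c z * e y z \<partial>P)" for z
      unfolding es_eq by simp
    show "integrable lborel (\<lambda>z. c z * exp_smoothing \<theta> P z)"
      unfolding eq using PL.integrable_snd[OF int] by simp
    show "(LBINT z. c z * exp_smoothing \<theta> P z) = (\<integral>y. (LBINT z. c z * e y z) \<partial>P)"
      unfolding eq using PL.Fubini_integral[OF int] by simp
  qed
  show "integrable lborel (exp_smoothing \<theta> P)" using gen(1)[of "\<lambda>_. 1"] by simp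
  show "(LBINT z. cos (k * z) * exp_smoothing \<theta> P z) = (\<integral>y. \<theta> * (\<theta> * cos (k * \<bar>y\<bar>) - k * sin (k * \<bar>y\<bar>)) / (\<theta>\<^sup>2 + k\<^sup>2) \<partial>P)"
    by (subst gen(2)) (simp_all only: kern, auto)
  show "(LBINT z. sin (k * z) * exp_smoothing \<theta> P z) = (\<integral>y. \<theta> * (\<theta> * sin (k * \<bar>y\<bar>) + k * cos (k * \<bar>y\<bar>)) / (\<theta>\<^sup>2 + k\<^sup>2) \<partial>P)"
    by (subst gen(2)) (simp_all only: kern, auto)
qed

text \<open>One density is glued to the reflection of another. Exchanging d and e fixes the cosine
  transform, a sum, and negates the sine transform, a difference. If d and e have equal sine
  transforms, the exchange therefore leaves the measure unchanged; this gives injectivity of the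
  sine transform on the half line.\<close>

lemma finite_density_add_reflect:
  fixes d e :: "real \<Rightarrow> real"
  assumes d: "integrable lborel d" "\<And>z. 0 \<le> d z" and e: "integrable lborel e" "\<And>z. 0 \<le> e z"
  defines "N \<equiv> density lborel (\<lambda>z. ennreal (d z + e (- z)))"
  shows "finite_measure N" "sets N = sets borel"
    "(\<integral>z. cos (k * z) \<partial>N) = (LBINT z. cos (k * z) * d z) + (LBINT z. cos (k * z) * e z)"
    "(\<integral>z. sin (k * z) \<partial>N) = (LBINT z. sin (k * z) * d z) - (LBINT z. sin (k * z) * e z)"
proof -
  have [measurable]: "d \<in> borel_measurable borel" "e \<in> borel_measurable borel" using d(1) e(1) by auto
  have e': "integrable lborel (\<lambda>z. e (- z))"
    using lborel_integrable_real_affine[OF e(1), of "- 1" 0] by simp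
  have int: "integrable lborel (\<lambda>z. d z + e (- z))" using d(1) e' by simp
  show "finite_measure N"
  proof (rule finite_measureI)
    have "emeasure N (space N) = (\<integral>\<^sup>+z. ennreal (d z + e (- z)) \<partial>lborel)"
      unfolding N_def by (subst emeasure_density) (auto intro!: nn_integral_cong)
    also have "\<dots> = ennreal (LBINT z. d z + e (- z))"
      using d(2) e(2) by (intro nn_integral_eq_integral int) auto
    finally show "emeasure N (space N) \<noteq> \<infinity>" by simp
  qed
  show "sets N = sets borel" by (simp add: N_def)
  have bnd: "integrable lborel (\<lambda>z. c z * f z)" if "integrable lborel f" "c \<in> borel_measurable borel" "\<And>z. \<bar>c z\<bar> \<le> 1"
    for c f :: "real \<Rightarrow> real"
  proof (rule Bochner_Integration.integrable_bound[OF that(1)])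
    show "(\<lambda>z. c z * f z) \<in> borel_measurable lborel" using that(1,2) by auto
    show "AE z in lborel. norm (c z * f z) \<le> norm (f z)"
      using that(3) by (auto simp: abs_mult intro!: mult_left_le_one_le)
  qed
  have gen: "(\<integral>z. c z \<partial>N) = (LBINT z. c z * d z) + (LBINT z. c (- z) * e z)"
    if c [measurable]: "c \<in> borel_measurable borel" and c1: "\<And>z. \<bar>c z\<bar> \<le> 1" for c :: "real \<Rightarrow> real"
  proof -
    have "(\<integral>z. c z \<partial>N) = (LBINT z. (d z + e (- z)) * c z)"
      unfolding N_def using d(2) e(2) by (subst integral_density) auto
    also have "\<dots> = (LBINT z. c z * d z) + (LBINT z. c z * e (- z))"
      using bnd[OF d(1) c c1] bnd[OF e' c c1] by (simp add: algebra_simps)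
    also have "(LBINT z. c z * e (- z)) = (LBINT z. c (- z) * e z)"
      using lborel_integral_real_affine[of "- 1" "\<lambda>z. c (- z) * e z" 0] by simp
    finally show ?thesis .
  qed
  show "(\<integral>z. cos (k * z) \<partial>N) = (LBINT z. cos (k * z) * d z) + (LBINT z. cos (k * z) * e z)"
    by (subst gen) auto
  show "(\<integral>z. sin (k * z) \<partial>N) = (LBINT z. sin (k * z) * d z) - (LBINT z. sin (k * z) * e z)"
    by (subst gen) auto
qed

text \<open>The first hypothesis determines the sine transform of the smoothed law of \<open>\<bar>y\<bar>\<close>, hence (the sine
  transform being injective on \<open>[0, \<infinity>)\<close>) its cosine transform; the two together give the cosine
  transform of \<open>P\<close>, and the second hypothesis then gives the sine transform.\<close>

lemma robin_transform_unique:
  fixes P Q :: "real measure"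
  assumes P: "finite_measure P" "sets P = sets borel" and Q: "finite_measure Q" "sets Q = sets borel"
    and \<theta>: "0 < \<theta>"
    and even: "\<And>k. (\<integral>y. \<theta> * sin (k * \<bar>y\<bar>) + k * cos (k * \<bar>y\<bar>) \<partial>P) = (\<integral>y. \<theta> * sin (k * \<bar>y\<bar>) + k * cos (k * \<bar>y\<bar>) \<partial>Q)"
    and skew: "\<And>k. (\<integral>y. \<theta> * sin (k * y) + \<gamma> * k * cos (k * y) \<partial>P) = (\<integral>y. \<theta> * sin (k * y) + \<gamma> * k * cos (k * y) \<partial>Q)"
  shows "P = Q"
proof -
  interpret P: finite_measure P by fact
  interpret Q: finite_measure Q by fact
  note [measurable_cong] = P(2) Q(2)
  define d e where "d = exp_smoothing \<theta> P" and "e = exp_smoothing \<theta> Q"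
  note d = exp_smoothing[OF P \<theta>, folded d_def] and e = exp_smoothing[OF Q \<theta>, folded e_def]
  have D: "0 < \<theta>\<^sup>2 + k\<^sup>2" for k using \<theta> by (simp add: add_pos_nonneg)
  have sin_eq: "(LBINT z. sin (k * z) * d z) = (LBINT z. sin (k * z) * e z)" for k
  proof -
    have "(LBINT z. sin (k * z) * d z) = (\<integral>y. \<theta> / (\<theta>\<^sup>2 + k\<^sup>2) * (\<theta> * sin (k * \<bar>y\<bar>) + k * cos (k * \<bar>y\<bar>)) \<partial>P)"
      unfolding d(6) by simp
    also have "\<dots> = (\<integral>y. \<theta> / (\<theta>\<^sup>2 + k\<^sup>2) * (\<theta> * sin (k * \<bar>y\<bar>) + k * cos (k * \<bar>y\<bar>)) \<partial>Q)"
      using even[of k] by simp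
    also have "\<dots> = (LBINT z. sin (k * z) * e z)"
      unfolding e(6) by simp
    finally show ?thesis .
  qed
  note N = finite_density_add_reflect[OF d(4,2) e(4,2)] and N' = finite_density_add_reflect[OF e(4,2) d(4,2)]
  \<comment> \<open>Equal sine transforms make both sine integrals zero, and the cosine integrals
    agree by symmetry.\<close>
  have "density lborel (\<lambda>z. ennreal (d z + e (- z))) = density lborel (\<lambda>z. ennreal (e z + d (- z)))"
  proof (rule finite_measure_fourier_unique[OF N(1,2) N'(1,2)])
    fix k
    show "(\<integral>y. cos (k * y) \<partial>density lborel (\<lambda>z. ennreal (d z + e (- z)))) = (\<integral>y. cos (k * y) \<partial>density lborel (\<lambda>z. ennreal (e z + d (- z))))"
      unfolding N(3) N'(3) by simp
    show "(\<integral>y. sin (k * y) \<partial>density lborel (\<lambda>z. ennreal (d z + e (- z)))) = (\<integral>y. sin (k * y) \<partial>density lborel (\<lambda>z. ennreal (e z + d (- z))))"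
      unfolding N(4) N'(4) sin_eq by simp
  qed
  then have "AE z in lborel. ennreal (d z + e (- z)) = ennreal (e z + d (- z))"
    using d(1) e(1) by (subst (asm) sigma_finite_measure.density_unique_iff[OF sigma_finite_lborel]) auto
  \<comment> \<open>At z = 0 the two halves overlap and the equation says nothing; elsewhere one
    summand on each side vanishes.\<close>
  moreover have "AE z in lborel. z \<noteq> (0::real)" by (rule AE_lborel_singleton)
  ultimately have "AE z in lborel. d z = e z"
  proof eventually_elim
    case (elim z)
    then have eq: "d z + e (- z) = e z + d (- z)" by (metis add_nonneg_nonneg d(2) e(2) ennreal_inj)
    show ?case using elim(2) eq d(3)[of z] e(3)[of z] d(3)[of "- z"] e(3)[of "- z"] by (cases "z < 0") auto
  qed
  then have cos_eq: "(LBINT z. cos (k * z) * d z) = (LBINT z. cos (k * z) * e z)" for k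
    using d(1) e(1) by (intro integral_cong_AE) auto
  have bi: "integrable P f" "integrable Q f" if "f \<in> borel_measurable borel" "\<And>z. \<bar>f z\<bar> \<le> C" for f :: "real \<Rightarrow> real" and C
    using that by (auto intro!: P.integrable_const_bound[where B = C] Q.integrable_const_bound[where B = C])
  have icos: "integrable P (\<lambda>y. cos (k * f y))" "integrable Q (\<lambda>y. cos (k * f y))"
    and isin: "integrable P (\<lambda>y. sin (k * f y))" "integrable Q (\<lambda>y. sin (k * f y))"
    if "f \<in> borel_measurable borel" for k and f :: "real \<Rightarrow> real"
    using that by (intro bi[where C = 1]; simp)+
  have cosP: "(\<integral>y. cos (k * y) \<partial>P) = (\<integral>y. cos (k * y) \<partial>Q)" for k
  proof -
    \<comment> \<open>The two numerators are the vector (cos, sin) rotated and scaled; solving back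
      for cos expresses it through the cosine transform of the smoothed law and the Robin
      transform.\<close>
    have trig: "cos (k * y) = \<theta> * (\<theta> * cos (k * \<bar>y\<bar>) - k * sin (k * \<bar>y\<bar>)) / (\<theta>\<^sup>2 + k\<^sup>2)
        + k / (\<theta>\<^sup>2 + k\<^sup>2) * (\<theta> * sin (k * \<bar>y\<bar>) + k * cos (k * \<bar>y\<bar>))" for y
    proof -
      have "cos (k * y) = cos (k * \<bar>y\<bar>)" by (cases "0 \<le> y") auto
      also have "\<dots> = (\<theta>\<^sup>2 + k\<^sup>2) * cos (k * \<bar>y\<bar>) / (\<theta>\<^sup>2 + k\<^sup>2)" using \<theta> by simp
      also have "(\<theta>\<^sup>2 + k\<^sup>2) * cos (k * \<bar>y\<bar>) = \<theta> * (\<theta> * cos (k * \<bar>y\<bar>) - k * sin (k * \<bar>y\<bar>)) + k * (\<theta> * sin (k * \<bar>y\<bar>) + k * cos (k * \<bar>y\<bar>))"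
        by (simp add: algebra_simps power2_eq_square)
      finally show ?thesis by (simp add: add_divide_distrib)
    qed
    have "(\<integral>y. cos (k * y) \<partial>P) = (\<integral>y. \<theta> * (\<theta> * cos (k * \<bar>y\<bar>) - k * sin (k * \<bar>y\<bar>)) / (\<theta>\<^sup>2 + k\<^sup>2) \<partial>P)
        + k / (\<theta>\<^sup>2 + k\<^sup>2) * (\<integral>y. \<theta> * sin (k * \<bar>y\<bar>) + k * cos (k * \<bar>y\<bar>) \<partial>P)"
      unfolding Bochner_Integration.integral_cong[OF refl trig]
      using icos(1)[of abs k] isin(1)[of abs k] by (subst Bochner_Integration.integral_add) auto
    also have "\<dots> = (\<integral>y. \<theta> * (\<theta> * cos (k * \<bar>y\<bar>) - k * sin (k * \<bar>y\<bar>)) / (\<theta>\<^sup>2 + k\<^sup>2) \<partial>Q)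
        + k / (\<theta>\<^sup>2 + k\<^sup>2) * (\<integral>y. \<theta> * sin (k * \<bar>y\<bar>) + k * cos (k * \<bar>y\<bar>) \<partial>Q)"
      using cos_eq[of k] unfolding d(5) e(5) even by simp
    also have "\<dots> = (\<integral>y. cos (k * y) \<partial>Q)"
      unfolding Bochner_Integration.integral_cong[OF refl trig]
      using icos(2)[of abs k] isin(2)[of abs k] by (subst Bochner_Integration.integral_add) auto
    finally show ?thesis .
  qed
  show "P = Q"
  proof (rule finite_measure_fourier_unique[OF P Q cosP])
    fix k
    have "\<theta> * (\<integral>y. sin (k * y) \<partial>P) + \<gamma> * k * (\<integral>y. cos (k * y) \<partial>P) = \<theta> * (\<integral>y. sin (k * y) \<partial>Q) + \<gamma> * k * (\<integral>y. cos (k * y) \<partial>Q)"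
      using skew[of k] icos[of "\<lambda>y. y" k] isin[of "\<lambda>y. y" k] by simp
    then show "(\<integral>y. sin (k * y) \<partial>P) = (\<integral>y. sin (k * y) \<partial>Q)"
      using cosP[of k] \<theta> by simp
  qed
qed

text \<open>With z = exp(- l) the integer values of the transform are moments on [0, 1], so
  Weierstrass approximation reaches all bounded continuous functions of z, then indicators. The
  value n = 0 is not given, so everything carries an extra factor exp(- l), removed at the
  end.\<close>

lemma finite_measure_laplace_unique:
  fixes P Q :: "real measure"
  assumes P: "finite_measure P" "sets P = sets borel" "AE l in P. 0 \<le> l"
    and Q: "finite_measure Q" "sets Q = sets borel" "AE l in Q. 0 \<le> l"
    and lap: "\<And>n::nat. 0 < n \<Longrightarrow> (\<integral>l. exp (- real n * l) \<partial>P) = (\<integral>l. exp (- real n * l) \<partial>Q)"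
  shows "P = Q"
proof -
  interpret P: finite_measure P by fact
  interpret Q: finite_measure Q by fact
  note [measurable_cong] = P(2) Q(2)
  have int: "integrable P (\<lambda>l. exp (- l) * f (exp (- l)))" "integrable Q (\<lambda>l. exp (- l) * f (exp (- l)))"
    if "f \<in> borel_measurable borel" "\<And>z. z \<in> {0..1} \<Longrightarrow> \<bar>f z\<bar> \<le> C" for f :: "real \<Rightarrow> real" and C
  proof -
    have b: "\<bar>exp (- l) * f (exp (- l))\<bar> \<le> C" if l: "0 \<le> l" for l :: real
    proof -
      have "\<bar>exp (- l)\<bar> * \<bar>f (exp (- l))\<bar> \<le> 1 * C" using that l \<open>\<And>z. z \<in> {0..1} \<Longrightarrow> \<bar>f z\<bar> \<le> C\<close> by (intro mult_mono) auto
      then show ?thesis by (simp add: abs_mult)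
    qed
    show "integrable P (\<lambda>l. exp (- l) * f (exp (- l)))"
      using that(1) P(3) b by (intro P.integrable_const_bound[where B = C]) (auto elim!: eventually_mono)
    show "integrable Q (\<lambda>l. exp (- l) * f (exp (- l)))"
      using that(1) Q(3) b by (intro Q.integrable_const_bound[where B = C]) (auto elim!: eventually_mono)
  qed
  \<comment> \<open>The extra factor raises every exponent by one, so only positive integers
    occur.\<close>
  have poly: "(\<integral>l. exp (- l) * (\<Sum>i\<le>n. a i * exp (- l) ^ i) \<partial>P) = (\<integral>l. exp (- l) * (\<Sum>i\<le>n. a i * exp (- l) ^ i) \<partial>Q)"
    for a :: "nat \<Rightarrow> real" and n
  proof -
    have eq: "exp (- l) * (\<Sum>i\<le>n. a i * exp (- l) ^ i) = (\<Sum>i\<le>n. a i * exp (- real (Suc i) * l))" for l :: real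
      unfolding sum_distrib_left
      by (intro sum.cong refl) (simp add: exp_of_nat_mult[symmetric] exp_add[symmetric] algebra_simps)
    have i: "integrable P (\<lambda>l. exp (- real (Suc i) * l))" "integrable Q (\<lambda>l. exp (- real (Suc i) * l))" for i
    proof -
      have "exp (- l) * exp (- l) ^ i = exp (- real (Suc i) * l)" for l :: real
        by (simp add: exp_of_nat_mult[symmetric] exp_add[symmetric] algebra_simps)
      then show "integrable P (\<lambda>l. exp (- real (Suc i) * l))" "integrable Q (\<lambda>l. exp (- real (Suc i) * l))"
        using int[of "\<lambda>z. z ^ i" 1] by (auto simp: power_le_one)
    qed
    show ?thesis unfolding eq
      using i lap by (simp add: Bochner_Integration.integral_sum del: of_nat_Suc)
  qed
  have cont: "(\<integral>l. exp (- l) * f (exp (- l)) \<partial>P) = (\<integral>l. exp (- l) * f (exp (- l)) \<partial>Q)"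
    if f: "continuous_on UNIV f" "\<And>z. \<bar>f z\<bar> \<le> C" for f :: "real \<Rightarrow> real" and C
  proof -
    let ?IP = "\<integral>l. exp (- l) * f (exp (- l)) \<partial>P" and ?IQ = "\<integral>l. exp (- l) * f (exp (- l)) \<partial>Q"
    let ?m = "measure P (space P) + measure Q (space Q)"
    have fm [measurable]: "f \<in> borel_measurable borel" using f(1) by (rule borel_measurable_continuous_onI)
    have "\<bar>?IP - ?IQ\<bar> \<le> e * ?m" if e: "0 < e" for e
    proof -
      obtain g where g: "real_polynomial_function g" "\<And>z. z \<in> {0..1} \<Longrightarrow> \<bar>f z - g z\<bar> < e"
        using Stone_Weierstrass_real_polynomial_function[of "{0..1::real}" f e] continuous_on_subset[OF f(1)] e by auto
      obtain a n where gs: "g = (\<lambda>z. \<Sum>i\<le>n. a i * z ^ i)" using real_polynomial_function_imp_sum[OF g(1)] by blast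
      have gm [measurable]: "g \<in> borel_measurable borel" unfolding gs by measurable
      have gb: "\<bar>g z\<bar> \<le> C + e" if "z \<in> {0..1}" for z using g(2)[OF that] f(2)[of z] by linarith
      have IP: "\<bar>?IP - (\<integral>l. exp (- l) * g (exp (- l)) \<partial>P)\<bar> \<le> e * measure P (space P)"
      proof -
        have "\<bar>?IP - (\<integral>l. exp (- l) * g (exp (- l)) \<partial>P)\<bar> = \<bar>\<integral>l. exp (- l) * (f (exp (- l)) - g (exp (- l))) \<partial>P\<bar>"
          using int(1)[OF fm f(2)] int(1)[OF gm gb] by (simp add: right_diff_distrib)
        also have "\<dots> \<le> (\<integral>l. e \<partial>P)"
        proof (rule order_trans[OF integral_abs_bound], rule integral_mono_AE)
          show "integrable P (\<lambda>l. \<bar>exp (- l) * (f (exp (- l)) - g (exp (- l)))\<bar>)"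
            using int(1)[OF fm f(2)] int(1)[OF gm gb] by (simp add: right_diff_distrib)
          show "AE l in P. \<bar>exp (- l) * (f (exp (- l)) - g (exp (- l)))\<bar> \<le> e"
            using P(3)
          proof eventually_elim
            case (elim l)
            then have "\<bar>exp (- l)\<bar> * \<bar>f (exp (- l)) - g (exp (- l))\<bar> \<le> 1 * e"
              using g(2)[of "exp (- l)"] by (intro mult_mono) auto
            then show ?case by (simp add: abs_mult)
          qed
        qed simp
        also have "\<dots> = e * measure P (space P)" by simp
        finally show ?thesis .
      qed
      have IQ: "\<bar>?IQ - (\<integral>l. exp (- l) * g (exp (- l)) \<partial>Q)\<bar> \<le> e * measure Q (space Q)"
      proof -
        have "\<bar>?IQ - (\<integral>l. exp (- l) * g (exp (- l)) \<partial>Q)\<bar> = \<bar>\<integral>l. exp (- l) * (f (exp (- l)) - g (exp (- l))) \<partial>Q\<bar>"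
          using int(2)[OF fm f(2)] int(2)[OF gm gb] by (simp add: right_diff_distrib)
        also have "\<dots> \<le> (\<integral>l. e \<partial>Q)"
        proof (rule order_trans[OF integral_abs_bound], rule integral_mono_AE)
          show "integrable Q (\<lambda>l. \<bar>exp (- l) * (f (exp (- l)) - g (exp (- l)))\<bar>)"
            using int(2)[OF fm f(2)] int(2)[OF gm gb] by (simp add: right_diff_distrib)
          show "AE l in Q. \<bar>exp (- l) * (f (exp (- l)) - g (exp (- l)))\<bar> \<le> e"
            using Q(3)
          proof eventually_elim
            case (elim l)
            then have "\<bar>exp (- l)\<bar> * \<bar>f (exp (- l)) - g (exp (- l))\<bar> \<le> 1 * e"
              using g(2)[of "exp (- l)"] by (intro mult_mono) auto
            then show ?case by (simp add: abs_mult)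
          qed
        qed simp
        also have "\<dots> = e * measure Q (space Q)" by simp
        finally show ?thesis .
      qed
      have "(\<integral>l. exp (- l) * g (exp (- l)) \<partial>P) = (\<integral>l. exp (- l) * g (exp (- l)) \<partial>Q)"
        unfolding gs by (rule poly)
      then show ?thesis using IP IQ by (simp add: distrib_left)
    qed
    \<comment> \<open>The added 1 makes the factor positive even if both measures vanish, so that e
      can be rescaled.\<close>
    then have le: "\<bar>?IP - ?IQ\<bar> \<le> e * (?m + 1)" if "0 < e" for e
      using that by (smt (verit) mult_left_mono)
    have "\<bar>?IP - ?IQ\<bar> \<le> 0"
    proof (rule field_le_epsilon)
      fix e :: real assume "0 < e"
      moreover have "0 < ?m + 1" by (smt (verit) measure_nonneg)
      ultimately show "\<bar>?IP - ?IQ\<bar> \<le> 0 + e" using le[of "e / (?m + 1)"] by simp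
    qed
    then show ?thesis by simp
  qed
  have cdf: "(\<integral>l. exp (- l) * indicator {..c} l \<partial>P) = (\<integral>l. exp (- l) * indicator {..c} l \<partial>Q)" for c
  proof -
    \<comment> \<open>A ramp in z of slope m, equal to 1 for z \<ge> exp(- c), that is for l \<le>
      c, and vanishing for any other fixed l once m is large.\<close>
    define f where "f m z = min 1 (max 0 (1 + real m * (z - exp (- c))))" for m :: nat and z
    have fb: "\<bar>f m z\<bar> \<le> 1" for m z by (simp add: f_def)
    have fc: "continuous_on UNIV (f m)" for m unfolding f_def by (intro continuous_intros)
    have lim: "(\<lambda>m. exp (- l) * f m (exp (- l))) \<longlonglongrightarrow> exp (- l) * indicator {..c} l" for l
    proof -
      have "(\<lambda>m. f m (exp (- l))) \<longlonglongrightarrow> indicator {..c} l"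
      proof (cases "l \<le> c")
        case True
        then have "f m (exp (- l)) = 1" for m unfolding f_def by simp
        with True show ?thesis by simp
      next
        case False
        define g where "g = exp (- c) - exp (- l)"
        have g: "0 < g" using False by (simp add: g_def)
        obtain N :: nat where N: "1 / g < real N" using reals_Archimedean2 by blast
        have "f m (exp (- l)) = 0" if "N \<le> m" for m
        proof -
          have "1 / g < real m" using N that by (meson le_less_trans less_le_trans of_nat_le_iff)
          then have "1 < real m * g" using g by (simp add: divide_simps)
          then have "1 + real m * (exp (- l) - exp (- c)) \<le> 0" by (simp add: g_def algebra_simps)
          then show ?thesis by (simp add: f_def)
        qed
        then have "eventually (\<lambda>m. f m (exp (- l)) = 0) sequentially"
          by (auto simp: eventually_sequentially)
        then show ?thesis using False by (simp add: tendsto_eventually)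
      qed
      then show ?thesis by (intro tendsto_intros)
    qed
    have fm [measurable]: "f m \<in> borel_measurable borel" for m using fc by (rule borel_measurable_continuous_onI)
    have dom: "norm (exp (- l) * f m (exp (- l))) \<le> 1" if "0 \<le> l" for m l
    proof -
      have "\<bar>exp (- l)\<bar> * \<bar>f m (exp (- l))\<bar> \<le> 1 * 1" using that fb by (intro mult_mono) auto
      then show ?thesis by (simp add: abs_mult)
    qed
    have "(\<lambda>m. \<integral>l. exp (- l) * f m (exp (- l)) \<partial>P) \<longlonglongrightarrow> (\<integral>l. exp (- l) * indicator {..c} l \<partial>P)"
      by (rule integral_dominated_convergence[where w = "\<lambda>_. 1"]) (use lim P(3) dom in \<open>auto elim!: eventually_mono\<close>)
    moreover have "(\<lambda>m. \<integral>l. exp (- l) * f m (exp (- l)) \<partial>Q) \<longlonglongrightarrow> (\<integral>l. exp (- l) * indicator {..c} l \<partial>Q)"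
      by (rule integral_dominated_convergence[where w = "\<lambda>_. 1"]) (use lim Q(3) dom in \<open>auto elim!: eventually_mono\<close>)
    ultimately show ?thesis
      using cont[OF fc fb] LIMSEQ_unique by simp
  qed
  have nnP: "(\<integral>\<^sup>+l\<in>{..c}. ennreal (exp (- l)) \<partial>P) = ennreal (\<integral>l. exp (- l) * indicator {..c} l \<partial>P)"
    and nnQ: "(\<integral>\<^sup>+l\<in>{..c}. ennreal (exp (- l)) \<partial>Q) = ennreal (\<integral>l. exp (- l) * indicator {..c} l \<partial>Q)" for c
  proof -
    have i: "integrable P (\<lambda>l. exp (- l) * indicator {..c} l)" "integrable Q (\<lambda>l. exp (- l) * indicator {..c} l)"
      using P(3) Q(3) by (auto intro!: P.integrable_const_bound[where B = 1] Q.integrable_const_bound[where B = 1]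
          elim!: eventually_mono simp: indicator_def)
    have "(\<integral>\<^sup>+l\<in>{..c}. ennreal (exp (- l)) \<partial>P) = (\<integral>\<^sup>+l. ennreal (exp (- l) * indicator {..c} l) \<partial>P)"
      "(\<integral>\<^sup>+l\<in>{..c}. ennreal (exp (- l)) \<partial>Q) = (\<integral>\<^sup>+l. ennreal (exp (- l) * indicator {..c} l) \<partial>Q)"
      by (auto intro!: nn_integral_cong simp: indicator_def)
    then show "(\<integral>\<^sup>+l\<in>{..c}. ennreal (exp (- l)) \<partial>P) = ennreal (\<integral>l. exp (- l) * indicator {..c} l \<partial>P)"
      "(\<integral>\<^sup>+l\<in>{..c}. ennreal (exp (- l)) \<partial>Q) = ennreal (\<integral>l. exp (- l) * indicator {..c} l \<partial>Q)"
      using i by (auto simp: nn_integral_eq_integral)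
  qed
  \<comment> \<open>The distribution functions found above belong to the measures weighted by exp(-
    l); the density exp l undoes the weight.\<close>
  define P' Q' where "P' = density P (\<lambda>l. ennreal (exp (- l)))" and "Q' = density Q (\<lambda>l. ennreal (exp (- l)))"
  have fin: "finite_borel_measure P'" "finite_borel_measure Q'"
  proof -
    have "(\<integral>\<^sup>+l. ennreal (exp (- l)) \<partial>P) \<le> (\<integral>\<^sup>+l. 1 \<partial>P)" "(\<integral>\<^sup>+l. ennreal (exp (- l)) \<partial>Q) \<le> (\<integral>\<^sup>+l. 1 \<partial>Q)"
      using P(3) Q(3) by (auto intro!: nn_integral_mono_AE elim!: eventually_mono simp del: nn_integral_const)
    then have "(\<integral>\<^sup>+l. ennreal (exp (- l)) \<partial>P) < \<infinity>" "(\<integral>\<^sup>+l. ennreal (exp (- l)) \<partial>Q) < \<infinity>"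
      using P.emeasure_finite Q.emeasure_finite by (auto simp: less_top[symmetric] top_unique)
    then have "emeasure P' (space P') \<noteq> \<infinity>" "emeasure Q' (space Q') \<noteq> \<infinity>"
      unfolding P'_def Q'_def by (auto simp: emeasure_density cong: nn_integral_cong)
    then show "finite_borel_measure P'" "finite_borel_measure Q'"
      using P(2) Q(2) by (auto intro!: finite_measureI simp: finite_borel_measure_def finite_borel_measure_axioms_def P'_def Q'_def)
  qed
  have "cdf P' = cdf Q'"
  proof
    fix c
    show "cdf P' c = cdf Q' c"
      unfolding cdf_def measure_def P'_def Q'_def
      by (subst (1 2) emeasure_density) (auto simp: nnP nnQ cdf)
  qed
  then have "P' = Q'" by (rule cdf_unique'[OF fin])
  moreover have "density P' (\<lambda>l. ennreal (exp l)) = P" "density Q' (\<lambda>l. ennreal (exp l)) = Q"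
    unfolding P'_def Q'_def
    by (auto simp: density_density_eq ennreal_mult[symmetric] exp_add[symmetric] density_1)
  ultimately show "P = Q" by metis
qed

text \<open>For fixed \<theta> the Robin uniqueness in y applies to the weighted marginal; for fixed
  A the Laplace uniqueness then applies to the l-marginal on y in A. Rectangles determine the joint
  law.\<close>

lemma joint_robin_transform_unique:
  fixes P Q :: "(real \<times> real) measure"
  assumes P: "finite_measure P" "sets P = sets (borel \<Otimes>\<^sub>M borel)" "AE (y, l) in P. 0 \<le> l"
    and Q: "finite_measure Q" "sets Q = sets (borel \<Otimes>\<^sub>M borel)" "AE (y, l) in Q. 0 \<le> l"
    and even: "\<And>\<theta> k. 0 < \<theta> \<Longrightarrow> (\<integral>(y, l). exp (- \<theta> * l) * (\<theta> * sin (k * \<bar>y\<bar>) + k * cos (k * \<bar>y\<bar>)) \<partial>P)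
        = (\<integral>(y, l). exp (- \<theta> * l) * (\<theta> * sin (k * \<bar>y\<bar>) + k * cos (k * \<bar>y\<bar>)) \<partial>Q)"
    and skew: "\<And>\<theta> k. 0 < \<theta> \<Longrightarrow> (\<integral>(y, l). exp (- \<theta> * l) * (\<theta> * sin (k * y) + \<gamma> * k * cos (k * y)) \<partial>P)
        = (\<integral>(y, l). exp (- \<theta> * l) * (\<theta> * sin (k * y) + \<gamma> * k * cos (k * y)) \<partial>Q)"
  shows "P = Q"
proof -
  \<comment> \<open>The y-marginal after weighting with \<open>exp (- \<theta> * l)\<close>.\<close>
  define R where "R M \<theta> = distr (density M (\<lambda>(y, l). ennreal (exp (- \<theta> * l)))) borel fst"
    for M :: "(real \<times> real) measure" and \<theta>
  have R: "finite_measure (R M \<theta>)" "sets (R M \<theta>) = sets borel"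
    "\<And>w. w \<in> borel_measurable borel \<Longrightarrow> (\<integral>y. w y \<partial>R M \<theta>) = (\<integral>(y, l). exp (- \<theta> * l) * w y \<partial>M)"
    if M: "finite_measure M" "sets M = sets (borel \<Otimes>\<^sub>M borel)" "AE (y, l) in M. 0 \<le> l" and \<theta>: "0 < \<theta>" for M \<theta>
  proof -
    interpret M: finite_measure M by fact
    note [measurable_cong] = M(2)
    have "(\<integral>\<^sup>+(y, l). ennreal (exp (- \<theta> * l)) \<partial>M) \<le> (\<integral>\<^sup>+z. 1 \<partial>M)"
      using M(3) \<theta> by (intro nn_integral_mono_AE) (auto elim!: eventually_mono)
    then have "(\<integral>\<^sup>+(y, l). ennreal (exp (- \<theta> * l)) \<partial>M) < \<infinity>"
      using M.emeasure_finite by (auto simp: less_top[symmetric] top_unique)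
    then have "finite_measure (density M (\<lambda>(y, l). ennreal (exp (- \<theta> * l))))"
      by (intro finite_measureI) (auto simp: emeasure_density cong: nn_integral_cong)
    then show "finite_measure (R M \<theta>)" unfolding R_def by (intro finite_measure.finite_measure_distr) auto
    show "sets (R M \<theta>) = sets borel" by (simp add: R_def)
    fix w :: "real \<Rightarrow> real" assume [measurable]: "w \<in> borel_measurable borel"
    have "(\<integral>y. w y \<partial>R M \<theta>) = (\<integral>z. w (fst z) \<partial>density M (\<lambda>z. ennreal (exp (- \<theta> * snd z))))"
      unfolding R_def by (subst integral_distr) (auto simp: split_beta')
    also have "\<dots> = (\<integral>(y, l). exp (- \<theta> * l) * w y \<partial>M)"
      by (subst integral_density) (auto simp: split_beta')
    finally show "(\<integral>y. w y \<partial>R M \<theta>) = (\<integral>(y, l). exp (- \<theta> * l) * w y \<partial>M)" .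
  qed
  have RPQ: "R P \<theta> = R Q \<theta>" if \<theta>: "0 < \<theta>" for \<theta>
  proof (rule robin_transform_unique[OF R(1,2)[OF P \<theta>] R(1,2)[OF Q \<theta>] \<theta>, where \<gamma> = \<gamma>])
    fix k
    have [measurable]: "(\<lambda>y. \<theta> * sin (k * \<bar>y\<bar>) + k * cos (k * \<bar>y\<bar>)) \<in> borel_measurable borel"
      "(\<lambda>y. \<theta> * sin (k * y) + \<gamma> * k * cos (k * y)) \<in> borel_measurable borel"
      by measurable
    show "(\<integral>y. \<theta> * sin (k * \<bar>y\<bar>) + k * cos (k * \<bar>y\<bar>) \<partial>R P \<theta>) = (\<integral>y. \<theta> * sin (k * \<bar>y\<bar>) + k * cos (k * \<bar>y\<bar>) \<partial>R Q \<theta>)"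
      by (subst R(3)[OF P \<theta>], measurable, subst R(3)[OF Q \<theta>], measurable) (rule even[OF \<theta>])
    show "(\<integral>y. \<theta> * sin (k * y) + \<gamma> * k * cos (k * y) \<partial>R P \<theta>) = (\<integral>y. \<theta> * sin (k * y) + \<gamma> * k * cos (k * y) \<partial>R Q \<theta>)"
      by (subst R(3)[OF P \<theta>], measurable, subst R(3)[OF Q \<theta>], measurable) (rule skew[OF \<theta>])
  qed
  \<comment> \<open>The l-marginal of the part with y in A.\<close>
  define S where "S M A = distr (density M (\<lambda>(y, l). indicator A y)) borel snd"
    for M :: "(real \<times> real) measure" and A :: "real set"
  have S: "finite_measure (S M A)" "sets (S M A) = sets borel" "AE l in S M A. 0 \<le> l"
    "\<And>w :: real \<Rightarrow> real. w \<in> borel_measurable borel \<Longrightarrow> (\<integral>l. w l \<partial>S M A) = (\<integral>(y, l). w l * indicator A y \<partial>M)"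
    "\<And>D. D \<in> sets borel \<Longrightarrow> emeasure (S M A) D = emeasure M (A \<times> D)"
    if M: "finite_measure M" "sets M = sets (borel \<Otimes>\<^sub>M borel)" "AE (y, l) in M. 0 \<le> l" and A [measurable]: "A \<in> sets borel" for M A
  proof -
    interpret M: finite_measure M by fact
    note [measurable_cong] = M(2)
    have "(\<integral>\<^sup>+(y, l). indicator A y \<partial>M) \<le> (\<integral>\<^sup>+z. 1 \<partial>M)"
      by (intro nn_integral_mono) (auto simp: indicator_def)
    then have "(\<integral>\<^sup>+(y, l). indicator A y \<partial>M) < \<infinity>"
      using M.emeasure_finite by (auto simp: less_top[symmetric] top_unique)
    then have "finite_measure (density M (\<lambda>(y, l). indicator A y))"
      by (intro finite_measureI) (auto simp: emeasure_density cong: nn_integral_cong)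
    then show "finite_measure (S M A)" unfolding S_def by (intro finite_measure.finite_measure_distr) auto
    show "sets (S M A) = sets borel" by (simp add: S_def)
    show "AE l in S M A. 0 \<le> l"
      unfolding S_def using M(3) by (subst AE_distr_iff) (auto simp: AE_density split_beta')
    show "emeasure (S M A) D = emeasure M (A \<times> D)" if [measurable]: "D \<in> sets borel" for D
    proof -
      have sp: "space M = UNIV" using sets_eq_imp_space_eq[OF M(2)] by (simp add: space_pair_measure)
      have "snd -` D \<inter> space M \<in> sets M" by (rule measurable_sets[of snd M borel]) (auto intro: measurable_snd'')
      then have "emeasure (S M A) D = (\<integral>\<^sup>+z. (case z of (y, l) \<Rightarrow> indicator A y) * indicator (snd -` D \<inter> space M) z \<partial>M)"
        unfolding S_def by (simp add: emeasure_distr emeasure_density)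
      also have "\<dots> = (\<integral>\<^sup>+z. indicator (A \<times> D) z \<partial>M)"
        by (intro nn_integral_cong) (auto simp: indicator_def sp split_beta')
      finally have "emeasure (S M A) D = (\<integral>\<^sup>+z. indicator (A \<times> D) z \<partial>M)" .
      then show ?thesis using M(2) by simp
    qed
    fix w :: "real \<Rightarrow> real" assume [measurable]: "w \<in> borel_measurable borel"
    have "(\<integral>l. w l \<partial>S M A) = (\<integral>z. w (snd z) \<partial>density M (\<lambda>z. ennreal (indicator A (fst z))))"
      unfolding S_def by (subst integral_distr) (auto simp: split_beta' ennreal_indicator)
    also have "\<dots> = (\<integral>(y, l). w l * indicator A y \<partial>M)"
      by (subst integral_density) (auto simp: split_beta' mult.commute)
    finally show "(\<integral>l. w l \<partial>S M A) = (\<integral>(y, l). w l * indicator A y \<partial>M)" .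
  qed
  \<comment> \<open>Testing R against the indicator of A gives the Laplace transform of S, here at
    the integers.\<close>
  have SPQ: "S P A = S Q A" if A: "A \<in> sets borel" for A
  proof (rule finite_measure_laplace_unique[OF S(1-3)[OF P A] S(1-3)[OF Q A]])
    fix n :: nat assume "0 < n"
    then have n: "0 < real n" by simp
    show "(\<integral>l. exp (- real n * l) \<partial>S P A) = (\<integral>l. exp (- real n * l) \<partial>S Q A)"
      using R(3)[OF P n, of "indicator A"] R(3)[OF Q n, of "indicator A"] RPQ[OF n] A
      by (simp add: S(4)[OF P A] S(4)[OF Q A])
  qed
  show "P = Q"
  proof (rule measure_eqI_generator_eq[OF Int_stable_pair_measure_generator[of borel borel],
        where \<Omega> = UNIV and A = "\<lambda>_. UNIV \<times> UNIV"])
    show "{a \<times> b |a b. a \<in> sets borel \<and> b \<in> sets borel} \<subseteq> Pow (UNIV :: (real \<times> real) set)" by auto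
    show "sets P = sigma_sets UNIV {a \<times> b |a b. a \<in> sets borel \<and> b \<in> sets borel}"
      "sets Q = sigma_sets UNIV {a \<times> b |a b. a \<in> sets borel \<and> b \<in> sets borel}"
      using P(2) Q(2) by (simp_all add: sets_pair_measure)
    show "emeasure P X = emeasure Q X" if "X \<in> {a \<times> b |a b. a \<in> sets borel \<and> b \<in> sets borel}" for X
    proof -
      from that obtain a b where ab: "X = a \<times> b" "a \<in> sets borel" "b \<in> sets borel" by blast
      show ?thesis
        unfolding ab(1) S(5)[OF P ab(2,3), symmetric] S(5)[OF Q ab(2,3), symmetric] SPQ[OF ab(2)] ..
    qed
  qed (use finite_measure.emeasure_finite[OF P(1)] in \<open>auto intro!: exI[of _ UNIV]\<close>)
qed

section \<open>Heat kernel and hitting densities\<close>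

definition heat :: "real \<Rightarrow> real \<Rightarrow> real" where
  "heat t z = 1 / sqrt (2 * pi * t) * exp (- (z\<^sup>2 / (2 * t)))"

text \<open>For z > 0 and as a function of t, the density of the first time at which Brownian motion
  started at 0 reaches z; as a function of z, minus the derivative of the heat kernel.\<close>

definition hitting_density :: "real \<Rightarrow> real \<Rightarrow> real" where
  "hitting_density t z = z / sqrt (2 * pi * t ^ 3) * exp (- (z\<^sup>2 / (2 * t)))"

lemma heat_minus [simp]: "heat t (- z) = heat t z"
  by (simp add: heat_def)

lemma heat_nonneg: "0 < t \<Longrightarrow> 0 \<le> heat t z"
  by (simp add: heat_def)

lemma hitting_density_nonneg: "0 < t \<Longrightarrow> 0 \<le> z \<Longrightarrow> 0 \<le> hitting_density t z"
  by (simp add: hitting_density_def)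

lemma heat_measurable [measurable]: "heat t \<in> borel_measurable borel"
  unfolding heat_def by measurable

lemma hitting_density_measurable [measurable]: "hitting_density t \<in> borel_measurable borel"
  unfolding hitting_density_def by measurable

lemma heat_antimono:
  assumes t: "0 < t" and "\<bar>y\<bar> \<le> \<bar>z\<bar>"
  shows "heat t z \<le> heat t y"
proof -
  have "y\<^sup>2 \<le> z\<^sup>2" using assms(2) by (rule abs_le_square_iff[THEN iffD1])
  then show ?thesis using t by (auto simp: heat_def intro!: divide_right_mono)
qed

lemma heat_deriv:
  assumes t: "0 < t"
  shows "(heat t has_real_derivative - hitting_density t z) (at z)"
proof -
  define r where "r = sqrt (2 * pi * t)"
  have r0: "r \<noteq> 0" using t by (simp add: r_def)
  have "sqrt (2 * pi * t ^ 3) = sqrt ((2 * pi * t) * t\<^sup>2)" by (simp add: power3_eq_cube power2_eq_square mult_ac)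
  then have s: "sqrt (2 * pi * t ^ 3) = r * t" using t by (simp only: real_sqrt_mult real_sqrt_unique less_imp_le r_def)
  have "(heat t has_real_derivative 1 / r * (exp (- (z\<^sup>2 / (2 * t))) * - (2 * z / (2 * t)))) (at z)"
    unfolding heat_def r_def[symmetric] using t r0 by (auto intro!: derivative_eq_intros)
  then show ?thesis unfolding hitting_density_def s using t by (simp add: mult_ac)
qed

lemma heat_at_top: "0 < t \<Longrightarrow> ((\<lambda>z. heat t (z + c)) \<longlongrightarrow> 0) at_top"
  unfolding heat_def by real_asymp

lemma heat_eq_normal_density: "0 < t \<Longrightarrow> heat t (y - c) = normal_density c (sqrt t) y"
  by (simp add: heat_def normal_density_def)

lemma heat_integrable: "0 < t \<Longrightarrow> integrable lborel (\<lambda>y. heat t (y - c))"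
  unfolding heat_eq_normal_density by simp

lemma integrable_mult_bounded:
  fixes f w :: "real \<Rightarrow> real"
  assumes "integrable lborel f" "w \<in> borel_measurable borel" "\<And>y. \<bar>w y\<bar> \<le> C"
  shows "integrable lborel (\<lambda>y. f y * w y)"
proof (rule Bochner_Integration.integrable_bound)
  show "integrable lborel (\<lambda>y. C * f y)" using assms(1) by simp
  show "(\<lambda>y. f y * w y) \<in> borel_measurable lborel" using assms(1,2) by auto
  have "\<bar>f y\<bar> * \<bar>w y\<bar> \<le> \<bar>f y\<bar> * \<bar>C\<bar>" for y using assms(3)[of y] by (intro mult_left_mono) auto
  then show "AE y in lborel. norm (f y * w y) \<le> norm (C * f y)" by (simp add: abs_mult mult.commute)
qed

lemma std_normal_fourier:
  "(LBINT z. std_normal_density z * cos (k * z)) = exp (- (k\<^sup>2 / 2))"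
  "(LBINT z. std_normal_density z * sin (k * z)) = 0"
proof -
  have i: "integrable lborel (\<lambda>z. std_normal_density z * cos (k * z))" "integrable lborel (\<lambda>z. std_normal_density z * sin (k * z))"
    by (rule integrable_mult_bounded[where C = 1]; simp)+
  have iexp: "iexp r = complex_of_real (cos r) + \<i> * complex_of_real (sin r)" for r
    by (simp add: exp_Euler cos_of_real sin_of_real)
  have "char std_normal_distribution k = (CLBINT z. std_normal_density z *\<^sub>R iexp (k * z))"
    unfolding char_def by (subst integral_density) auto
  also have "\<dots> = (CLBINT z. complex_of_real (std_normal_density z * cos (k * z)) + \<i> * complex_of_real (std_normal_density z * sin (k * z)))"
    by (intro Bochner_Integration.integral_cong refl)
      (unfold iexp, simp add: scaleR_conv_of_real distrib_left mult_ac)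
  also have "\<dots> = complex_of_real (LBINT z. std_normal_density z * cos (k * z)) + \<i> * complex_of_real (LBINT z. std_normal_density z * sin (k * z))"
    using integrable_of_real[OF i(1), where 'a = complex] integrable_of_real[OF i(2), where 'a = complex]
    by (subst Bochner_Integration.integral_add) (simp_all only: integrable_mult_right integral_mult_right_zero integral_complex_of_real)
  finally have eq: "complex_of_real (exp (- (k\<^sup>2 / 2))) = complex_of_real (LBINT z. std_normal_density z * cos (k * z)) + \<i> * complex_of_real (LBINT z. std_normal_density z * sin (k * z))"
    by (simp add: char_std_normal_distribution)
  from arg_cong[OF eq, of Re] arg_cong[OF eq, of Im]
  show "(LBINT z. std_normal_density z * cos (k * z)) = exp (- (k\<^sup>2 / 2))" "(LBINT z. std_normal_density z * sin (k * z)) = 0"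
    by simp_all
qed

text \<open>Substituting y = c + sqrt(t) z reduces both integrals to the standard normal ones; the
  addition theorems bring out the shift c.\<close>

lemma heat_fourier:
  assumes t: "0 < t"
  shows "(LBINT y. heat t (y - c) * cos (k * y)) = exp (- (k\<^sup>2 * t / 2)) * cos (k * c)"
    "(LBINT y. heat t (y - c) * sin (k * y)) = exp (- (k\<^sup>2 * t / 2)) * sin (k * c)"
proof -
  have h: "sqrt t * heat t (c + sqrt t * z - c) = std_normal_density z" for z
    using t by (simp add: heat_def normal_density_def real_sqrt_mult power_mult_distrib)
  have st: "sqrt t \<noteq> 0" "\<bar>sqrt t\<bar> = sqrt t" using t by auto
  have i: "integrable lborel (\<lambda>z. std_normal_density z * cos (k * sqrt t * z))" "integrable lborel (\<lambda>z. std_normal_density z * sin (k * sqrt t * z))"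
    by (rule integrable_mult_bounded[where C = 1]; simp)+
  have k2: "(k * sqrt t)\<^sup>2 / 2 = k\<^sup>2 * t / 2" using t by (simp add: power_mult_distrib)
  note F = std_normal_fourier[of "k * sqrt t", unfolded k2]
  have "(LBINT y. heat t (y - c) * cos (k * y)) = (LBINT z. (sqrt t * heat t (c + sqrt t * z - c)) * cos (k * (c + sqrt t * z)))"
    by (subst lborel_integral_real_affine[OF st(1), of _ c]) (simp add: st mult.assoc)
  also have "\<dots> = (LBINT z. cos (k * c) * (std_normal_density z * cos (k * sqrt t * z)) - sin (k * c) * (std_normal_density z * sin (k * sqrt t * z)))"
    unfolding h by (intro Bochner_Integration.integral_cong refl) (simp add: distrib_left cos_add algebra_simps)
  also have "\<dots> = cos (k * c) * exp (- (k\<^sup>2 * t / 2)) - sin (k * c) * 0"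
    using i by (subst Bochner_Integration.integral_diff) (auto simp: F)
  finally show "(LBINT y. heat t (y - c) * cos (k * y)) = exp (- (k\<^sup>2 * t / 2)) * cos (k * c)" by (simp add: mult.commute)
  have "(LBINT y. heat t (y - c) * sin (k * y)) = (LBINT z. (sqrt t * heat t (c + sqrt t * z - c)) * sin (k * (c + sqrt t * z)))"
    by (subst lborel_integral_real_affine[OF st(1), of _ c]) (simp add: st mult.assoc)
  also have "\<dots> = (LBINT z. sin (k * c) * (std_normal_density z * cos (k * sqrt t * z)) + cos (k * c) * (std_normal_density z * sin (k * sqrt t * z)))"
    unfolding h by (intro Bochner_Integration.integral_cong refl) (simp add: distrib_left sin_add algebra_simps)
  also have "\<dots> = sin (k * c) * exp (- (k\<^sup>2 * t / 2)) + cos (k * c) * 0"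
    using i by (subst Bochner_Integration.integral_add) (auto simp: F)
  finally show "(LBINT y. heat t (y - c) * sin (k * y)) = exp (- (k\<^sup>2 * t / 2)) * sin (k * c)" by (simp add: mult.commute)
qed

section \<open>Half-line integrals and the Laplace transform in the local time\<close>

lemma integral_fold_half_line:
  fixes f :: "real \<Rightarrow> real"
  assumes f: "integrable lborel f"
  shows "(LBINT y. f y) = (LBINT y:{0..}. f y + f (- y))" "set_integrable lborel {0..} (\<lambda>y. f y + f (- y))"
proof -
  have f': "integrable lborel (\<lambda>y. f (- y))" using lborel_integrable_real_affine[OF f, of "- 1" 0] by simp
  have i: "integrable lborel (\<lambda>y. f y * indicator {0..} y)" "integrable lborel (\<lambda>y. f (- y) * indicator {0..} y)"
    "integrable lborel (\<lambda>y. f y * indicator {..0} y)"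
    using f f' by (auto intro!: integrable_mult_bounded[where C = 1] simp: indicator_def)
  show "set_integrable lborel {0..} (\<lambda>y. f y + f (- y))"
    using Bochner_Integration.integrable_add[OF i(1,2)] by (simp add: set_integrable_def algebra_simps)
  have "(LBINT y. f y) = (LBINT y. f y * indicator {0..} y + f y * indicator {..0} y)"
  proof (rule integral_cong_AE)
    show "AE y in lborel. f y = f y * indicator {0..} y + f y * indicator {..0} y"
      using AE_lborel_singleton[of "0::real"] by eventually_elim (auto simp: indicator_def)
  qed (use f i in auto)
  also have "\<dots> = (LBINT y. f y * indicator {0..} y) + (LBINT y. f y * indicator {..0} y)"
    using i by simp
  also have "(LBINT y. f y * indicator {..0} y) = (LBINT y. f (- y) * indicator {0..} y)"
    by (subst lborel_integral_real_affine[of "- 1" _ 0]) (auto simp: indicator_def intro!: Bochner_Integration.integral_cong)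
  also have "(LBINT y. f y * indicator {0..} y) + (LBINT y. f (- y) * indicator {0..} y) = (LBINT y:{0..}. f y + f (- y))"
    using i by (simp add: set_lebesgue_integral_def algebra_simps)
  finally show "(LBINT y. f y) = (LBINT y:{0..}. f y + f (- y))" .
qed

text \<open>The integrand is the derivative of - \<open>heat t (z + c)\<close>, which vanishes at
  infinity.\<close>

lemma hitting_density_integral:
  assumes t: "0 < t" and c: "0 \<le> c"
  shows "(\<integral>\<^sup>+z. ennreal (hitting_density t (z + c) * indicator {0..} z) \<partial>lborel) = ennreal (heat t c)"
    "set_integrable lborel {0..} (\<lambda>z. hitting_density t (z + c))"
    "(LBINT z:{0..}. hitting_density t (z + c)) = heat t c"
proof -
  have "(\<integral>\<^sup>+z\<in>{0..}. ennreal (hitting_density t (z + c)) \<partial>lborel) = ennreal (0 - - heat t (0 + c))"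
  proof (rule nn_integral_FTC_atLeast[where F = "\<lambda>z. - heat t (z + c)" and T = 0])
    show "((\<lambda>z. - heat t (z + c)) has_real_derivative hitting_density t (z + c)) (at z)" for z
      using DERIV_minus[OF DERIV_shift[THEN iffD1, OF heat_deriv[OF t, of "z + c"]]] by simp
    show "((\<lambda>z. - heat t (z + c)) \<longlongrightarrow> 0) at_top" using tendsto_minus[OF heat_at_top[OF t, of c]] by simp
  qed (use hitting_density_nonneg t c in auto)
  also have "(\<integral>\<^sup>+z\<in>{0..}. ennreal (hitting_density t (z + c)) \<partial>lborel) = (\<integral>\<^sup>+z. ennreal (hitting_density t (z + c) * indicator {0..} z) \<partial>lborel)"
    by (intro nn_integral_cong) (auto simp: indicator_def)
  finally show nn: "(\<integral>\<^sup>+z. ennreal (hitting_density t (z + c) * indicator {0..} z) \<partial>lborel) = ennreal (heat t c)" by simp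
  have nonneg: "0 \<le> hitting_density t (z + c) * indicator {0..} z" for z
    using hitting_density_nonneg[OF t, of "z + c"] c by (auto simp: indicator_def)
  have i: "integrable lborel (\<lambda>z. hitting_density t (z + c) * indicator {0..} z)"
    using nn nonneg by (intro integrableI_nonneg) auto
  then show "set_integrable lborel {0..} (\<lambda>z. hitting_density t (z + c))"
    by (simp add: set_integrable_def mult.commute)
  have "(LBINT z. hitting_density t (z + c) * indicator {0..} z) = heat t c"
    using nn nonneg heat_nonneg[OF t] by (subst integral_eq_nn_integral) auto
  then show "(LBINT z:{0..}. hitting_density t (z + c)) = heat t c"
    by (simp add: set_lebesgue_integral_def mult.commute)
qed

text \<open>The continuous part of the law depends on l and the distances only through l + |y| +
  |x|. After the Laplace transform in l, this function at c = |y| + |x| therefore describes it up to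
  the side weight.\<close>

definition laplace_hitting :: "real \<Rightarrow> real \<Rightarrow> real \<Rightarrow> real" where
  "laplace_hitting t \<theta> c = (LBINT l:{0..}. exp (- \<theta> * l) * hitting_density t (l + c))"

lemma laplace_hitting_integrable:
  assumes t: "0 < t" and c: "0 \<le> c" and \<theta>: "0 < \<theta>"
  shows "set_integrable lborel {0..} (\<lambda>l. exp (- \<theta> * l) * hitting_density t (l + c))"
    "0 \<le> laplace_hitting t \<theta> c" "laplace_hitting t \<theta> c \<le> heat t c"
proof -
  have i: "integrable lborel (\<lambda>l. hitting_density t (l + c) * indicator {0..} l)"
    using hitting_density_integral(2)[OF t c] by (simp add: set_integrable_def mult.commute)
  have nonneg: "0 \<le> hitting_density t (l + c)" if "0 \<le> l" for l
    using hitting_density_nonneg[OF t, of "l + c"] c that by simp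
  have bnd: "exp (- \<theta> * l) * hitting_density t (l + c) * indicator {0..} l \<le> hitting_density t (l + c) * indicator {0..} l" for l
    using nonneg[of l] \<theta> by (auto simp: indicator_def mult_left_le_one_le)
  have nn: "0 \<le> exp (- \<theta> * l) * hitting_density t (l + c) * indicator {0..} l" for l
    using nonneg[of l] by (auto simp: indicator_def)
  have i2: "integrable lborel (\<lambda>l. exp (- \<theta> * l) * hitting_density t (l + c) * indicator {0..} l)"
    by (rule Bochner_Integration.integrable_bound[OF i]) (use bnd nn in \<open>auto intro: order_trans[OF _ abs_ge_self]\<close>)
  then show "set_integrable lborel {0..} (\<lambda>l. exp (- \<theta> * l) * hitting_density t (l + c))"
    by (simp add: set_integrable_def mult_ac)
  have eq: "laplace_hitting t \<theta> c = (LBINT l. exp (- \<theta> * l) * hitting_density t (l + c) * indicator {0..} l)"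
    by (simp add: laplace_hitting_def set_lebesgue_integral_def mult_ac)
  show "0 \<le> laplace_hitting t \<theta> c" unfolding eq using nn by (intro integral_nonneg_AE) auto
  have "laplace_hitting t \<theta> c \<le> (LBINT l. hitting_density t (l + c) * indicator {0..} l)"
    unfolding eq using bnd by (intro integral_mono i2 i) auto
  also have "\<dots> = heat t c" using hitting_density_integral(3)[OF t c] by (simp add: set_lebesgue_integral_def mult.commute)
  finally show "laplace_hitting t \<theta> c \<le> heat t c" .
qed

text \<open>For \<open>H y = laplace_hitting t \<theta> (y + c)\<close> one has \<open>H' = \<theta> H - hitting_density t (y + c)\<close>, so
  \<open>(H y - heat t (y + c)) sin (k y)\<close> is an antiderivative.\<close>

lemma laplace_hitting_robin_transform:
  assumes t: "0 < t" and c: "0 \<le> c" and \<theta>: "0 < \<theta>"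
  shows "(LBINT y:{0..}. laplace_hitting t \<theta> (y + c) * (\<theta> * sin (k * y) + k * cos (k * y)))
      = k * (LBINT y:{0..}. heat t (y + c) * cos (k * y))"
    "set_integrable lborel {0..} (\<lambda>y. laplace_hitting t \<theta> (y + c))"
    "(\<lambda>y. laplace_hitting t \<theta> (y + c) * indicator {0..} y) \<in> borel_measurable borel"
proof -
  have hc: "continuous_on UNIV (hitting_density t)" unfolding hitting_density_def using t by (intro continuous_intros) auto
  have "continuous_on UNIV (\<lambda>z. exp (- \<theta> * z) * hitting_density t (z + c))"
    by (intro continuous_intros continuous_on_compose2[OF hc]) auto
  then obtain I where I: "\<And>z. (I has_real_derivative exp (- \<theta> * z) * hitting_density t (z + c)) (at z)" "I 0 = 0"
    by (rule antiderivative_on_reals) blast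
  have Icont: "isCont (\<lambda>z. exp (- \<theta> * z) * hitting_density t (z + c)) z" for z
    using \<open>continuous_on UNIV (\<lambda>z. exp (- \<theta> * z) * hitting_density t (z + c))\<close> by (simp add: continuous_on_eq_continuous_at)
  define J where "J = laplace_hitting t \<theta> c"
  have Ilim: "(I \<longlongrightarrow> J) at_top"
  proof -
    have "((\<lambda>b. LBINT z:{0..b}. exp (- \<theta> * z) * hitting_density t (z + c)) \<longlongrightarrow> J) at_top"
      unfolding J_def laplace_hitting_def
      by (intro tendsto_set_lebesgue_integral_at_top laplace_hitting_integrable[OF t c \<theta>]) auto
    moreover have "eventually (\<lambda>b. (LBINT z:{0..b}. exp (- \<theta> * z) * hitting_density t (z + c)) = I b) at_top"
      using eventually_ge_at_top[of 0]
    proof eventually_elim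
      case (elim b)
      have "(LBINT z. (exp (- \<theta> * z) * hitting_density t (z + c)) * indicator {0..b} z) = I b - I 0"
        by (rule integral_FTC_Icc_real[OF elim]) (use I Icont in auto)
      then show ?case by (simp add: set_lebesgue_integral_def I(2) mult_ac)
    qed
    ultimately show ?thesis by (rule Lim_transform_eventually)
  qed
  \<comment> \<open>An explicit form of H that is differentiable on the whole line, so that the
    fundamental theorem can be applied from the end point 0 on.\<close>
  define K where "K y = exp (\<theta> * y) * (J - I y)" for y
  have KH: "laplace_hitting t \<theta> (y + c) = K y" if y: "0 \<le> y" for y
  proof -
    have "laplace_hitting t \<theta> (y + c) = exp (\<theta> * y) * J - exp (\<theta> * y) * I (0 + y)"
      unfolding laplace_hitting_def
    proof (rule LBINT_FTC_atLeast)
      fix l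
      have "((\<lambda>l. I (l + y)) has_real_derivative exp (- \<theta> * (l + y)) * hitting_density t (l + y + c)) (at l)"
        using I(1)[of "l + y"] DERIV_shift by blast
      from DERIV_cmult[OF this, of "exp (\<theta> * y)"]
      show "((\<lambda>l. exp (\<theta> * y) * I (l + y)) has_real_derivative exp (- \<theta> * l) * hitting_density t (l + (y + c))) (at l)"
        by (simp add: mult.assoc[symmetric] exp_add[symmetric] algebra_simps)
    next
      have "continuous_on UNIV (\<lambda>l. exp (- \<theta> * l) * hitting_density t (l + (y + c)))"
        by (intro continuous_intros continuous_on_compose2[OF hc]) auto
      then show "isCont (\<lambda>l. exp (- \<theta> * l) * hitting_density t (l + (y + c))) l" for l
        by (simp add: continuous_on_eq_continuous_at)
      show "set_integrable lborel {0..} (\<lambda>l. exp (- \<theta> * l) * hitting_density t (l + (y + c)))"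
        using y c by (intro laplace_hitting_integrable[OF t _ \<theta>]) auto
      have "filterlim (\<lambda>l. l + y) at_top at_top" by real_asymp
      from filterlim_compose[OF Ilim this]
      show "((\<lambda>l. exp (\<theta> * y) * I (l + y)) \<longlongrightarrow> exp (\<theta> * y) * J) at_top" by (intro tendsto_intros)
    qed
    then show ?thesis by (simp add: K_def algebra_simps)
  qed
  have dK: "(K has_real_derivative \<theta> * K y - hitting_density t (y + c)) (at y)" for y
  proof -
    have "(K has_real_derivative exp (\<theta> * y) * \<theta> * (J - I y) + (0 - exp (- \<theta> * y) * hitting_density t (y + c)) * exp (\<theta> * y)) (at y)"
      unfolding K_def by (intro DERIV_mult DERIV_diff DERIV_const I(1)) (auto intro!: derivative_eq_intros)
    moreover have "exp (\<theta> * y) * \<theta> * (J - I y) + (0 - exp (- \<theta> * y) * hitting_density t (y + c)) * exp (\<theta> * y)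
        = \<theta> * K y - hitting_density t (y + c)"
      by (simp add: K_def exp_minus field_simps)
    ultimately show ?thesis by simp
  qed
  have Kcont: "continuous_on UNIV K" using dK by (meson DERIV_isCont continuous_at_imp_continuous_on)
  have [measurable]: "K \<in> borel_measurable borel" by (rule borel_measurable_continuous_onI[OF Kcont])
  have KI: "(\<lambda>y. laplace_hitting t \<theta> (y + c) * indicator {0..} y) = (\<lambda>y. K y * indicator {0..} y)"
    using KH by (auto simp: indicator_def)
  show "(\<lambda>y. laplace_hitting t \<theta> (y + c) * indicator {0..} y) \<in> borel_measurable borel"
    unfolding KI by measurable
  have hi: "integrable lborel (\<lambda>y. heat t (y + c))" using heat_integrable[OF t, of "- c"] by simp
  have Kb: "0 \<le> K y" "K y \<le> heat t (y + c)" if "0 \<le> y" for y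
    using laplace_hitting_integrable(2,3)[OF t _ \<theta>, of "y + c"] KH[OF that] that c by auto
  have Ki: "integrable lborel (\<lambda>y. K y * indicator {0..} y)"
    by (rule Bochner_Integration.integrable_bound[OF hi]) (use Kb heat_nonneg[OF t] in \<open>auto simp: indicator_def\<close>)
  then show "set_integrable lborel {0..} (\<lambda>y. laplace_hitting t \<theta> (y + c))"
    unfolding set_integrable_def using KI by (simp add: mult.commute)
  have w: "\<bar>\<theta> * sin (k * y) + k * cos (k * y)\<bar> \<le> \<theta> + \<bar>k\<bar>" for y
    using abs_sin_cos_comb[of k "\<bar>k\<bar>" \<theta> \<theta> "k * y"] \<theta> by (simp add: add.commute)
  have i1: "integrable lborel (\<lambda>y. K y * indicator {0..} y * (\<theta> * sin (k * y) + k * cos (k * y)))"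
    by (rule integrable_mult_bounded[OF Ki _ w]) measurable
  have i2: "integrable lborel (\<lambda>y. heat t (y + c) * (cos (k * y) * indicator {0..} y))"
    by (rule integrable_mult_bounded[OF hi, where C = 1]) (auto simp: indicator_def)
  \<comment> \<open>The boundary terms vanish: at 0 because of the sine, at infinity because K and
    the heat kernel both lie between 0 and the heat kernel.\<close>
  have "(LBINT y:{0..}. K y * (\<theta> * sin (k * y) + k * cos (k * y)) - k * (heat t (y + c) * cos (k * y)))
      = 0 - (K 0 - heat t (0 + c)) * sin (k * 0)"
  proof (rule LBINT_FTC_atLeast[where F = "\<lambda>y. (K y - heat t (y + c)) * sin (k * y)"])
    fix y
    have "((\<lambda>y. heat t (y + c)) has_real_derivative - hitting_density t (y + c)) (at y)"
      using heat_deriv[OF t, of "y + c"] DERIV_shift by blast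
    then have "((\<lambda>y. (K y - heat t (y + c)) * sin (k * y)) has_real_derivative
        (\<theta> * K y - hitting_density t (y + c) - - hitting_density t (y + c)) * sin (k * y) + (cos (k * y) * k) * (K y - heat t (y + c))) (at y)"
      by (intro DERIV_mult DERIV_diff dK) (auto intro!: derivative_eq_intros)
    then show "((\<lambda>y. (K y - heat t (y + c)) * sin (k * y)) has_real_derivative
        K y * (\<theta> * sin (k * y) + k * cos (k * y)) - k * (heat t (y + c) * cos (k * y))) (at y)"
      by (simp add: algebra_simps)
  next
    have "continuous_on UNIV (\<lambda>y. heat t (y + c))" unfolding heat_def using t by (intro continuous_intros) auto
    then have "continuous_on UNIV (\<lambda>y. K y * (\<theta> * sin (k * y) + k * cos (k * y)) - k * (heat t (y + c) * cos (k * y)))"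
      by (intro continuous_intros Kcont)
    then show "isCont (\<lambda>y. K y * (\<theta> * sin (k * y) + k * cos (k * y)) - k * (heat t (y + c) * cos (k * y))) y" for y
      by (simp add: continuous_on_eq_continuous_at)
    show "set_integrable lborel {0..} (\<lambda>y. K y * (\<theta> * sin (k * y) + k * cos (k * y)) - k * (heat t (y + c) * cos (k * y)))"
      using Bochner_Integration.integrable_diff[OF i1 integrable_mult_right[OF i2, of k]]
      by (simp add: set_integrable_def algebra_simps)
    show "((\<lambda>y. (K y - heat t (y + c)) * sin (k * y)) \<longlongrightarrow> 0) at_top"
    proof (rule Lim_null_comparison[OF _ heat_at_top[OF t, of c]])
      show "\<forall>\<^sub>F y in at_top. norm ((K y - heat t (y + c)) * sin (k * y)) \<le> heat t (y + c)"
        using eventually_ge_at_top[of 0]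
      proof eventually_elim
        case (elim y)
        have "\<bar>K y - heat t (y + c)\<bar> * \<bar>sin (k * y)\<bar> \<le> heat t (y + c) * 1"
          using Kb[OF elim] heat_nonneg[OF t, of "y + c"] by (intro mult_mono) auto
        then show ?case by (simp add: abs_mult)
      qed
    qed
  qed
  then have "(LBINT y. K y * indicator {0..} y * (\<theta> * sin (k * y) + k * cos (k * y)) - k * (heat t (y + c) * (cos (k * y) * indicator {0..} y))) = 0"
    by (simp add: set_lebesgue_integral_def algebra_simps)
  then have "(LBINT y. K y * indicator {0..} y * (\<theta> * sin (k * y) + k * cos (k * y))) = k * (LBINT y. heat t (y + c) * (cos (k * y) * indicator {0..} y))"
    using i1 i2 by simp
  moreover have "(LBINT y:{0..}. laplace_hitting t \<theta> (y + c) * (\<theta> * sin (k * y) + k * cos (k * y)))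
      = (LBINT y. K y * indicator {0..} y * (\<theta> * sin (k * y) + k * cos (k * y)))"
    unfolding set_lebesgue_integral_def using KH by (intro Bochner_Integration.integral_cong) (auto simp: indicator_def)
  ultimately show "(LBINT y:{0..}. laplace_hitting t \<theta> (y + c) * (\<theta> * sin (k * y) + k * cos (k * y)))
      = k * (LBINT y:{0..}. heat t (y + c) * cos (k * y))"
    by (simp add: set_lebesgue_integral_def mult_ac)
qed

section \<open>The joint law\<close>

text \<open>The value at y = 0 is that of the negative side. Hence the formula for y \<le> 0 holds
  pointwise, while the one for y \<ge> 0 needs an almost everywhere argument.\<close>

definition side_weight :: "real \<Rightarrow> real \<Rightarrow> real" where
  "side_weight \<alpha> y = (if 0 < y then \<alpha> else 1 - \<alpha>)"

text \<open>The transition density of Brownian motion killed at 0, by the method of images. For x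
  and y on opposite sides the difference is negative and the maximum replaces it by 0.\<close>

definition killed_heat :: "real \<Rightarrow> real \<Rightarrow> real \<Rightarrow> real" where
  "killed_heat t x y = max 0 (heat t (y - x) - heat t (y + x))"

text \<open>The atom at \<open>l = 0\<close> is obtained by spreading its mass uniformly over \<open>- 1 \<le> l < 0\<close> and mapping
  \<open>l\<close> to \<open>max 0 l\<close>.\<close>

definition skew_density :: "real \<Rightarrow> real \<Rightarrow> real \<Rightarrow> real \<Rightarrow> real \<Rightarrow> real" where
  "skew_density t \<alpha> x y l = (if 0 \<le> l then 2 * side_weight \<alpha> y * hitting_density t (l + (\<bar>y\<bar> + \<bar>x\<bar>))
     else if - 1 \<le> l then killed_heat t x y else 0)"

definition skew_law :: "real \<Rightarrow> real \<Rightarrow> real \<Rightarrow> (real \<times> real) measure" where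
  "skew_law t \<alpha> x = distr (density (lborel \<Otimes>\<^sub>M lborel) (\<lambda>z. ennreal (skew_density t \<alpha> x (fst z) (snd z))))
     (borel \<Otimes>\<^sub>M borel) (\<lambda>z. (fst z, max 0 (snd z)))"

lemma side_weight_measurable [measurable]: "side_weight \<alpha> \<in> borel_measurable borel"
  unfolding side_weight_def by measurable

lemma killed_heat_measurable [measurable]: "killed_heat t x \<in> borel_measurable borel"
  unfolding killed_heat_def by measurable

lemma skew_density_measurable [measurable]:
  assumes [measurable]: "f \<in> borel_measurable M" "g \<in> borel_measurable M"
  shows "(\<lambda>z. skew_density t \<alpha> x (f z) (g z)) \<in> borel_measurable M"
  unfolding skew_density_def by measurable

text \<open>Changing both signs leaves the two heat terms unchanged, and the heat kernel decreases
  with distance, so the comparison of |y - x| with |y + x| decides the sign of the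
  difference.\<close>

lemma killed_heat_cases:
  assumes t: "0 < t"
  shows "0 \<le> x * y \<Longrightarrow> killed_heat t x y = heat t (\<bar>y\<bar> - \<bar>x\<bar>) - heat t (\<bar>y\<bar> + \<bar>x\<bar>)"
    "x * y \<le> 0 \<Longrightarrow> killed_heat t x y = 0"
proof -
  have le: "heat t (\<bar>y\<bar> + \<bar>x\<bar>) \<le> heat t (\<bar>y\<bar> - \<bar>x\<bar>)" by (rule heat_antimono[OF t]) auto
  show "killed_heat t x y = heat t (\<bar>y\<bar> - \<bar>x\<bar>) - heat t (\<bar>y\<bar> + \<bar>x\<bar>)" if "0 \<le> x * y"
  proof -
    have "(0 \<le> x \<and> 0 \<le> y) \<or> (x \<le> 0 \<and> y \<le> 0)" using that by (auto simp: zero_le_mult_iff)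
    then show ?thesis
    proof
      assume "0 \<le> x \<and> 0 \<le> y" then show ?thesis using le by (simp add: killed_heat_def)
    next
      assume a: "x \<le> 0 \<and> y \<le> 0"
      have "- y + x = - (y - x)" "- y - x = - (y + x)" by simp_all
      then have "heat t (- y + x) = heat t (y - x)" "heat t (- y - x) = heat t (y + x)" by (simp_all only: heat_minus)
      with a le show ?thesis by (simp add: killed_heat_def)
    qed
  qed
  show "killed_heat t x y = 0" if "x * y \<le> 0"
  proof -
    have "\<bar>y + x\<bar> \<le> \<bar>y - x\<bar>" using that by (auto simp: mult_le_0_iff)
    from heat_antimono[OF t this] show ?thesis by (simp add: killed_heat_def)
  qed
qed

section \<open>The claimed law: mass, integrals and Robin transforms\<close>

context
  fixes t \<alpha> x :: real
  assumes t: "0 < t" and \<alpha>: "0 < \<alpha>" "\<alpha> < 1"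
begin

lemma side_weight_bounds: "0 \<le> side_weight \<alpha> y" "side_weight \<alpha> y \<le> 1"
  using \<alpha> by (auto simp: side_weight_def)

lemma killed_heat_bounds: "0 \<le> killed_heat t x y" "killed_heat t x y \<le> heat t (y - x)"
  using heat_nonneg[OF t] by (auto simp: killed_heat_def)

lemma skew_density_nonneg: "0 \<le> skew_density t \<alpha> x y l"
  using side_weight_bounds(1) killed_heat_bounds(1) hitting_density_nonneg[OF t]
  by (auto simp: skew_density_def)

text \<open>On [- 1, 0) the integrand is constant because max 0 l = 0, and this interval has length
  1; it yields the atom.\<close>

lemma nn_integral_skew_density_inner:
  assumes h [measurable]: "h \<in> borel_measurable borel"
  shows "(\<integral>\<^sup>+l. ennreal (skew_density t \<alpha> x y l) * h (max 0 l) \<partial>lborel)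
    = (\<integral>\<^sup>+l. ennreal (2 * side_weight \<alpha> y * hitting_density t (l + (\<bar>y\<bar> + \<bar>x\<bar>)) * indicator {0..} l) * h l \<partial>lborel)
      + ennreal (killed_heat t x y) * h 0"
proof -
  have "(\<integral>\<^sup>+l. ennreal (skew_density t \<alpha> x y l) * h (max 0 l) \<partial>lborel)
      = (\<integral>\<^sup>+l. ennreal (2 * side_weight \<alpha> y * hitting_density t (l + (\<bar>y\<bar> + \<bar>x\<bar>)) * indicator {0..} l) * h l
        + ennreal (killed_heat t x y) * h 0 * indicator {- 1..<0} l \<partial>lborel)"
    by (intro nn_integral_cong) (auto simp: skew_density_def indicator_def)
  also have "\<dots> = (\<integral>\<^sup>+l. ennreal (2 * side_weight \<alpha> y * hitting_density t (l + (\<bar>y\<bar> + \<bar>x\<bar>)) * indicator {0..} l) * h l \<partial>lborel)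
      + (\<integral>\<^sup>+l. ennreal (killed_heat t x y) * h 0 * indicator {- 1..<0::real} l \<partial>lborel)"
    by (rule nn_integral_add) measurable
  also have "(\<integral>\<^sup>+l. ennreal (killed_heat t x y) * h 0 * indicator {- 1..<0::real} l \<partial>lborel) = ennreal (killed_heat t x y) * h 0"
    by (subst nn_integral_cmult_indicator) auto
  finally show ?thesis .
qed

lemma emeasure_skew_law:
  assumes C [measurable]: "C \<in> sets (borel \<Otimes>\<^sub>M borel)"
  shows "emeasure (skew_law t \<alpha> x) C =
    (\<integral>\<^sup>+y. (\<integral>\<^sup>+l. ennreal (2 * side_weight \<alpha> y * hitting_density t (l + (\<bar>y\<bar> + \<bar>x\<bar>)) * indicator {0..} l) * indicator C (y, l) \<partial>lborel) \<partial>lborel)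
    + (\<integral>\<^sup>+y. ennreal (killed_heat t x y) * indicator C (y, 0) \<partial>lborel)"
proof -
  have "emeasure (skew_law t \<alpha> x) C = (\<integral>\<^sup>+z. ennreal (skew_density t \<alpha> x (fst z) (snd z)) * indicator C (fst z, max 0 (snd z)) \<partial>(lborel \<Otimes>\<^sub>M lborel))"
  proof -
    have "emeasure (skew_law t \<alpha> x) C = (\<integral>\<^sup>+z. indicator C z \<partial>skew_law t \<alpha> x)"
      by (subst nn_integral_indicator) (auto simp: skew_law_def)
    also have "\<dots> = (\<integral>\<^sup>+z. indicator C (fst z, max 0 (snd z)) \<partial>density (lborel \<Otimes>\<^sub>M lborel) (\<lambda>z. ennreal (skew_density t \<alpha> x (fst z) (snd z))))"
      unfolding skew_law_def by (rule nn_integral_distr) measurable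
    also have "\<dots> = (\<integral>\<^sup>+z. ennreal (skew_density t \<alpha> x (fst z) (snd z)) * indicator C (fst z, max 0 (snd z)) \<partial>(lborel \<Otimes>\<^sub>M lborel))"
      by (rule nn_integral_density) measurable
    finally show ?thesis .
  qed
  also have "\<dots> = (\<integral>\<^sup>+y. (\<integral>\<^sup>+l. ennreal (skew_density t \<alpha> x y l) * indicator C (y, max 0 l) \<partial>lborel) \<partial>lborel)"
  proof -
    have "(\<lambda>z. ennreal (skew_density t \<alpha> x (fst z) (snd z)) * indicator C (fst z, max 0 (snd z))) \<in> borel_measurable (lborel \<Otimes>\<^sub>M lborel)"
      by measurable
    from lborel.nn_integral_fst[OF this] show ?thesis by simp
  qed
  also have "\<dots> = (\<integral>\<^sup>+y. (\<integral>\<^sup>+l. ennreal (2 * side_weight \<alpha> y * hitting_density t (l + (\<bar>y\<bar> + \<bar>x\<bar>)) * indicator {0..} l) * indicator C (y, l) \<partial>lborel)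
      + ennreal (killed_heat t x y) * indicator C (y, 0) \<partial>lborel)"
    by (intro nn_integral_cong nn_integral_skew_density_inner) measurable
  also have "\<dots> = (\<integral>\<^sup>+y. (\<integral>\<^sup>+l. ennreal (2 * side_weight \<alpha> y * hitting_density t (l + (\<bar>y\<bar> + \<bar>x\<bar>)) * indicator {0..} l) * indicator C (y, l) \<partial>lborel) \<partial>lborel)
      + (\<integral>\<^sup>+y. ennreal (killed_heat t x y) * indicator C (y, 0) \<partial>lborel)"
    by (rule nn_integral_add) measurable
  finally show ?thesis .
qed

text \<open>Integrating out l turns the hitting density into a heat kernel, and what is left in y is
  dominated by Gaussian densities.\<close>

lemma integrable_skew_density: "integrable (lborel \<Otimes>\<^sub>M lborel) (\<lambda>z. skew_density t \<alpha> x (fst z) (snd z))"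
proof (rule integrableI_nonneg)
  have "(\<integral>\<^sup>+z. ennreal (skew_density t \<alpha> x (fst z) (snd z)) \<partial>(lborel \<Otimes>\<^sub>M lborel))
      = (\<integral>\<^sup>+y. (\<integral>\<^sup>+l. ennreal (skew_density t \<alpha> x y l) \<partial>lborel) \<partial>lborel)"
  proof -
    have "(\<lambda>z. ennreal (skew_density t \<alpha> x (fst z) (snd z))) \<in> borel_measurable (lborel \<Otimes>\<^sub>M lborel)"
      by measurable
    from lborel.nn_integral_fst[OF this] show ?thesis by simp
  qed
  also have "\<dots> = (\<integral>\<^sup>+y. ennreal (2 * side_weight \<alpha> y * heat t (\<bar>y\<bar> + \<bar>x\<bar>) + killed_heat t x y) \<partial>lborel)"
  proof (rule nn_integral_cong)
    fix y
    have "(\<integral>\<^sup>+l. ennreal (skew_density t \<alpha> x y l) \<partial>lborel)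
        = (\<integral>\<^sup>+l. ennreal (2 * side_weight \<alpha> y) * ennreal (hitting_density t (l + (\<bar>y\<bar> + \<bar>x\<bar>)) * indicator {0..} l) \<partial>lborel) + ennreal (killed_heat t x y)"
      using nn_integral_skew_density_inner[of "\<lambda>_. 1" y] side_weight_bounds(1)[of y]
      by (simp add: ennreal_mult' mult.assoc)
    also have "(\<integral>\<^sup>+l. ennreal (2 * side_weight \<alpha> y) * ennreal (hitting_density t (l + (\<bar>y\<bar> + \<bar>x\<bar>)) * indicator {0..} l) \<partial>lborel)
        = ennreal (2 * side_weight \<alpha> y) * ennreal (heat t (\<bar>y\<bar> + \<bar>x\<bar>))"
      using hitting_density_integral(1)[OF t, of "\<bar>y\<bar> + \<bar>x\<bar>"] by (subst nn_integral_cmult) auto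
    finally show "(\<integral>\<^sup>+l. ennreal (skew_density t \<alpha> x y l) \<partial>lborel) = ennreal (2 * side_weight \<alpha> y * heat t (\<bar>y\<bar> + \<bar>x\<bar>) + killed_heat t x y)"
      using side_weight_bounds(1)[of y] heat_nonneg[OF t] killed_heat_bounds(1)[of y]
      by (simp add: ennreal_mult'[symmetric] ennreal_plus[symmetric] del: ennreal_plus)
  qed
  also have "\<dots> \<le> (\<integral>\<^sup>+y. ennreal (2 * heat t (y - 0) + heat t (y - x)) \<partial>lborel)"
  proof (intro nn_integral_mono ennreal_leI add_mono killed_heat_bounds(2))
    fix y
    have "side_weight \<alpha> y * heat t (\<bar>y\<bar> + \<bar>x\<bar>) \<le> 1 * heat t (y - 0)"
      using side_weight_bounds[of y] heat_nonneg[OF t] by (intro mult_mono heat_antimono[OF t]) auto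
    then show "2 * side_weight \<alpha> y * heat t (\<bar>y\<bar> + \<bar>x\<bar>) \<le> 2 * heat t (y - 0)" by simp
  qed
  also have "\<dots> < \<infinity>"
  proof -
    have "integrable lborel (\<lambda>y. 2 * heat t (y - 0) + heat t (y - x))"
      using heat_integrable[OF t] by (intro Bochner_Integration.integrable_add integrable_mult_right)
    then show ?thesis using heat_nonneg[OF t] by (subst nn_integral_eq_integral) auto
  qed
  finally show "(\<integral>\<^sup>+z. ennreal (skew_density t \<alpha> x (fst z) (snd z)) \<partial>(lborel \<Otimes>\<^sub>M lborel)) < \<infinity>" .
  show "(\<lambda>z. skew_density t \<alpha> x (fst z) (snd z)) \<in> borel_measurable (lborel \<Otimes>\<^sub>M lborel)" by measurable
qed (auto intro!: AE_I2 simp: skew_density_nonneg)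

lemma skew_law_finite: "finite_measure (skew_law t \<alpha> x)"
proof -
  have "finite_measure (density (lborel \<Otimes>\<^sub>M lborel) (\<lambda>z. ennreal (skew_density t \<alpha> x (fst z) (snd z))))"
  proof (rule finite_measureI)
    have "emeasure (density (lborel \<Otimes>\<^sub>M lborel) (\<lambda>z. ennreal (skew_density t \<alpha> x (fst z) (snd z)))) (space (lborel \<Otimes>\<^sub>M lborel))
        = (\<integral>\<^sup>+z. ennreal (skew_density t \<alpha> x (fst z) (snd z)) \<partial>(lborel \<Otimes>\<^sub>M lborel))"
    proof -
      have "(\<lambda>z. ennreal (skew_density t \<alpha> x (fst z) (snd z))) \<in> borel_measurable (lborel \<Otimes>\<^sub>M lborel)"
        by measurable
      from emeasure_density[OF this sets.top] show ?thesis by (simp cong: nn_integral_cong)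
    qed
    also have "\<dots> < \<infinity>"
      using integrable_skew_density skew_density_nonneg by (subst nn_integral_eq_integral) (auto intro!: AE_I2)
    finally show "emeasure (density (lborel \<Otimes>\<^sub>M lborel) (\<lambda>z. ennreal (skew_density t \<alpha> x (fst z) (snd z))))
        (space (density (lborel \<Otimes>\<^sub>M lborel) (\<lambda>z. ennreal (skew_density t \<alpha> x (fst z) (snd z))))) \<noteq> \<infinity>" by simp
  qed
  then show ?thesis unfolding skew_law_def by (rule finite_measure.finite_measure_distr) measurable
qed

lemma skew_law_AE: "AE (y, l) in skew_law t \<alpha> x. 0 \<le> l"
proof -
  have m: "(\<lambda>z. (fst z, max 0 (snd z))) \<in> density (lborel \<Otimes>\<^sub>M lborel) (\<lambda>z. ennreal (skew_density t \<alpha> x (fst z) (snd z))) \<rightarrow>\<^sub>M borel \<Otimes>\<^sub>M borel"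
    by measurable
  have s: "{z \<in> space (borel \<Otimes>\<^sub>M borel). 0 \<le> snd z} \<in> sets (borel \<Otimes>\<^sub>M (borel :: real measure))" by measurable
  show ?thesis unfolding skew_law_def split_beta' AE_distr_iff[OF m s] by simp
qed

lemma skew_law_integral:
  assumes \<theta>: "0 < \<theta>" and w [measurable]: "w \<in> borel_measurable borel" and wC: "\<And>y. \<bar>w y\<bar> \<le> C"
  shows "(\<integral>(y, l). exp (- \<theta> * l) * w y \<partial>skew_law t \<alpha> x)
      = (LBINT y. (2 * side_weight \<alpha> y * laplace_hitting t \<theta> (\<bar>y\<bar> + \<bar>x\<bar>) + killed_heat t x y) * w y)" (is ?eq)
    and "integrable lborel (\<lambda>y. (2 * side_weight \<alpha> y * laplace_hitting t \<theta> (\<bar>y\<bar> + \<bar>x\<bar>) + killed_heat t x y) * w y)" (is ?int)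
proof -
  let ?f = "\<lambda>y l. skew_density t \<alpha> x y l * (exp (- \<theta> * max 0 l) * w y)"
  have int: "integrable (lborel \<Otimes>\<^sub>M lborel) (\<lambda>z. ?f (fst z) (snd z))"
  proof (rule Bochner_Integration.integrable_bound)
    show "integrable (lborel \<Otimes>\<^sub>M lborel) (\<lambda>z. C * skew_density t \<alpha> x (fst z) (snd z))"
      using integrable_skew_density by (rule integrable_mult_right)
    show "(\<lambda>z. ?f (fst z) (snd z)) \<in> borel_measurable (lborel \<Otimes>\<^sub>M lborel)" by measurable
    have "norm (?f y l) \<le> norm (C * skew_density t \<alpha> x y l)" for y l
    proof -
      have "\<bar>exp (- \<theta> * max 0 l)\<bar> * \<bar>w y\<bar> \<le> 1 * C" using wC \<theta> by (intro mult_mono) auto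
      then have "skew_density t \<alpha> x y l * (\<bar>exp (- \<theta> * max 0 l)\<bar> * \<bar>w y\<bar>) \<le> skew_density t \<alpha> x y l * C"
        using skew_density_nonneg by (intro mult_left_mono) auto
      also have "\<dots> \<le> \<bar>C * skew_density t \<alpha> x y l\<bar>" by (simp add: mult.commute)
      finally show ?thesis using skew_density_nonneg[of y l] by (simp add: abs_mult)
    qed
    then show "AE z in lborel \<Otimes>\<^sub>M lborel. norm (?f (fst z) (snd z)) \<le> norm (C * skew_density t \<alpha> x (fst z) (snd z))"
      by (intro AE_I2)
  qed
  have inner: "(LBINT l. ?f y l) = (2 * side_weight \<alpha> y * laplace_hitting t \<theta> (\<bar>y\<bar> + \<bar>x\<bar>) + killed_heat t x y) * w y" for y
  proof -
    let ?a = "2 * side_weight \<alpha> y * w y"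
    have i1: "integrable lborel (\<lambda>l. indicator {0..} l * (exp (- \<theta> * l) * hitting_density t (l + (\<bar>y\<bar> + \<bar>x\<bar>))))"
      using laplace_hitting_integrable(1)[OF t _ \<theta>, of "\<bar>y\<bar> + \<bar>x\<bar>"] by (simp add: set_integrable_def)
    have i2: "integrable lborel (\<lambda>l. indicator {- 1..<0::real} l :: real)" by simp
    have "(LBINT l. ?f y l) = (LBINT l. ?a * (indicator {0..} l * (exp (- \<theta> * l) * hitting_density t (l + (\<bar>y\<bar> + \<bar>x\<bar>))))
        + killed_heat t x y * w y * indicator {- 1..<0::real} l)"
      by (intro Bochner_Integration.integral_cong refl) (auto simp: skew_density_def indicator_def)
    also have "\<dots> = ?a * (LBINT l. indicator {0..} l * (exp (- \<theta> * l) * hitting_density t (l + (\<bar>y\<bar> + \<bar>x\<bar>))))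
        + killed_heat t x y * w y * (LBINT l. indicator {- 1..<0::real} l)"
      using integrable_mult_right[OF i1, of ?a] integrable_mult_right[OF i2, of "killed_heat t x y * w y"]
      by (subst Bochner_Integration.integral_add) auto
    also have "(LBINT l. indicator {- 1..<0::real} l :: real) = 1" by simp
    finally show ?thesis by (simp add: laplace_hitting_def set_lebesgue_integral_def algebra_simps)
  qed
  have "(\<integral>(y, l). exp (- \<theta> * l) * w y \<partial>skew_law t \<alpha> x)
      = (\<integral>z. exp (- \<theta> * max 0 (snd z)) * w (fst z)
          \<partial>density (lborel \<Otimes>\<^sub>M lborel) (\<lambda>z. ennreal (skew_density t \<alpha> x (fst z) (snd z))))"
  proof -
    have m: "(\<lambda>z. (fst z, max 0 (snd z))) \<in> density (lborel \<Otimes>\<^sub>M lborel) (\<lambda>z. ennreal (skew_density t \<alpha> x (fst z) (snd z))) \<rightarrow>\<^sub>M borel \<Otimes>\<^sub>M borel"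
      by measurable
    have m': "(\<lambda>z. exp (- \<theta> * snd z) * w (fst z)) \<in> borel_measurable (borel \<Otimes>\<^sub>M borel)" by measurable
    show ?thesis unfolding skew_law_def split_beta' integral_distr[OF m m'] by simp
  qed
  also have "\<dots> = (\<integral>z. ?f (fst z) (snd z) \<partial>(lborel \<Otimes>\<^sub>M lborel))"
  proof -
    have m: "(\<lambda>z. exp (- \<theta> * max 0 (snd z)) * w (fst z)) \<in> borel_measurable (lborel \<Otimes>\<^sub>M lborel)" by measurable
    have m': "(\<lambda>z. skew_density t \<alpha> x (fst z) (snd z)) \<in> borel_measurable (lborel \<Otimes>\<^sub>M lborel)" by measurable
    show ?thesis using integral_density[OF m m'] skew_density_nonneg by simp
  qed
  also have "\<dots> = (LBINT y. (LBINT l. ?f y l))"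
    using lborel_pair.integral_fst'[OF int] by simp
  finally show ?eq unfolding inner .
  show ?int using lborel_pair.integrable_fst'[OF int] unfolding inner[symmetric] by simp
qed

text \<open>Folding the full-line transform of the heat kernel centred at |x| turns the left half
  into the image term \<open>heat t (y + \<bar>x\<bar>)\<close>, with a minus sign for the sine and
  a plus sign for the cosine.\<close>

lemma heat_half_line_fourier:
  shows "set_integrable lborel {0..} (\<lambda>y. heat t (y - \<bar>x\<bar>) * sin (k * y))" "set_integrable lborel {0..} (\<lambda>y. heat t (y + \<bar>x\<bar>) * sin (k * y))"
    "set_integrable lborel {0..} (\<lambda>y. heat t (y - \<bar>x\<bar>) * cos (k * y))" "set_integrable lborel {0..} (\<lambda>y. heat t (y + \<bar>x\<bar>) * cos (k * y))"
    "(LBINT y:{0..}. heat t (y - \<bar>x\<bar>) * sin (k * y)) - (LBINT y:{0..}. heat t (y + \<bar>x\<bar>) * sin (k * y)) = exp (- (k\<^sup>2 * t / 2)) * sin (k * \<bar>x\<bar>)"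
    "(LBINT y:{0..}. heat t (y - \<bar>x\<bar>) * cos (k * y)) + (LBINT y:{0..}. heat t (y + \<bar>x\<bar>) * cos (k * y)) = exp (- (k\<^sup>2 * t / 2)) * cos (k * \<bar>x\<bar>)"
proof -
  have h: "integrable lborel (\<lambda>y. heat t (y - \<bar>x\<bar>))" "integrable lborel (\<lambda>y. heat t (y + \<bar>x\<bar>))"
    using heat_integrable[OF t, of "\<bar>x\<bar>"] heat_integrable[OF t, of "- \<bar>x\<bar>"] by simp_all
  have si: "set_integrable lborel {0..} (\<lambda>y. f y * w y)" if "integrable lborel f" "w \<in> borel_measurable borel" "\<And>y. \<bar>w y\<bar> \<le> 1"
    for f w :: "real \<Rightarrow> real"
    unfolding set_integrable_def using integrable_mult_bounded[OF that(1), of "\<lambda>y. indicator {0..} y * w y" 1] that(2,3)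
    by (simp add: indicator_def mult_ac)
  show i: "set_integrable lborel {0..} (\<lambda>y. heat t (y - \<bar>x\<bar>) * sin (k * y))" "set_integrable lborel {0..} (\<lambda>y. heat t (y + \<bar>x\<bar>) * sin (k * y))"
    "set_integrable lborel {0..} (\<lambda>y. heat t (y - \<bar>x\<bar>) * cos (k * y))" "set_integrable lborel {0..} (\<lambda>y. heat t (y + \<bar>x\<bar>) * cos (k * y))"
    by (intro si h; simp)+
  have r: "heat t (- y - \<bar>x\<bar>) = heat t (y + \<bar>x\<bar>)" for y using heat_minus[of t "y + \<bar>x\<bar>"] by simp
  have i': "integrable lborel (\<lambda>y. heat t (y - \<bar>x\<bar>) * sin (k * y))" "integrable lborel (\<lambda>y. heat t (y - \<bar>x\<bar>) * cos (k * y))"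
    by (rule integrable_mult_bounded[OF h(1), where C = 1]; simp)+
  show "(LBINT y:{0..}. heat t (y - \<bar>x\<bar>) * sin (k * y)) - (LBINT y:{0..}. heat t (y + \<bar>x\<bar>) * sin (k * y)) = exp (- (k\<^sup>2 * t / 2)) * sin (k * \<bar>x\<bar>)"
    using integral_fold_half_line(1)[OF i'(1)] heat_fourier(2)[OF t, of "\<bar>x\<bar>" k] set_integral_diff(2)[OF i(1,2)] by (simp add: r)
  show "(LBINT y:{0..}. heat t (y - \<bar>x\<bar>) * cos (k * y)) + (LBINT y:{0..}. heat t (y + \<bar>x\<bar>) * cos (k * y)) = exp (- (k\<^sup>2 * t / 2)) * cos (k * \<bar>x\<bar>)"
    using integral_fold_half_line(1)[OF i'(2)] heat_fourier(1)[OF t, of "\<bar>x\<bar>" k] set_integral_add(2)[OF i(3,4)] by (simp add: r)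
qed

text \<open>Fold y onto the half line. The killed part supplies heat terms with the image
  subtracted, right for the sine but not for the cosine; the Robin transform of the hitting part
  equals k times the cosine integral of the image, and twice this amount corrects the sign.\<close>

lemma skew_law_robin_transform:
  assumes \<theta>: "0 < \<theta>"
  shows "(\<integral>(y, l). exp (- \<theta> * l) * (\<theta> * sin (k * \<bar>y\<bar>) + k * cos (k * \<bar>y\<bar>)) \<partial>skew_law t \<alpha> x)
      = exp (- (k\<^sup>2 * t / 2)) * (\<theta> * sin (k * \<bar>x\<bar>) + k * cos (k * \<bar>x\<bar>))" (is ?even)
    and "(\<integral>(y, l). exp (- \<theta> * l) * (\<theta> * sin (k * y) + (2 * \<alpha> - 1) * k * cos (k * y)) \<partial>skew_law t \<alpha> x)
      = exp (- (k\<^sup>2 * t / 2)) * (\<theta> * sin (k * x) + (2 * \<alpha> - 1) * k * cos (k * x))" (is ?skew)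
proof -
  let ?c = "\<bar>x\<bar>" and ?\<gamma> = "2 * \<alpha> - 1" and ?e = "exp (- (k\<^sup>2 * t / 2))"
  define H where "H y = laplace_hitting t \<theta> (y + ?c)" for y
  \<comment> \<open>The sign of x: the killed part lives on the side of x, so its odd part changes
    sign with x.\<close>
  define s where "s = (if 0 \<le> x then 1 else - 1 :: real)"
  define D where "D y = heat t (y - ?c) - heat t (y + ?c)" for y
  define R where "R y = \<theta> * sin (k * y) + k * cos (k * y)" for y
  have s: "s * ?c = x" by (simp add: s_def)
  have trig: "\<bar>p * sin (k * y) + q * cos (k * y)\<bar> \<le> \<bar>p\<bar> + \<bar>q\<bar>" for p q y
    using abs_sin_cos_comb[of q "\<bar>q\<bar>" p "\<bar>p\<bar>" "k * y"] by (simp add: add.commute)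
  have kh: "killed_heat t x y + killed_heat t x (- y) = D y" "killed_heat t x y - killed_heat t x (- y) = s * D y" if y: "0 < y" for y
  proof -
    have "killed_heat t x y = (if 0 \<le> x then D y else 0) \<and> killed_heat t x (- y) = (if 0 \<le> x then 0 else D y)"
      using killed_heat_cases[OF t, of x y] killed_heat_cases[OF t, of x "- y"] y
      by (auto simp: D_def mult_le_0_iff zero_le_mult_iff)
    then show "killed_heat t x y + killed_heat t x (- y) = D y" "killed_heat t x y - killed_heat t x (- y) = s * D y"
      by (auto simp: s_def)
  qed
  have HR: "(LBINT y:{0..}. H y * R y) = k * (LBINT y:{0..}. heat t (y + ?c) * cos (k * y))"
    unfolding H_def R_def by (rule laplace_hitting_robin_transform(1)[OF t _ \<theta>]) simp
  have HRi: "set_integrable lborel {0..} (\<lambda>y. H y * R y)"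
  proof -
    have i: "integrable lborel (\<lambda>y. H y * indicator {0..} y)"
      using laplace_hitting_robin_transform(2)[OF t _ \<theta>, of ?c] by (simp add: set_integrable_def H_def mult.commute)
    have Rm: "R \<in> borel_measurable borel" unfolding R_def by measurable
    have "integrable lborel (\<lambda>y. (H y * indicator {0..} y) * R y)"
      by (rule integrable_mult_bounded[OF i Rm, where C = "\<bar>\<theta>\<bar> + \<bar>k\<bar>"]) (unfold R_def, rule trig)
    then show ?thesis by (simp add: set_integrable_def mult_ac)
  qed
  note F = heat_half_line_fourier[of k]
  have Dsin: "set_integrable lborel {0..} (\<lambda>y. D y * sin (k * y))" "(LBINT y:{0..}. D y * sin (k * y)) = ?e * sin (k * ?c)"
    using set_integral_diff[OF F(1,2)] F(5) by (simp_all add: D_def left_diff_distrib)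
  have Dcos: "set_integrable lborel {0..} (\<lambda>y. D y * cos (k * y))"
    "(LBINT y:{0..}. D y * cos (k * y)) + 2 * (LBINT y:{0..}. heat t (y + ?c) * cos (k * y)) = ?e * cos (k * ?c)"
    using set_integral_diff[OF F(3,4)] F(6) by (simp_all add: D_def left_diff_distrib)
  \<comment> \<open>Common to both test functions w. Their averages over the two sides with weights
    \<alpha> and 1 - \<alpha> are both multiples of R: A is 1 for the even function and 2 \<alpha> -
    1 for the smooth one.\<close>
  have fold: "(LBINT y. (2 * side_weight \<alpha> y * laplace_hitting t \<theta> (\<bar>y\<bar> + ?c) + killed_heat t x y) * w y)
      = 2 * A * (LBINT y:{0..}. H y * R y) + p * (LBINT y:{0..}. D y * sin (k * y)) + q * (LBINT y:{0..}. D y * cos (k * y))"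
    if i: "integrable lborel (\<lambda>y. (2 * side_weight \<alpha> y * laplace_hitting t \<theta> (\<bar>y\<bar> + ?c) + killed_heat t x y) * w y)"
      and w: "\<And>y. 0 < y \<Longrightarrow> \<alpha> * w y + (1 - \<alpha>) * w (- y) = A * R y"
      and d: "\<And>y. 0 < y \<Longrightarrow> killed_heat t x y * w y + killed_heat t x (- y) * w (- y) = p * (D y * sin (k * y)) + q * (D y * cos (k * y))"
    for w :: "real \<Rightarrow> real" and A p q
  proof -
    let ?g = "\<lambda>y. (2 * side_weight \<alpha> y * laplace_hitting t \<theta> (\<bar>y\<bar> + ?c) + killed_heat t x y) * w y"
    let ?f = "\<lambda>y. 2 * A * (H y * R y) + (p * (D y * sin (k * y)) + q * (D y * cos (k * y)))"
    have pt: "?g y + ?g (- y) = ?f y" if y: "0 < y" for y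
    proof -
      have "?g y + ?g (- y) = 2 * H y * (\<alpha> * w y + (1 - \<alpha>) * w (- y)) + (killed_heat t x y * w y + killed_heat t x (- y) * w (- y))"
        using y by (simp add: side_weight_def H_def algebra_simps)
      then show ?thesis unfolding w[OF y] d[OF y] by simp
    qed
    have fi: "set_integrable lborel {0..} ?f"
      using HRi Dsin(1) Dcos(1) by (intro set_integral_add set_integrable_mult_right) auto
    have "(LBINT y. ?g y) = (LBINT y:{0..}. ?g y + ?g (- y))" by (rule integral_fold_half_line(1)[OF i])
    also have "\<dots> = (LBINT y:{0..}. ?f y)"
      unfolding set_lebesgue_integral_def
    proof (rule integral_cong_AE)
      show "(\<lambda>y. indicator {0..} y *\<^sub>R (?g y + ?g (- y))) \<in> borel_measurable lborel"
        using integral_fold_half_line(2)[OF i] unfolding set_integrable_def by (rule borel_measurable_integrable)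
      show "(\<lambda>y. indicator {0..} y *\<^sub>R ?f y) \<in> borel_measurable lborel"
        using fi unfolding set_integrable_def by (rule borel_measurable_integrable)
      show "AE y in lborel. indicator {0..} y *\<^sub>R (?g y + ?g (- y)) = indicator {0..} y *\<^sub>R ?f y"
        using AE_lborel_singleton[of "0::real"]
      proof eventually_elim
        case (elim y)
        then show ?case using pt[of y] by (cases "0 < y") (auto simp: indicator_def)
      qed
    qed
    also have "\<dots> = 2 * A * (LBINT y:{0..}. H y * R y) + p * (LBINT y:{0..}. D y * sin (k * y)) + q * (LBINT y:{0..}. D y * cos (k * y))"
      using HRi Dsin(1) Dcos(1)
      by (simp add: set_integral_add set_integrable_mult_right set_integral_mult_right)
    finally show ?thesis .
  qed
  have "(\<integral>(y, l). exp (- \<theta> * l) * (\<theta> * sin (k * \<bar>y\<bar>) + k * cos (k * \<bar>y\<bar>)) \<partial>skew_law t \<alpha> x)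
      = 2 * 1 * (LBINT y:{0..}. H y * R y) + \<theta> * (LBINT y:{0..}. D y * sin (k * y)) + k * (LBINT y:{0..}. D y * cos (k * y))"
  proof (subst skew_law_integral(1)[OF \<theta>, of _ "\<bar>\<theta>\<bar> + \<bar>k\<bar>"])
    show "(LBINT y. (2 * side_weight \<alpha> y * laplace_hitting t \<theta> (\<bar>y\<bar> + ?c) + killed_heat t x y) * (\<theta> * sin (k * \<bar>y\<bar>) + k * cos (k * \<bar>y\<bar>)))
        = 2 * 1 * (LBINT y:{0..}. H y * R y) + \<theta> * (LBINT y:{0..}. D y * sin (k * y)) + k * (LBINT y:{0..}. D y * cos (k * y))"
    proof (rule fold)
      show "integrable lborel (\<lambda>y. (2 * side_weight \<alpha> y * laplace_hitting t \<theta> (\<bar>y\<bar> + ?c) + killed_heat t x y) * (\<theta> * sin (k * \<bar>y\<bar>) + k * cos (k * \<bar>y\<bar>)))"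
        by (rule skew_law_integral(2)[OF \<theta> _ trig]) measurable
      fix y :: real assume y: "0 < y"
      then show "\<alpha> * (\<theta> * sin (k * \<bar>y\<bar>) + k * cos (k * \<bar>y\<bar>)) + (1 - \<alpha>) * (\<theta> * sin (k * \<bar>- y\<bar>) + k * cos (k * \<bar>- y\<bar>)) = 1 * R y"
        by (simp add: R_def algebra_simps)
      have "killed_heat t x y * (\<theta> * sin (k * \<bar>y\<bar>) + k * cos (k * \<bar>y\<bar>)) + killed_heat t x (- y) * (\<theta> * sin (k * \<bar>- y\<bar>) + k * cos (k * \<bar>- y\<bar>))
          = (killed_heat t x y + killed_heat t x (- y)) * (\<theta> * sin (k * y) + k * cos (k * y))"
        using y by (simp add: algebra_simps)
      then show "killed_heat t x y * (\<theta> * sin (k * \<bar>y\<bar>) + k * cos (k * \<bar>y\<bar>)) + killed_heat t x (- y) * (\<theta> * sin (k * \<bar>- y\<bar>) + k * cos (k * \<bar>- y\<bar>))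
          = \<theta> * (D y * sin (k * y)) + k * (D y * cos (k * y))"
        unfolding kh(1)[OF y] by (simp add: algebra_simps)
    qed
  qed (use trig in auto)
  \<comment> \<open>The hitting part enters as twice the cosine integral of the image, which turns
    the difference D into the sum required by \<open>Dcos(2)\<close>.\<close>
  also have "\<dots> = \<theta> * (LBINT y:{0..}. D y * sin (k * y)) + k * ((LBINT y:{0..}. D y * cos (k * y)) + 2 * (LBINT y:{0..}. heat t (y + ?c) * cos (k * y)))"
    unfolding HR by (simp add: algebra_simps)
  also have "\<dots> = ?e * (\<theta> * sin (k * ?c) + k * cos (k * ?c))"
    unfolding Dsin(2) Dcos(2) by (simp add: algebra_simps)
  finally show ?even .
  have "(\<integral>(y, l). exp (- \<theta> * l) * (\<theta> * sin (k * y) + ?\<gamma> * k * cos (k * y)) \<partial>skew_law t \<alpha> x)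
      = 2 * ?\<gamma> * (LBINT y:{0..}. H y * R y) + \<theta> * s * (LBINT y:{0..}. D y * sin (k * y)) + ?\<gamma> * k * (LBINT y:{0..}. D y * cos (k * y))"
  proof (subst skew_law_integral(1)[OF \<theta>, of _ "\<bar>\<theta>\<bar> + \<bar>?\<gamma> * k\<bar>"])
    show "(LBINT y. (2 * side_weight \<alpha> y * laplace_hitting t \<theta> (\<bar>y\<bar> + ?c) + killed_heat t x y) * (\<theta> * sin (k * y) + ?\<gamma> * k * cos (k * y)))
        = 2 * ?\<gamma> * (LBINT y:{0..}. H y * R y) + \<theta> * s * (LBINT y:{0..}. D y * sin (k * y)) + ?\<gamma> * k * (LBINT y:{0..}. D y * cos (k * y))"
    proof (rule fold)
      show "integrable lborel (\<lambda>y. (2 * side_weight \<alpha> y * laplace_hitting t \<theta> (\<bar>y\<bar> + ?c) + killed_heat t x y) * (\<theta> * sin (k * y) + ?\<gamma> * k * cos (k * y)))"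
        by (rule skew_law_integral(2)[OF \<theta> _ trig]) measurable
      fix y :: real assume y: "0 < y"
      show "\<alpha> * (\<theta> * sin (k * y) + ?\<gamma> * k * cos (k * y)) + (1 - \<alpha>) * (\<theta> * sin (k * - y) + ?\<gamma> * k * cos (k * - y)) = ?\<gamma> * R y"
        by (simp add: R_def algebra_simps)
      have "killed_heat t x y * (\<theta> * sin (k * y) + ?\<gamma> * k * cos (k * y)) + killed_heat t x (- y) * (\<theta> * sin (k * - y) + ?\<gamma> * k * cos (k * - y))
          = (killed_heat t x y - killed_heat t x (- y)) * (\<theta> * sin (k * y)) + (killed_heat t x y + killed_heat t x (- y)) * (?\<gamma> * k * cos (k * y))"
        by (simp add: algebra_simps)
      then show "killed_heat t x y * (\<theta> * sin (k * y) + ?\<gamma> * k * cos (k * y)) + killed_heat t x (- y) * (\<theta> * sin (k * - y) + ?\<gamma> * k * cos (k * - y))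
          = \<theta> * s * (D y * sin (k * y)) + ?\<gamma> * k * (D y * cos (k * y))"
        unfolding kh[OF y] by (simp add: algebra_simps)
    qed
  qed (use trig in auto)
  also have "\<dots> = \<theta> * (s * (LBINT y:{0..}. D y * sin (k * y))) + ?\<gamma> * k * ((LBINT y:{0..}. D y * cos (k * y)) + 2 * (LBINT y:{0..}. heat t (y + ?c) * cos (k * y)))"
    unfolding HR by (simp add: algebra_simps)
  also have "\<dots> = ?e * (\<theta> * (s * sin (k * ?c)) + ?\<gamma> * k * cos (k * ?c))"
    unfolding Dsin(2) Dcos(2) by (simp add: algebra_simps)
  also have "s * sin (k * ?c) = sin (k * x)" by (auto simp: s_def)
  also have "cos (k * ?c) = cos (k * x)" by (cases "0 \<le> x") auto
  finally show ?skew .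
qed

end

text \<open>Process and candidate satisfy the same two identities, with the same right-hand sides,
  for all \<theta> > 0 and all k.\<close>

lemma (in skew_continuous) joint_law_eq_skew_law:
  assumes "0 < t" "0 < \<alpha>" "\<alpha> < 1"
  shows "distr M (borel \<Otimes>\<^sub>M borel) (\<lambda>\<omega>. (B t \<omega>, L t \<omega>)) = skew_law t \<alpha> x" (is "?D = _")
proof (rule joint_robin_transform_unique)
  have [measurable]: "random_variable borel (L t)" "random_variable borel (B t)"
    using assms by (auto intro: local_time_measurable B_measurable)
  have BL: "(\<lambda>\<omega>. (B t \<omega>, L t \<omega>)) \<in> M \<rightarrow>\<^sub>M borel \<Otimes>\<^sub>M borel" by measurable
  show "finite_measure ?D" by (rule finite_measure_distr[OF BL])
  show "sets ?D = sets (borel \<Otimes>\<^sub>M borel)" by simp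
  show "AE (y, l) in ?D. 0 \<le> l" 
  proof -
    have "{z \<in> space (borel \<Otimes>\<^sub>M borel). 0 \<le> snd z} \<in> sets (borel \<Otimes>\<^sub>M (borel :: real measure))" by measurable
    from AE_distr_iff[OF BL this] show ?thesis by (simp add: split_beta' L_nonneg)
  qed
  show "finite_measure (skew_law t \<alpha> x)" by (rule skew_law_finite[OF assms])
  show "sets (skew_law t \<alpha> x) = sets (borel \<Otimes>\<^sub>M borel)" by (simp add: skew_law_def)
  show "AE (y, l) in skew_law t \<alpha> x. 0 \<le> l" by (rule skew_law_AE[OF assms])
  fix \<theta> k :: real assume \<theta>: "0 < \<theta>"
  show "(\<integral>(y, l). exp (- \<theta> * l) * (\<theta> * sin (k * \<bar>y\<bar>) + k * cos (k * \<bar>y\<bar>)) \<partial>?D)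
      = (\<integral>(y, l). exp (- \<theta> * l) * (\<theta> * sin (k * \<bar>y\<bar>) + k * cos (k * \<bar>y\<bar>)) \<partial>skew_law t \<alpha> x)"
  proof -
    have "(\<lambda>z. exp (- \<theta> * snd z) * (\<theta> * sin (k * \<bar>fst z\<bar>) + k * cos (k * \<bar>fst z\<bar>))) \<in> borel_measurable (borel \<Otimes>\<^sub>M borel)" by measurable
    from integral_distr[OF BL this] show ?thesis
      using skew_law_robin_transform(1)[OF assms \<theta>, of x k] robin_identity[OF assms(1) \<theta>, of k] by (simp add: split_beta')
  qed
  show "(\<integral>(y, l). exp (- \<theta> * l) * (\<theta> * sin (k * y) + \<gamma> * k * cos (k * y)) \<partial>?D)
      = (\<integral>(y, l). exp (- \<theta> * l) * (\<theta> * sin (k * y) + \<gamma> * k * cos (k * y)) \<partial>skew_law t \<alpha> x)"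
  proof -
    have "(\<lambda>z. exp (- \<theta> * snd z) * (\<theta> * sin (k * fst z) + \<gamma> * k * cos (k * fst z))) \<in> borel_measurable (borel \<Otimes>\<^sub>M borel)" by measurable
    from integral_distr[OF BL this] show ?thesis
      using skew_law_robin_transform(2)[OF assms \<theta>, of x k] skew_identity[OF assms(1) \<theta>, of k] by (simp add: split_beta')
  qed
qed

text \<open>Path properties are repaired on one measurable null set, which belongs to the filtration
  at every time, so adaptedness survives. Truncating L at 0 changes nothing almost surely for t
  \<ge> 0, and it also covers negative times, where L is unconstrained.\<close>

lemma skew_continuous_modification:
  assumes "skew_brownian_motion M W \<alpha> x B L"
  obtains B' L' where "skew_continuous M W \<alpha> x B' L'"
    "\<And>t. 0 \<le> t \<Longrightarrow> AE \<omega> in M. B' t \<omega> = B t \<omega>" "\<And>t. 0 \<le> t \<Longrightarrow> AE \<omega> in M. L' t \<omega> = L t \<omega>"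
proof -
  interpret skew_brownian_motion M W \<alpha> x B L by fact
  let ?good = "\<lambda>\<omega>. continuous_on {0..} (\<lambda>s. B s \<omega>) \<and> is_symmetric_local_time (\<lambda>s. B s \<omega>) (\<lambda>s. L s \<omega>)"
  have "AE \<omega> in M. ?good \<omega>" using B_continuous local_time by eventually_elim simp
  then obtain N where "{\<omega> \<in> space M. \<not> ?good \<omega>} \<subseteq> N" "emeasure M N = 0" "N \<in> sets M"
    by (rule AE_E)
  then have N: "N \<in> null_sets M" "{\<omega> \<in> space M. \<not> ?good \<omega>} \<subseteq> N" by auto
  define B' where "B' t \<omega> = (if \<omega> \<in> N then 0 else B t \<omega>)" for t \<omega>
  define L' where "L' t \<omega> = max 0 (L t \<omega>)" for t \<omega>
  have notN: "AE \<omega> in M. \<omega> \<notin> N" using N(1) by (rule AE_not_in)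
  have B'B: "AE \<omega> in M. \<forall>t. B' t \<omega> = B t \<omega>" using notN by eventually_elim (simp add: B'_def)
  have L'L: "AE \<omega> in M. \<forall>t\<ge>0. L' t \<omega> = L t \<omega>"
    using \<open>AE \<omega> in M. ?good \<omega>\<close>
  proof eventually_elim
    case (elim \<omega>)
    then have "0 \<le> L t \<omega>" if "0 \<le> t" for t
      using local_time_mono[of "\<lambda>s. B s \<omega>" "\<lambda>s. L s \<omega>" 0 t] local_time_0[of "\<lambda>s. B s \<omega>" "\<lambda>s. L s \<omega>"] that by auto
    then show ?case by (simp add: L'_def)
  qed
  have "skew_continuous M W \<alpha> x B' L'"
  proof (unfold_locales)
    show "B' t \<in> borel_measurable (completed_natural_filtration M W t)" if "0 \<le> t" for t
    proof -
      have "N \<inter> space M = N" using sets.sets_into_space[OF null_setsD2[OF N(1)]] by blast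
      then show ?thesis
        unfolding B'_def using B_adapted[OF that] null_sets_filtration[OF N(1), of t]
        by (intro measurable_If_set) auto
    qed
    show "continuous_on {0..} (\<lambda>s. B' s \<omega>)" if "\<omega> \<in> space M" for \<omega>
      unfolding B'_def using N(2) that by (cases "\<omega> \<in> N") auto
    then show "AE \<omega> in M. continuous_on {0..} (\<lambda>s. B' s \<omega>)" by (rule AE_I2)
    show "random_variable borel (L' t)" if "0 \<le> t" for t
      unfolding L'_def using local_time_measurable[OF that] by measurable
    show "AE \<omega> in M. is_symmetric_local_time (\<lambda>s. B' s \<omega>) (\<lambda>s. L' s \<omega>)"
      using local_time B'B L'L by eventually_elim (simp add: is_symmetric_local_time_def)
    show "AE \<omega> in M. \<forall>t\<ge>0. B' t \<omega> = x + W t \<omega> + (2 * \<alpha> - 1) * L' t \<omega>"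
      using skew_equation B'B L'L by eventually_elim simp
    show "0 \<le> L' t \<omega>" for t \<omega> by (simp add: L'_def)
  qed
  then show thesis
    using B'B L'L by (intro that) (auto elim: eventually_mono)
qed

lemma distr_eq_skew_law:
  assumes "skew_brownian_motion M W \<alpha> x B L" "0 < \<alpha>" "\<alpha> < 1" "0 < t"
  shows "distr M (borel \<Otimes>\<^sub>M borel) (\<lambda>\<omega>. (B t \<omega>, L t \<omega>)) = skew_law t \<alpha> x"
proof -
  obtain B' L' where BL: "skew_continuous M W \<alpha> x B' L'"
    "AE \<omega> in M. B' t \<omega> = B t \<omega>" "AE \<omega> in M. L' t \<omega> = L t \<omega>"
    using skew_continuous_modification[OF assms(1)] assms(4) by (metis less_imp_le)
  interpret S: skew_brownian_motion M W \<alpha> x B L by fact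
  interpret C: skew_continuous M W \<alpha> x B' L' by fact
  have [measurable]: "B t \<in> borel_measurable M" "L t \<in> borel_measurable M" "B' t \<in> borel_measurable M" "L' t \<in> borel_measurable M"
    using S.filtration_measurable_M[OF S.B_adapted] S.local_time_measurable C.B_measurable C.local_time_measurable assms(4) by auto
  have "distr M (borel \<Otimes>\<^sub>M borel) (\<lambda>\<omega>. (B t \<omega>, L t \<omega>)) = distr M (borel \<Otimes>\<^sub>M borel) (\<lambda>\<omega>. (B' t \<omega>, L' t \<omega>))"
    using BL(2,3) by (intro distr_cong_AE) auto
  also have "\<dots> = skew_law t \<alpha> x" by (rule C.joint_law_eq_skew_law[OF assms(4,2,3)])
  finally show ?thesis .
qed

section \<open>The law on the two half planes\<close>

lemma skew_law_nonpos_side: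
  assumes "0 < t" "0 < \<alpha>" "\<alpha> < 1" and C: "C \<in> sets (borel \<Otimes>\<^sub>M borel)" "C \<subseteq> {..0} \<times> {0..}"
  shows "emeasure (skew_law t \<alpha> x) C =
    (\<integral>\<^sup>+y. (\<integral>\<^sup>+l. ennreal (2 * (1 - \<alpha>) * hitting_density t (l - y + \<bar>x\<bar>)) * indicator C (y, l) \<partial>lborel) \<partial>lborel)
    + (\<integral>\<^sup>+y. ennreal (killed_heat t x y) * indicator C (y, 0) \<partial>lborel)"
proof -
  have "ennreal (2 * side_weight \<alpha> y * hitting_density t (l + (\<bar>y\<bar> + \<bar>x\<bar>)) * indicator {0..} l) * indicator C (y, l)
      = ennreal (2 * (1 - \<alpha>) * hitting_density t (l - y + \<bar>x\<bar>)) * indicator C (y, l)" for y l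
  proof (cases "(y, l) \<in> C")
    case True
    then have "y \<le> 0" "0 \<le> l" using C(2) by auto
    then show ?thesis by (simp add: side_weight_def algebra_simps)
  qed simp
  then show ?thesis unfolding emeasure_skew_law[OF assms(1-3) C(1)] by simp
qed

lemma skew_law_nonneg_side:
  assumes "0 < t" "0 < \<alpha>" "\<alpha> < 1" and C: "C \<in> sets (borel \<Otimes>\<^sub>M borel)" "C \<subseteq> {0..} \<times> {0..}"
  shows "emeasure (skew_law t \<alpha> x) C =
    (\<integral>\<^sup>+y. (\<integral>\<^sup>+l. ennreal (2 * \<alpha> * hitting_density t (l + y + \<bar>x\<bar>)) * indicator C (y, l) \<partial>lborel) \<partial>lborel)
    + (\<integral>\<^sup>+y. ennreal (killed_heat t x y) * indicator C (y, 0) \<partial>lborel)"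
proof -
  \<comment> \<open>At y = 0 the side weight is 1 - \<alpha>, so the identity is claimed only off
    this null line.\<close>
  have eq: "ennreal (2 * side_weight \<alpha> y * hitting_density t (l + (\<bar>y\<bar> + \<bar>x\<bar>)) * indicator {0..} l) * indicator C (y, l)
      = ennreal (2 * \<alpha> * hitting_density t (l + y + \<bar>x\<bar>)) * indicator C (y, l)" if "y \<noteq> 0" for y l
  proof (cases "(y, l) \<in> C")
    case True
    then have "0 < y" "0 \<le> l" using C(2) that by auto
    then show ?thesis by (simp add: side_weight_def algebra_simps)
  qed simp
  have "(\<integral>\<^sup>+y. (\<integral>\<^sup>+l. ennreal (2 * side_weight \<alpha> y * hitting_density t (l + (\<bar>y\<bar> + \<bar>x\<bar>)) * indicator {0..} l) * indicator C (y, l) \<partial>lborel) \<partial>lborel)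
      = (\<integral>\<^sup>+y. (\<integral>\<^sup>+l. ennreal (2 * \<alpha> * hitting_density t (l + y + \<bar>x\<bar>)) * indicator C (y, l) \<partial>lborel) \<partial>lborel)"
    by (rule nn_integral_cong_AE, use AE_lborel_singleton[of "0::real"] in eventually_elim) (intro nn_integral_cong, rule eq)
  then show ?thesis unfolding emeasure_skew_law[OF assms(1-3) C(1)] by simp
qed

text \<open>The conversion \<open>ennreal\<close> sends negative numbers to 0, just as the maximum
  in \<open>killed_heat\<close> does, so the plain difference of heat kernels can stand under the
  integral.\<close>

lemma nn_integral_atom:
  fixes C :: "(real \<times> real) set"
  assumes [measurable]: "C \<in> sets (borel \<Otimes>\<^sub>M borel)"
  shows "(\<integral>\<^sup>+l. ennreal (heat t (y - x) - heat t (y + x)) * indicator C (y, l) \<partial>return borel 0) = ennreal (killed_heat t x y) * indicator C (y, 0)"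
proof -
  have "ennreal (killed_heat t x y) = ennreal (heat t (y - x) - heat t (y + x))"
    by (auto simp: killed_heat_def max_def ennreal_neg)
  moreover have "(\<lambda>l. ennreal (heat t (y - x) - heat t (y + x)) * indicator C (y, l)) \<in> borel_measurable borel" by measurable
  ultimately show ?thesis by (subst nn_integral_return) auto
qed

theorem corollary3p3:
  fixes M :: "'a measure" and W B L :: "real \<Rightarrow> 'a \<Rightarrow> real" and \<alpha> x t :: real
  assumes "0 < \<alpha>" "\<alpha> < 1" "0 < t"
    and "skew_brownian_motion M W \<alpha> x B L"
  defines "\<mu> \<equiv> distr M (borel \<Otimes>\<^sub>M borel) (\<lambda>\<omega>. (B t \<omega>, L t \<omega>))"
  shows "(AE (y, l) in \<mu>. 0 \<le> l) \<and>
    (0 \<le> x \<longrightarrow>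
      (\<forall>C \<in> sets (borel \<Otimes>\<^sub>M borel). C \<subseteq> {..0} \<times> {0..} \<longrightarrow>
        emeasure \<mu> C =
          (\<integral>\<^sup>+ y. (\<integral>\<^sup>+ l. ennreal (2 * (1 - \<alpha>) * (l - y + x) / sqrt (2 * pi * t ^ 3)
              * exp (- ((l - y + x)\<^sup>2 / (2 * t)))) * indicator C (y, l) \<partial>lborel) \<partial>lborel)) \<and>
      (\<forall>C \<in> sets (borel \<Otimes>\<^sub>M borel). C \<subseteq> {0..} \<times> {0..} \<longrightarrow>
        emeasure \<mu> C =
          (\<integral>\<^sup>+ y. (\<integral>\<^sup>+ l. ennreal (2 * \<alpha> * (l + y + x) / sqrt (2 * pi * t ^ 3)
              * exp (- ((l + y + x)\<^sup>2 / (2 * t)))) * indicator C (y, l) \<partial>lborel) \<partial>lborel)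
          + (\<integral>\<^sup>+ y. (\<integral>\<^sup>+ l. ennreal (1 / sqrt (2 * pi * t)
              * (exp (- ((y - x)\<^sup>2 / (2 * t))) - exp (- ((y + x)\<^sup>2 / (2 * t)))))
              * indicator C (y, l) \<partial>return borel 0) \<partial>lborel))) \<and>
    (x \<le> 0 \<longrightarrow>
      (\<forall>C \<in> sets (borel \<Otimes>\<^sub>M borel). C \<subseteq> {0..} \<times> {0..} \<longrightarrow>
        emeasure \<mu> C =
          (\<integral>\<^sup>+ y. (\<integral>\<^sup>+ l. ennreal (2 * \<alpha> * (l + y - x) / sqrt (2 * pi * t ^ 3)
              * exp (- ((l + y - x)\<^sup>2 / (2 * t)))) * indicator C (y, l) \<partial>lborel) \<partial>lborel)) \<and>
      (\<forall>C \<in> sets (borel \<Otimes>\<^sub>M borel). C \<subseteq> {..0} \<times> {0..} \<longrightarrow>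
        emeasure \<mu> C =
          (\<integral>\<^sup>+ y. (\<integral>\<^sup>+ l. ennreal (2 * (1 - \<alpha>) * (l - y - x) / sqrt (2 * pi * t ^ 3)
              * exp (- ((l - y - x)\<^sup>2 / (2 * t)))) * indicator C (y, l) \<partial>lborel) \<partial>lborel)
          + (\<integral>\<^sup>+ y. (\<integral>\<^sup>+ l. ennreal (1 / sqrt (2 * pi * t)
              * (exp (- ((y - x)\<^sup>2 / (2 * t))) - exp (- ((y + x)\<^sup>2 / (2 * t)))))
              * indicator C (y, l) \<partial>return borel 0) \<partial>lborel)))"
proof -
  have \<mu>: "\<mu> = skew_law t \<alpha> x"
    unfolding \<mu>_def by (rule distr_eq_skew_law[OF assms(4,1,2,3)])
  have hd': "2 * a * z / sqrt (2 * pi * t ^ 3) * exp (- (z\<^sup>2 / (2 * t))) = 2 * a * hitting_density t z" for a z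
    by (simp add: hitting_density_def)
  have heat': "1 / sqrt (2 * pi * t) * (exp (- ((y - x)\<^sup>2 / (2 * t))) - exp (- ((y + x)\<^sup>2 / (2 * t)))) = heat t (y - x) - heat t (y + x)" for y
    by (simp add: heat_def right_diff_distrib)
  note law = skew_law_nonpos_side[OF assms(3,1,2)] skew_law_nonneg_side[OF assms(3,1,2)]
  \<comment> \<open>On the side opposite to x the killed density vanishes: the path has to cross 0,
    so there is no atom at l = 0.\<close>
  have killed: "(\<integral>\<^sup>+y. ennreal (killed_heat t x y) * indicator C (y, 0) \<partial>lborel) = 0"
    if "\<And>y. (y, 0) \<in> C \<Longrightarrow> x * y \<le> 0" for C :: "(real \<times> real) set"
  proof -
    have pt: "ennreal (killed_heat t x y) * indicator C (y, 0) = 0" for y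
      using that[of y] killed_heat_cases(2)[OF assms(3), of x y] by (auto simp: indicator_def)
    have "(\<integral>\<^sup>+y. ennreal (killed_heat t x y) * indicator C (y, 0) \<partial>lborel) = (\<integral>\<^sup>+(y::real). 0 \<partial>lborel)"
      by (intro nn_integral_cong pt)
    then show ?thesis by simp
  qed
  show ?thesis
    unfolding hd' heat'
  proof (intro conjI impI ballI)
    show "AE (y, l) in \<mu>. 0 \<le> l" unfolding \<mu> by (rule skew_law_AE[OF assms(3,1,2)])
  next
    fix C :: "(real \<times> real) set" assume "0 \<le> x" and C: "C \<in> sets (borel \<Otimes>\<^sub>M borel)" "C \<subseteq> {..0} \<times> {0..}"
    have "(\<integral>\<^sup>+y. ennreal (killed_heat t x y) * indicator C (y, 0) \<partial>lborel) = 0"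
      using C(2) \<open>0 \<le> x\<close> by (intro killed mult_nonneg_nonpos) auto
    then show "emeasure \<mu> C = (\<integral>\<^sup>+y. (\<integral>\<^sup>+l. ennreal (2 * (1 - \<alpha>) * hitting_density t (l - y + x)) * indicator C (y, l) \<partial>lborel) \<partial>lborel)"
      unfolding \<mu> law(1)[OF C] using \<open>0 \<le> x\<close> by simp
  next
    fix C :: "(real \<times> real) set" assume "0 \<le> x" and C: "C \<in> sets (borel \<Otimes>\<^sub>M borel)" "C \<subseteq> {0..} \<times> {0..}"
    show "emeasure \<mu> C = (\<integral>\<^sup>+y. (\<integral>\<^sup>+l. ennreal (2 * \<alpha> * hitting_density t (l + y + x)) * indicator C (y, l) \<partial>lborel) \<partial>lborel)
        + (\<integral>\<^sup>+y. (\<integral>\<^sup>+l. ennreal (heat t (y - x) - heat t (y + x)) * indicator C (y, l) \<partial>return borel 0) \<partial>lborel)"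
      unfolding \<mu> law(2)[OF C] nn_integral_atom[OF C(1)] using \<open>0 \<le> x\<close> by simp
  next
    fix C :: "(real \<times> real) set" assume "x \<le> 0" and C: "C \<in> sets (borel \<Otimes>\<^sub>M borel)" "C \<subseteq> {0..} \<times> {0..}"
    have "(\<integral>\<^sup>+y. ennreal (killed_heat t x y) * indicator C (y, 0) \<partial>lborel) = 0"
      using C(2) \<open>x \<le> 0\<close> by (intro killed mult_nonpos_nonneg) auto
    then show "emeasure \<mu> C = (\<integral>\<^sup>+y. (\<integral>\<^sup>+l. ennreal (2 * \<alpha> * hitting_density t (l + y - x)) * indicator C (y, l) \<partial>lborel) \<partial>lborel)"
      unfolding \<mu> law(2)[OF C] using \<open>x \<le> 0\<close> by simp
  next
    fix C :: "(real \<times> real) set" assume "x \<le> 0" and C: "C \<in> sets (borel \<Otimes>\<^sub>M borel)" "C \<subseteq> {..0} \<times> {0..}"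
    show "emeasure \<mu> C = (\<integral>\<^sup>+y. (\<integral>\<^sup>+l. ennreal (2 * (1 - \<alpha>) * hitting_density t (l - y - x)) * indicator C (y, l) \<partial>lborel) \<partial>lborel)
        + (\<integral>\<^sup>+y. (\<integral>\<^sup>+l. ennreal (heat t (y - x) - heat t (y + x)) * indicator C (y, l) \<partial>return borel 0) \<partial>lborel)"
      unfolding \<mu> law(1)[OF C] nn_integral_atom[OF C(1)] using \<open>x \<le> 0\<close> by simp
  qed
qed

end
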